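(* Let $k \geq 2$ be an integer. For an integer $N \geq 2$ and real $\alpha$ put $$S_k(\alpha) = \sum_{n \leq N} \mu_k(n) e(\alpha n), \qquad I_k(p) = \int_0^1 |S_k(\alpha)|^p \, d\alpha \quad (p \geq 0).$$ Then, with implied constants depending only on $k$ and $p$ (and not on $N$), for all $N \geq 2$: $$N^{p-1} \ll I_k(p) \ll N^{p-1} \quad \text{for } p > 1 + 1/k,$$ $$N^{1/k}\log N \ll I_k(p) \ll N^{1/k}(\log N)^2 \quad \text{for } p = 1 + 1/k,$$ $$N^{p/(k+1)} \ll I_k(p) \ll N^{p/(k+1)} \quad \text{for } 0 \leq p < 1 + 1/k.$$
   Context: $\mu_k$ denotes the indicator function of $k$-free numbers: $\mu_k(n) = 1$ if there is no integer $d > 1$ with $d^k \mid n$, and $\mu_k(n) = 0$ otherwise. $e(x) = \exp(2\pi i x)$. The notation $f \ll g$ means $|f| \leq C g$ for some constant $C > 0$. *)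

theory Defs
  imports "HOL-Analysis.Analysis"
begin

definition mu_k :: "nat \<Rightarrow> nat \<Rightarrow> real" where
  "mu_k k n = (if \<exists>d>1. d ^ k dvd n then 0 else 1)"

definition e_exp :: "real \<Rightarrow> complex" where
  "e_exp x = exp (2 * of_real pi * \<i> * of_real x)"

definition S_k :: "nat \<Rightarrow> nat \<Rightarrow> real \<Rightarrow> complex" where
  "S_k k N \<alpha> = (\<Sum>n = 1..N. of_real (mu_k k n) * e_exp (\<alpha> * real n))"

(* For p = 0 the convention 0 powr 0 = 0 is harmless: for k, N > 0 the trigonometric polynomial
   S_k k N is not identically zero, so it has only finitely many zeros in [0, 1]. *)
definition I_k :: "nat \<Rightarrow> nat \<Rightarrow> real \<Rightarrow> real" where
  "I_k k N p = integral {0..1} (\<lambda>\<alpha>. norm (S_k k N \<alpha>) powr p)"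

(* Vinogradov's f << g, uniformly on A; the constant may depend on all other
   variables occurring in f and g. *)
definition ll_on :: "nat set \<Rightarrow> (nat \<Rightarrow> real) \<Rightarrow> (nat \<Rightarrow> real) \<Rightarrow> bool" where
  "ll_on A f g \<longleftrightarrow> (\<exists>C>0. \<forall>N\<in>A. \<bar>f N\<bar> \<le> C * g N)"

end

theory Submission
  imports Defs "HOL-Computational_Algebra.Squarefree"
begin

text \<open>
  Write \<open>\<mu>\<^sub>k(n)\<close> as the sum of the Moebius function over all \<open>d\<close> with \<open>d\<^sup>k | n\<close> and split \<open>d\<close> into dyadic blocks
  \<open>D \<le> d < 2 D\<close>. Put \<open>y = N^(1/(k+1))\<close>. By Parseval the block has mean square \<open>O(N D^(1-k))\<close>, so the blocks with
  \<open>D > y\<close> contribute \<open>O(y)\<close> in \<open>L\<^sup>2\<close>. A block with \<open>D \<le> y\<close> is a sum of \<open>D\<close> Dirichlet kernels and so, after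
  smoothing, has \<open>L\<^sup>1\<close> norm \<open>O(D (1 + log (y / D)))\<close>. Interpolating between \<open>L\<^sup>1\<close> (above the critical exponent:
  \<open>L\<^sup>q\<close> with \<open>q > 1\<close> close to \<open>1\<close>) and \<open>L\<^sup>2\<close> gives \<open>p\<close>-th moments of order \<open>N^(p-1) D^(1-k(p-1))\<close> up to logarithms; the sum
  over \<open>D\<close> is dominated by \<open>D = 1\<close> or by \<open>D = y\<close> according to the sign of \<open>1 - k (p - 1)\<close>.

  For the lower bounds, sum the exponential sum over the shifts by \<open>a / d\<^sup>k\<close>, where no \<open>f > 1\<close> dividing \<open>d\<close>
  satisfies \<open>f\<^sup>k | a\<close>. The result is exactly \<open>\<mu>(d)\<close> times the unshifted sum, which has size \<open>N\<close> on an arc of length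
  \<open>1 / (6 N)\<close>. At the critical exponent the arcs with \<open>d \<le> N^(1/(2k))\<close> are disjoint, and each squarefree \<open>d\<close>
  contributes \<open>N^(1/k) / d\<close>. For \<open>p = 1\<close> one uses all squarefree \<open>d\<close> up to a small multiple \<open>P\<close> of \<open>y\<close>. The arcs
  may then overlap, but on average rarely: the loss is controlled by the mean square of the part of the
  sum with \<open>d \<ge> P / K\<close>, and the part with \<open>d < P / K\<close> is small in \<open>L\<^sup>1\<close>. Hoelder's inequality transfers the
  bound from \<open>p = 1\<close> to all \<open>p\<close> below the critical exponent.
\<close>

subsection \<open>Exponentials and moments\<close>

text \<open>The cut y is where two mean squares agree: N D^(1-k) of a block and D^2 of the flanks
  that smoothing adds are equal at D^(k+1) = N. What is neglected is then O(y^p) for every p <= 2,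
  which all three upper bounds tolerate. Without smoothing each kernel would cost log N in L^1, too
  much below the critical exponent. At the critical exponent all O(log N) blocks have the same size:
  Minkowski gives (log N)^p, the L^1 logarithms give (log N)^(2-p), together (log N)^2. Above it a
  logarithm at D = 1 would already be fatal, hence the detour through q > 1.

  For p = 1 from below, the mean square of the full sum, of order N, is too large to control
  overlapping arcs; dropping the divisors below D = P / K lowers it to N D^(1-k). The shift identity
  survives, because summing a progression of step d'^k over the shifts of a d that does not divide
  d' leaves only O(d^k). With y about D K^3 the dropped part is O(D (y / D)^(1/4)) in L^1, and a
  large constant K makes it, like the other losses, small against P.\<close>

lemma e_exp_cis: "e_exp x = cis (2 * pi * x)"
  by (simp add: e_exp_def cis_conv_exp mult_ac)

lemma e_exp_add: "e_exp (x + y) = e_exp x * e_exp y"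
  by (simp add: e_exp_cis cis_mult ring_distribs)

lemma e_exp_diff: "e_exp (x - y) = e_exp x * e_exp (- y)"
  using e_exp_add[of x "- y"] by simp

lemma norm_e_exp [simp]: "norm (e_exp x) = 1"
  by (simp add: e_exp_cis)

lemma e_exp_0 [simp]: "e_exp 0 = 1"
  by (simp add: e_exp_def)

lemma e_exp_of_int [simp]: "e_exp (of_int n) = 1"
  by (simp add: e_exp_cis cis_multiple_2pi)

lemma e_exp_of_nat [simp]: "e_exp (real n) = 1"
  using e_exp_of_int[of "int n"] by simp

lemma cnj_e_exp: "cnj (e_exp x) = e_exp (- x)"
  by (simp add: e_exp_cis cis_cnj)

lemma e_exp_eq_1_iff: "e_exp x = 1 \<longleftrightarrow> x \<in> \<int>"
proof
  assume "e_exp x = 1"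
  then have "exp (2 * of_real pi * \<i> * of_real x) = 1" by (simp add: e_exp_def)
  then obtain n :: int where "2 * pi * x = of_int (2 * n) * pi"
    by (auto simp: exp_eq_1)
  then have "x = of_int n" by simp
  then show "x \<in> \<int>" by simp
qed (auto elim!: Ints_cases)

lemma e_exp_power: "e_exp x ^ n = e_exp (real n * x)"
  by (induction n) (auto simp: e_exp_add ring_distribs)

lemma continuous_on_e_exp [continuous_intros]:
  "continuous_on A f \<Longrightarrow> continuous_on A (\<lambda>x. e_exp (f x))"
  unfolding e_exp_def by (intro continuous_intros)

lemma norm_e_exp_diff_le: "norm (e_exp x - e_exp y) \<le> 2 * pi * \<bar>x - y\<bar>"
proof -
  have "norm (e_exp x - e_exp y) = norm (cis (2 * pi * x) - cis (2 * pi * y))"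
    by (simp add: e_exp_cis)
  also have "\<dots> = norm (cis (2 * pi * y) * (cis (2 * pi * x - 2 * pi * y) - 1))"
    by (simp add: right_diff_distrib' cis_mult)
  also have "\<dots> = 2 * \<bar>sin ((2 * pi * x - 2 * pi * y) / 2)\<bar>"
    using dist_exp_i_1[of "2 * pi * x - 2 * pi * y"] by (simp add: norm_mult cis_conv_exp)
  also have "\<dots> \<le> 2 * \<bar>(2 * pi * x - 2 * pi * y) / 2\<bar>"
    using abs_sin_x_le_abs_x[of "(2 * pi * x - 2 * pi * y) / 2"] by linarith
  also have "\<dots> = \<bar>2 * pi * x - 2 * pi * y\<bar>" by simp
  also have "\<dots> = 2 * pi * \<bar>x - y\<bar>"
    by (simp add: abs_mult flip: right_diff_distrib)
  finally show ?thesis .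
qed

lemma has_integral_e_exp:
  "((\<lambda>\<alpha>. e_exp (\<alpha> * of_int n)) has_integral (if n = 0 then 1 else 0)) {0..1}"
proof (cases "n = 0")
  case True
  then show ?thesis using has_integral_const_real[of "1::complex" 0 1] by simp
next
  case False
  define c where "c = 2 * of_real pi * \<i> * (of_int n :: complex)"
  have c: "c \<noteq> 0" using False by (simp add: c_def)
  have "((\<lambda>\<alpha>. exp (c * of_real \<alpha>)) has_integral (exp (c * of_real 1) / c - exp (c * of_real 0) / c)) {0..1}"
  proof (rule fundamental_theorem_of_calculus)
    fix x :: real
    have "((\<lambda>z. exp (c * z) / c) has_field_derivative exp (c * of_real x)) (at (of_real x))"
      using c by (auto intro!: derivative_eq_intros)
    then have "((\<lambda>x. exp (c * of_real x) / c) has_vector_derivative exp (c * of_real x)) (at x)"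
      by (rule has_vector_derivative_real_field)
    then show "((\<lambda>x. exp (c * of_real x) / c) has_vector_derivative exp (c * of_real x)) (at x within {0..1})"
      by (rule has_vector_derivative_at_within)
  qed simp
  moreover have "exp (c * of_real 1) = 1"
    using e_exp_of_int[of n] by (simp add: e_exp_def c_def)
  moreover have "exp (c * of_real \<alpha>) = e_exp (\<alpha> * of_int n)" for \<alpha>
    by (simp add: e_exp_def c_def mult_ac)
  ultimately show ?thesis using False by simp
qed

text \<open>The frequencies may repeat. After expanding the square only pairs of equal frequency
  survive, each of weight at most 1, so mean squares become counting problems.\<close>

lemma parseval_le:
  fixes b :: "'a \<Rightarrow> complex" and \<nu> :: "'a \<Rightarrow> int"
  assumes X: "finite X" and b: "\<And>x. x \<in> X \<Longrightarrow> norm (b x) \<le> 1"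
  shows "integral {0..1} (\<lambda>\<alpha>. (norm (\<Sum>x\<in>X. b x * e_exp (\<alpha> * of_int (\<nu> x))))\<^sup>2)
       \<le> real (card {(x, x') \<in> X \<times> X. \<nu> x = \<nu> x'})"
proof -
  let ?f = "\<lambda>\<alpha>. \<Sum>x\<in>X. b x * e_exp (\<alpha> * of_int (\<nu> x))"
  define I where "I = (\<Sum>x\<in>X. \<Sum>x'\<in>X. b x * cnj (b x') * (if \<nu> x - \<nu> x' = 0 then 1 else 0))"
  have eq: "of_real ((norm (?f \<alpha>))\<^sup>2) = (\<Sum>x\<in>X. \<Sum>x'\<in>X. b x * cnj (b x') * e_exp (\<alpha> * of_int (\<nu> x - \<nu> x')))" for \<alpha>
  proof -
    have "of_real ((norm (?f \<alpha>))\<^sup>2) = ?f \<alpha> * cnj (?f \<alpha>)"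
      by (rule complex_norm_square)
    also have "\<dots> = (\<Sum>x\<in>X. \<Sum>x'\<in>X. (b x * e_exp (\<alpha> * of_int (\<nu> x))) * (cnj (b x') * e_exp (- (\<alpha> * of_int (\<nu> x')))))"
      by (simp add: sum_product cnj_e_exp)
    also have "\<dots> = (\<Sum>x\<in>X. \<Sum>x'\<in>X. b x * cnj (b x') * e_exp (\<alpha> * of_int (\<nu> x - \<nu> x')))"
      by (intro sum.cong refl) (simp add: right_diff_distrib' e_exp_diff)
    finally show ?thesis .
  qed
  have "((\<lambda>\<alpha>. of_real ((norm (?f \<alpha>))\<^sup>2)) has_integral I) {0..1}"
    unfolding eq I_def
    by (intro has_integral_sum X has_integral_mult_right has_integral_e_exp)
  then have "((\<lambda>\<alpha>. Re (of_real ((norm (?f \<alpha>))\<^sup>2))) has_integral Re I) {0..1}"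
    by (rule has_integral_linear[OF _ bounded_linear_Re, unfolded o_def])
  then have "integral {0..1} (\<lambda>\<alpha>. (norm (?f \<alpha>))\<^sup>2) = Re I"
    by (simp add: integral_unique)
  also have "\<dots> \<le> norm I" by (rule complex_Re_le_cmod)
  also have "\<dots> \<le> (\<Sum>x\<in>X. \<Sum>x'\<in>X. (if \<nu> x = \<nu> x' then 1 else 0))"
    unfolding I_def
  proof (intro sum_norm_le)
    fix x x' assume "x \<in> X" "x' \<in> X"
    then show "norm (b x * cnj (b x') * (if \<nu> x - \<nu> x' = 0 then 1 else 0)) \<le> (if \<nu> x = \<nu> x' then 1 else 0)"
      using mult_mono[OF b[of x] b[of x']] by (simp add: norm_mult)
  qed
  also have "\<dots> = real (card {(x, x') \<in> X \<times> X. \<nu> x = \<nu> x'})"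
  proof -
    have "(\<Sum>x\<in>X. \<Sum>x'\<in>X. (if \<nu> x = \<nu> x' then 1 else 0::real)) = (\<Sum>z\<in>X \<times> X. if (case z of (x,x') \<Rightarrow> \<nu> x = \<nu> x') then 1 else 0)"
      by (simp add: sum.cartesian_product case_prod_unfold)
    also have "\<dots> = (\<Sum>z\<in>{z \<in> X \<times> X. case z of (x,x') \<Rightarrow> \<nu> x = \<nu> x'}. 1)"
      by (subst sum.inter_filter[symmetric]) (use X in auto)
    also have "{z \<in> X \<times> X. case z of (x,x') \<Rightarrow> \<nu> x = \<nu> x'} = {(x, x') \<in> X \<times> X. \<nu> x = \<nu> x'}"
      by auto
    finally show ?thesis by simp
  qed
  finally show ?thesis .
qed

section \<open>Moments and inequalities of Hoelder and Minkowski type\<close>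

definition moment :: "real \<Rightarrow> (real \<Rightarrow> complex) \<Rightarrow> real" where
  "moment p f = integral {0..1} (\<lambda>\<alpha>. norm (f \<alpha>) powr p)"

lemma integrable_norm_powr:
  fixes f :: "real \<Rightarrow> complex"
  assumes f: "continuous_on {a..b} f" and p: "p \<ge> 0"
  shows "(\<lambda>\<alpha>. norm (f \<alpha>) powr p) integrable_on {a..b}"
proof -
  have "bounded (f ` {a..b})"
    using f by (intro compact_imp_bounded compact_continuous_image) auto
  then obtain B where B: "\<And>x. x \<in> {a..b} \<Longrightarrow> norm (f x) \<le> B"
    unfolding bounded_iff by blast
  show ?thesis
  proof (rule measurable_bounded_by_integrable_imp_integrable_real)
    have "f \<in> borel_measurable (lebesgue_on {a..b})"
      by (intro continuous_imp_measurable_on_sets_lebesgue f) auto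
    then show "(\<lambda>\<alpha>. norm (f \<alpha>) powr p) \<in> borel_measurable (lebesgue_on {a..b})"
      by measurable
    show "(\<lambda>_. B powr p) integrable_on {a..b}" by (rule integrable_const_ivl)
    show "\<bar>norm (f x) powr p\<bar> \<le> B powr p" if "x \<in> {a..b}" for x
      using B[OF that] p by (auto intro!: powr_mono2)
  qed auto
qed

lemma moment_nonneg: "moment p f \<ge> 0"
  unfolding moment_def by (cases "(\<lambda>\<alpha>. norm (f \<alpha>) powr p) integrable_on {0..1}")
    (auto intro: integral_nonneg simp: not_integrable_integral)

lemma moment_mono:
  assumes "continuous_on {0..1} f" "continuous_on {0..1} g" "p \<ge> 0"
    and "\<And>x. x \<in> {0..1} \<Longrightarrow> norm (f x) \<le> norm (g x)"
  shows "moment p f \<le> moment p g"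
  unfolding moment_def using assms
  by (intro integral_le integrable_norm_powr) (auto intro!: powr_mono2)

lemma moment_minus: "moment p (\<lambda>x. - f x) = moment p f"
  by (simp add: moment_def)

lemma moment_2: "moment 2 f = integral {0..1} (\<lambda>\<alpha>. (norm (f \<alpha>))\<^sup>2)"
  unfolding moment_def
  by (intro arg_cong[where f = "integral {0..1}"] ext) (simp add: powr_numeral)

lemma moment_1: "moment 1 f = integral {0..1} (\<lambda>\<alpha>. norm (f \<alpha>))"
  by (simp add: moment_def)

lemma powr_mult_le_weighted:
  fixes x y a b :: real
  assumes "a \<ge> 0" "b \<ge> 0" "a + b = 1" "x \<ge> 0" "y \<ge> 0"
  shows "x powr a * y powr b \<le> a * x + b * y"
proof (cases "x = 0 \<or> y = 0")
  \<comment> \<open>Here \<open>0 powr a = 0\<close> even for a = 0, so the left side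
    vanishes.\<close>
  case True
  then show ?thesis using assms by auto
next
  case False
  then show ?thesis using Youngs_inequality_0[of a b x y] assms by auto
qed

text \<open>Log-convexity of the moments in the exponent (Hoelder). Positive upper bounds
  \<open>A\<close> and \<open>B\<close> replace the moments themselves, so that one can normalise by
  them and apply the weighted inequality of the means pointwise.\<close>

lemma moment_interpolate:
  assumes f: "continuous_on {0..1} f" and q: "q \<ge> 0" and s: "s \<ge> 0"
    and ab: "a \<ge> 0" "b \<ge> 0" "a + b = 1" and p: "p = a * q + b * s"
    and A: "moment q f \<le> A" "A > 0" and B: "moment s f \<le> B" "B > 0"
  shows "moment p f \<le> A powr a * B powr b"
proof -
  have p0: "p \<ge> 0" using p q s ab by auto
  let ?u = "\<lambda>r x. norm (f x) powr r"
  have int: "?u r integrable_on {0..1}" if "r \<ge> 0" for r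
    by (rule integrable_norm_powr[OF f that])
  have pt: "?u p x \<le> A powr a * B powr b * (a * (?u q x / A) + b * (?u s x / B))" for x
  proof -
    have "?u p x = ?u q x powr a * ?u s x powr b"
      by (simp add: p powr_powr powr_add mult.commute)
    also have "\<dots> = A powr a * B powr b * ((?u q x / A) powr a * (?u s x / B) powr b)"
      using A B by (simp add: powr_divide)
    also have "\<dots> \<le> A powr a * B powr b * (a * (?u q x / A) + b * (?u s x / B))"
      using ab A B by (intro mult_left_mono powr_mult_le_weighted) auto
    finally show ?thesis .
  qed
  have "moment p f \<le> integral {0..1} (\<lambda>x. A powr a * B powr b * (a * (?u q x / A) + b * (?u s x / B)))"
    unfolding moment_def
    by (intro integral_le pt int p0 integrable_on_mult_right integrable_add integrable_on_divide q s)
  also have "\<dots> = A powr a * B powr b * (a * (moment q f / A) + b * (moment s f / B))"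
    unfolding moment_def using int[OF q] int[OF s]
    by (simp add: integral_add integrable_on_mult_right integrable_on_divide)
  also have "\<dots> \<le> A powr a * B powr b * (a * 1 + b * 1)"
    using A B ab by (intro mult_left_mono add_mono) auto
  finally show ?thesis using ab by simp
qed

text \<open>Interpolation with exponent 0: \<open>moment 0 f\<close> is the measure of the set where
  f does not vanish, hence at most 1.\<close>

lemma moment_lyapunov:
  assumes f: "continuous_on {0..1} f" and pq: "0 \<le> p" "p \<le> q" "q > 0"
    and A: "moment q f \<le> A" "A > 0"
  shows "moment p f \<le> A powr (p / q)"
proof -
  have "moment 0 f \<le> integral {0..1} (\<lambda>_::real. 1)"
    unfolding moment_def by (intro integral_le integrable_norm_powr f integrable_const_ivl) auto
  then have "moment 0 f \<le> 1" by simp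
  then have "moment p f \<le> A powr (p / q) * 1 powr (1 - p / q)"
    using pq A by (intro moment_interpolate[where q = q and s = 0] f) auto
  then show ?thesis by simp
qed

text \<open>The convex function t^p lies above its tangent at 1.\<close>

lemma powr_tangent_le:
  fixes t p :: real
  assumes "p \<ge> 1" "t \<ge> 0"
  shows "1 + p * (t - 1) \<le> t powr p"
proof -
  have "(t powr p) powr (1/p) * 1 powr (1 - 1/p) \<le> 1/p * t powr p + (1 - 1/p) * 1"
    using assms by (intro powr_mult_le_weighted) auto
  then have "t \<le> 1/p * t powr p + (1 - 1/p)"
    using assms by (simp add: powr_powr)
  then have "p * t \<le> p * (1/p * t powr p + (1 - 1/p))"
    using assms by (intro mult_left_mono) auto
  also have "\<dots> = t powr p + (p - 1)"
    using assms by (simp add: field_simps)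
  finally show ?thesis by (simp add: algebra_simps)
qed

text \<open>Jensen's inequality for the power p with weights \<open>w i\<close>, applied to
  \<open>t i / w i\<close>. The free weights are what makes Minkowski's inequality a pointwise
  consequence.\<close>

lemma powr_sum_le:
  fixes w t :: "'a \<Rightarrow> real"
  assumes S: "finite S" and w: "\<And>i. i \<in> S \<Longrightarrow> w i > 0" and t: "\<And>i. i \<in> S \<Longrightarrow> t i \<ge> 0" and p: "p \<ge> 1"
  shows "(\<Sum>i\<in>S. t i) powr p \<le> (\<Sum>i\<in>S. w i) powr (p - 1) * (\<Sum>i\<in>S. w i powr (1 - p) * t i powr p)"
proof (cases "(\<Sum>i\<in>S. t i) = 0")
  case True
  then show ?thesis by (auto intro!: mult_nonneg_nonneg sum_nonneg)
next
  case False
  define m where "m = (\<Sum>i\<in>S. t i)"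
  define W where "W = (\<Sum>i\<in>S. w i)"
  have m: "m > 0" using False t unfolding m_def by (simp add: sum_nonneg order_less_le)
  have "S \<noteq> {}" using False by auto
  then have W: "W > 0" unfolding W_def using S w by (intro sum_pos) auto
  \<comment> \<open>The ratios \<open>W * t i / (m * w i)\<close> have weighted mean 1, so the
    tangents at 1 add up to exactly \<open>W\<close>.\<close>
  have "W = (\<Sum>i\<in>S. w i * (1 + p * (W * t i / (m * w i) - 1)))"
  proof -
    have "(\<Sum>i\<in>S. w i * (1 + p * (W * t i / (m * w i) - 1))) = (\<Sum>i\<in>S. (1 - p) * w i + (p * W / m) * t i)"
    proof (intro sum.cong refl)
      fix i assume "i \<in> S"
      then have "w i > 0" by (rule w)
      then show "w i * (1 + p * (W * t i / (m * w i) - 1)) = (1 - p) * w i + (p * W / m) * t i"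
        using m by (simp add: field_simps)
    qed
    also have "\<dots> = (1 - p) * W + (p * W / m) * m"
      unfolding sum.distrib sum_distrib_left[symmetric] m_def[symmetric] W_def[symmetric] ..
    also have "\<dots> = W" using m by (simp add: field_simps)
    finally show ?thesis by simp
  qed
  also have "\<dots> \<le> (\<Sum>i\<in>S. w i * (W * t i / (m * w i)) powr p)"
    using w t m W p by (intro sum_mono mult_left_mono powr_tangent_le) (auto intro!: divide_nonneg_nonneg mult_nonneg_nonneg simp: less_imp_le)
  also have "\<dots> = (\<Sum>i\<in>S. (W / m) powr p * (w i powr (1 - p) * t i powr p))"
  proof (intro sum.cong refl)
    fix i assume i: "i \<in> S"
    have "w i * (W * t i / (m * w i)) powr p = w i * ((W / m) powr p * (t i powr p / w i powr p))"
      using w[OF i] t[OF i] m W by (simp add: powr_mult powr_divide)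
    also have "\<dots> = (W / m) powr p * (w i powr (1 - p) * t i powr p)"
      using w[OF i] by (simp add: powr_diff)
    finally show "w i * (W * t i / (m * w i)) powr p = \<dots>" .
  qed
  also have "\<dots> = (W / m) powr p * (\<Sum>i\<in>S. w i powr (1 - p) * t i powr p)"
    by (simp add: sum_distrib_left)
  finally have "m powr p * W \<le> m powr p * ((W / m) powr p * (\<Sum>i\<in>S. w i powr (1 - p) * t i powr p))"
    by (intro mult_left_mono) auto
  also have "\<dots> = W * (W powr (p - 1) * (\<Sum>i\<in>S. w i powr (1 - p) * t i powr p))"
    using m W by (simp add: powr_divide powr_diff)
  finally show ?thesis
    using W by (simp add: m_def W_def)
qed

text \<open>Minkowski's inequality with the p-th root removed; \<open>c j\<close> bounds the L^p
  norm of \<open>f j\<close> and also serves as the weight in \<open>powr_sum_le\<close>.\<close>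

lemma moment_sum_le:
  assumes J: "finite J" and f: "\<And>j. j \<in> J \<Longrightarrow> continuous_on {0..1} (f j)" and p: "p \<ge> 1"
    and c: "\<And>j. j \<in> J \<Longrightarrow> c j > 0" and le: "\<And>j. j \<in> J \<Longrightarrow> moment p (f j) \<le> c j powr p"
  shows "moment p (\<lambda>x. \<Sum>j\<in>J. f j x) \<le> (\<Sum>j\<in>J. c j) powr p"
proof (cases "J = {}")
  case True
  then show ?thesis by (simp add: moment_def)
next
  case False
  define C where "C = (\<Sum>j\<in>J. c j)"
  have C: "C > 0" unfolding C_def using J False c by (intro sum_pos) auto
  have int: "(\<lambda>x. norm (f j x) powr p) integrable_on {0..1}" if "j \<in> J" for j
    using f[OF that] p by (intro integrable_norm_powr) auto
  have "moment p (\<lambda>x. \<Sum>j\<in>J. f j x) \<le> integral {0..1} (\<lambda>x. C powr (p - 1) * (\<Sum>j\<in>J. c j powr (1 - p) * norm (f j x) powr p))"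
    unfolding moment_def
  proof (intro integral_le)
    show "(\<lambda>x. norm (\<Sum>j\<in>J. f j x) powr p) integrable_on {0..1}"
      using f p by (intro integrable_norm_powr continuous_on_sum) auto
    show "(\<lambda>x. C powr (p - 1) * (\<Sum>j\<in>J. c j powr (1 - p) * norm (f j x) powr p)) integrable_on {0..1}"
      using J int by (intro integrable_on_mult_right integrable_sum) auto
    fix x
    have "norm (\<Sum>j\<in>J. f j x) powr p \<le> (\<Sum>j\<in>J. norm (f j x)) powr p"
      using p by (intro powr_mono2 norm_sum) auto
    also have "\<dots> \<le> C powr (p - 1) * (\<Sum>j\<in>J. c j powr (1 - p) * norm (f j x) powr p)"
      unfolding C_def using J c p by (intro powr_sum_le) auto
    finally show "norm (\<Sum>j\<in>J. f j x) powr p \<le> C powr (p - 1) * (\<Sum>j\<in>J. c j powr (1 - p) * norm (f j x) powr p)" .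
  qed
  also have "\<dots> = C powr (p - 1) * (\<Sum>j\<in>J. c j powr (1 - p) * moment p (f j))"
    unfolding moment_def using J int by (simp add: integral_sum integrable_on_mult_right)
  also have "\<dots> \<le> C powr (p - 1) * (\<Sum>j\<in>J. c j powr (1 - p) * c j powr p)"
    using le by (intro mult_left_mono sum_mono) auto
  also have "(\<Sum>j\<in>J. c j powr (1 - p) * c j powr p) = (\<Sum>j\<in>J. c j)"
    using c by (intro sum.cong refl) (simp add: less_imp_le flip: powr_add)
  also have "C powr (p - 1) * (\<Sum>j\<in>J. c j) = C powr p"
    using C by (simp add: powr_diff flip: C_def)
  finally show ?thesis unfolding C_def .
qed

text \<open>A crude substitute for Minkowski's inequality that is also valid for p < 1: the sum is
  at most twice the larger term.\<close>

lemma moment_add_le: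
  assumes "continuous_on {0..1} f" "continuous_on {0..1} g" "p \<ge> 0"
  shows "moment p (\<lambda>x. f x + g x) \<le> 2 powr p * (moment p f + moment p g)"
proof -
  have int: "(\<lambda>x. norm (h x) powr p) integrable_on {0..1}" if "continuous_on {0..1} h" for h :: "real \<Rightarrow> complex"
    using that assms by (intro integrable_norm_powr) auto
  have "moment p (\<lambda>x. f x + g x) \<le> integral {0..1} (\<lambda>x. 2 powr p * (norm (f x) powr p + norm (g x) powr p))"
    unfolding moment_def
  proof (intro integral_le)
    fix x
    have "norm (f x + g x) powr p \<le> (2 * max (norm (f x)) (norm (g x))) powr p"
      using norm_triangle_ineq[of "f x" "g x"] assms by (intro powr_mono2) auto
    also have "\<dots> = 2 powr p * max (norm (f x)) (norm (g x)) powr p"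
      by (simp add: powr_mult)
    also have "\<dots> \<le> 2 powr p * (norm (f x) powr p + norm (g x) powr p)"
      by (intro mult_left_mono) (auto simp: max_def)
    finally show "norm (f x + g x) powr p \<le> \<dots>" .
  qed (use assms in \<open>auto intro!: int integrable_on_mult_right integrable_add continuous_intros\<close>)
  also have "\<dots> = 2 powr p * (moment p f + moment p g)"
    unfolding moment_def using int assms by (simp add: integral_add)
  finally show ?thesis .
qed

text \<open>The injective rank \<open>\<pi>\<close> allows the dominant block to stand at either end
  of the range: it is taken as j, \<open>j - J\<close> or \<open>J - j\<close>.\<close>

lemma moment_sum_geometric_le:
  fixes \<pi> :: "'a \<Rightarrow> nat"
  assumes J: "finite J" and f: "\<And>j. j \<in> J \<Longrightarrow> continuous_on {0..1} (f j)" and p: "p \<ge> 1"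
    and A: "A > 0" and \<rho>: "0 < \<rho>" "\<rho> < 1" and inj: "inj_on \<pi> J"
    and le: "\<And>j. j \<in> J \<Longrightarrow> moment p (f j) \<le> A * \<rho> ^ \<pi> j"
  shows "moment p (\<lambda>x. \<Sum>j\<in>J. f j x) \<le> A * (1 / (1 - \<rho> powr (1 / p))) powr p"
proof -
  \<comment> \<open>Moments decay with ratio \<open>\<rho>\<close>, so the norms in Minkowski's
    inequality decay with its p-th root.\<close>
  define r where "r = \<rho> powr (1 / p)"
  have r: "0 < r" "r < 1" using \<rho> p powr_less_mono2[of "1 / p" \<rho> 1] by (auto simp: r_def)
  define c where "c = (\<lambda>j. A powr (1 / p) * r ^ \<pi> j)"
  have c: "c j > 0" "c j powr p = A * \<rho> ^ \<pi> j" for j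
  proof -
    show "c j > 0" using A r by (simp add: c_def)
    have "c j powr p = A * (r ^ \<pi> j) powr p"
      using A r p by (simp add: c_def powr_mult powr_powr)
    also have "(r ^ \<pi> j) powr p = (r powr p) ^ \<pi> j"
      using r by (simp add: powr_powr mult.commute flip: powr_realpow)
    also have "r powr p = \<rho>" using \<rho> p by (simp add: r_def powr_powr)
    finally show "c j powr p = A * \<rho> ^ \<pi> j" .
  qed
  have "moment p (\<lambda>x. \<Sum>j\<in>J. f j x) \<le> (\<Sum>j\<in>J. c j) powr p"
    using c le by (intro moment_sum_le J f p) auto
  also have "\<dots> \<le> (A powr (1 / p) * (1 / (1 - r))) powr p"
  proof (intro powr_mono2)
    have "(\<Sum>j\<in>J. r ^ \<pi> j) = (\<Sum>n\<in>\<pi> ` J. r ^ n)"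
      using inj by (simp add: sum.reindex)
    also have "\<dots> \<le> (\<Sum>n. r ^ n)"
      using J r by (intro sum_le_suminf summable_geometric) auto
    also have "\<dots> = 1 / (1 - r)" using r by (simp add: suminf_geometric)
    finally show "(\<Sum>j\<in>J. c j) \<le> A powr (1 / p) * (1 / (1 - r))"
      unfolding c_def sum_distrib_left[symmetric] by (intro mult_left_mono) auto
  qed (use p c in \<open>auto intro!: sum_nonneg simp: less_imp_le\<close>)
  also have "\<dots> = A * (1 / (1 - r)) powr p"
    using A p r by (subst powr_mult) (auto simp: powr_powr)
  finally show ?thesis unfolding r_def .
qed

subsection \<open>The Moebius function and counting k-free numbers\<close>

definition moebius :: "nat \<Rightarrow> real" where
  "moebius n = (if squarefree n then (- 1) ^ card (prime_factors n) else 0)"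

lemma abs_moebius_le_1: "\<bar>moebius n\<bar> \<le> 1"
  by (simp add: moebius_def)

lemma abs_moebius_squarefree: "squarefree n \<Longrightarrow> \<bar>moebius n\<bar> = 1"
  by (simp add: moebius_def)

lemma moebius_1 [simp]: "moebius (Suc 0) = 1"
  by (simp add: moebius_def)

lemma moebius_prime_mult:
  assumes p: "prime p" and "\<not> p dvd e" and e: "squarefree e"
  shows "moebius (p * e) = - moebius e" "squarefree (p * e)"
proof -
  have cop: "coprime p e" using p assms(2) by (simp add: prime_imp_coprime)
  show sq: "squarefree (p * e)"
    using cop p e by (intro squarefree_mult_coprime) (auto intro: squarefree_prime)
  have "e \<noteq> 0" using assms(2) by (metis dvd_0_right)
  then have "prime_factors (p * e) = insert p (prime_factors e)"
    using p by (simp add: prime_factors_product prime_prime_factors)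
  moreover have "p \<notin> prime_factors e" using assms(2) by auto
  ultimately show "moebius (p * e) = - moebius e" using sq e by (simp add: moebius_def)
qed

lemma sum_moebius_divisors:
  assumes n: "n > 0"
  shows "(\<Sum>d | d dvd n. moebius d) = (if n = 1 then 1 else 0)"
proof (cases "n = 1")
  case True
  then show ?thesis by simp
next
  case False
  then obtain p where p: "prime p" "p dvd n" using prime_factor_nat by blast
  \<comment> \<open>Squarefree divisors of n either avoid the prime p or are p times one that does;
    the two halves have opposite Moebius signs.\<close>
  define A where "A = {d. d dvd n \<and> squarefree d \<and> \<not> p dvd d}"
  have fin: "finite {d. d dvd n}" using n by simp
  then have finA: "finite A" by (rule finite_subset[rotated]) (auto simp: A_def)
  have *: "{d. d dvd n \<and> squarefree d} = A \<union> (\<lambda>e. p * e) ` A"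
  proof (intro equalityI subsetI)
    fix d assume d: "d \<in> {d. d dvd n \<and> squarefree d}"
    show "d \<in> A \<union> (\<lambda>e. p * e) ` A"
    proof (cases "p dvd d")
      case True
      then obtain e where e: "d = p * e" by blast
      have "\<not> p dvd e"
      proof
        assume "p dvd e"
        then have "p\<^sup>2 dvd d" by (simp add: e power2_eq_square)
        with d have "p dvd 1" by (auto dest: squarefreeD)
        with p show False by auto
      qed
      moreover have "squarefree e" using d e by (auto dest: squarefree_multD)
      moreover have "e dvd n" using d e by (auto dest: dvd_mult_right)
      ultimately show ?thesis using e by (auto simp: A_def)
    qed (use d in \<open>auto simp: A_def\<close>)
  next
    fix d assume "d \<in> A \<union> (\<lambda>e. p * e) ` A"
    then consider "d \<in> A" | e where "e \<in> A" "d = p * e" by blast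
    then show "d \<in> {d. d dvd n \<and> squarefree d}"
    proof cases
      case 2
      then have e: "e dvd n" "squarefree e" "\<not> p dvd e" by (auto simp: A_def)
      then have "p * e dvd n"
        using p by (intro divides_mult) (auto simp: prime_imp_coprime)
      then show ?thesis using 2 moebius_prime_mult(2)[OF p(1) e(3) e(2)] by simp
    qed (simp add: A_def)
  qed
  have "(\<Sum>d | d dvd n. moebius d) = (\<Sum>d | d dvd n \<and> squarefree d. moebius d)"
    using fin by (intro sum.mono_neutral_right) (auto simp: moebius_def)
  also have "\<dots> = (\<Sum>d\<in>A. moebius d) + (\<Sum>d\<in>(\<lambda>e. p * e) ` A. moebius d)"
    unfolding * using finA by (intro sum.union_disjoint) (auto simp: A_def)
  also have "(\<Sum>d\<in>(\<lambda>e. p * e) ` A. moebius d) = (\<Sum>d\<in>A. moebius (p * d))"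
    using p by (subst sum.reindex) (auto simp: inj_on_def)
  also have "\<dots> = (\<Sum>d\<in>A. - moebius d)"
    using p by (intro sum.cong refl moebius_prime_mult) (auto simp: A_def)
  finally show ?thesis using False by (simp add: sum_negf)
qed

text \<open>A finite set of positive integers closed under divisors and least common multiples is the
  divisor set of its maximum.\<close>

lemma sum_moebius_closed:
  assumes F: "finite F" "0 \<notin> F" "1 \<in> F"
    and dv: "\<And>a b. a \<in> F \<Longrightarrow> b dvd a \<Longrightarrow> b \<in> F"
    and lc: "\<And>a b. a \<in> F \<Longrightarrow> b \<in> F \<Longrightarrow> lcm a b \<in> F"
  shows "(\<Sum>d\<in>F. moebius d) = (if F = {1} then 1 else 0)"
proof -
  define a where "a = Max F"
  have a: "a \<in> F" using F unfolding a_def by (intro Max_in) auto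
  then have a0: "a > 0" using F by (cases "a = 0") auto
  have "d dvd a" if "d \<in> F" for d
  proof -
    have "lcm a d \<le> a" using lc[OF a that] F unfolding a_def by simp
    moreover have "a dvd lcm a d" by simp
    ultimately have "lcm a d = a"
      using F lc[OF a that] by (metis dvd_imp_le gr0I le_antisym)
    then show ?thesis by (metis dvd_lcm2)
  qed
  then have Feq: "F = {d. d dvd a}" using dv[OF a] by blast
  have "F = {1} \<longleftrightarrow> a = 1"
  proof
    assume "F = {1}"
    then show "a = 1" using a by simp
  qed (simp add: Feq)
  moreover have "(\<Sum>d\<in>F. moebius d) = (if a = 1 then 1 else 0)"
    using sum_moebius_divisors[OF a0] by (subst Feq)
  ultimately show ?thesis by simp
qed

text \<open>Supplies the closure under lcm for \<open>sum_moebius_closed\<close>. With a = u g, b =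
  v g and u, v coprime the lcm is u v g; after dividing n by g^k, the coprime powers u^k and v^k
  both divide the quotient.\<close>

lemma lcm_power_dvd:
  fixes a b n :: nat
  assumes "a ^ k dvd n" "b ^ k dvd n"
  shows "lcm a b ^ k dvd n"
proof (cases "a = 0 \<or> b = 0")
  case True
  then show ?thesis using assms by auto
next
  case False
  define g where "g = gcd a b"
  obtain u v where uv: "a = u * g" "b = v * g" "coprime u v"
    using gcd_coprime_exists[of a b] False unfolding g_def by (auto simp: mult.commute)
  have g0: "g \<noteq> 0" using False by (simp add: g_def)
  have l: "lcm a b = u * v * g"
    using uv lcm_mult_right[of u g v] lcm_coprime[of u v] by (simp add: lcm.commute)
  obtain m where m: "n = g ^ k * m"
    using assms(1) unfolding uv(1) power_mult_distrib by (auto elim: dvdE dest: dvd_mult_right)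
  have "u ^ k dvd m" "v ^ k dvd m"
    using assms uv m g0 by (auto simp: power_mult_distrib mult.commute)
  then have "u ^ k * v ^ k dvd m" using uv by (intro divides_mult) auto
  then show ?thesis unfolding l m by (simp add: power_mult_distrib mult.commute[of _ "g ^ k"])
qed

lemma mu_k_eq_sum_moebius:
  assumes n: "n > 0" and k: "k > 0"
  shows "mu_k k n = (\<Sum>d | d ^ k dvd n. moebius d)"
proof -
  define F where "F = {d. d ^ k dvd n}"
  have "F \<subseteq> {..n}"
  proof
    fix d assume "d \<in> F"
    then have "d ^ k \<le> n" using n by (auto simp: F_def dvd_imp_le)
    moreover have "d \<le> d ^ k" using k by (cases "d = 0") (auto intro: self_le_power)
    ultimately show "d \<in> {..n}" by simp
  qed
  then have "finite F" by (rule finite_subset) simp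
  moreover have z: "0 \<notin> F" using n k by (auto simp: F_def zero_power)
  moreover have one: "1 \<in> F" by (simp add: F_def)
  moreover have "b \<in> F" if "a \<in> F" "b dvd a" for a b
    using that by (auto simp: F_def intro: dvd_trans dvd_power_same)
  moreover have "lcm a b \<in> F" if "a \<in> F" "b \<in> F" for a b
    using that lcm_power_dvd by (auto simp: F_def)
  ultimately have "(\<Sum>d\<in>F. moebius d) = (if F = {1} then 1 else 0)"
    by (intro sum_moebius_closed)
  also have "\<dots> = mu_k k n"
  proof -
    have "F = {1} \<longleftrightarrow> \<not> (\<exists>d>1. d ^ k dvd n)"
    proof
      assume "\<not> (\<exists>d>1. d ^ k dvd n)"
      then have "\<not> d > 1" if "d \<in> F" for d
        using that by (auto simp: F_def)
      moreover have "d \<noteq> 0" if "d \<in> F" for d using that z by metis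
      ultimately have "d = 1" if "d \<in> F" for d
        using that by (metis One_nat_def less_one linorder_neqE_nat)
      then show "F = {1}" using one by blast
    next
      assume F1: "F = {1}"
      show "\<not> (\<exists>d>1. d ^ k dvd n)"
      proof
        assume "\<exists>d>1. d ^ k dvd n"
        then obtain d where "d > 1" "d \<in> F" by (auto simp: F_def)
        then show False by (simp add: F1)
      qed
    qed
    then show ?thesis unfolding mu_k_def by (simp only: if_not_P if_P split: if_splits) simp
  qed
  finally show ?thesis by (simp add: F_def)
qed

section \<open>Positive density of k-free numbers\<close>

lemma sum_inverse_squares_le: "(\<Sum>d=2..n. 1 / (real d)\<^sup>2) \<le> 3 / 4"
proof -
  \<comment> \<open>Strengthened for the induction. The term 1/4 at d = 2 is kept exact and only the
    rest is telescoped; telescoping from d = 2 would give 1 and leave no positive density.\<close>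
  have "(\<Sum>d=2..n. 1 / (real d)\<^sup>2) \<le> 3 / 4 - 1 / real n" if "n \<ge> 2"
    using that
  proof (induction n rule: dec_induct)
    case base
    then show ?case by (simp add: power2_eq_square)
  next
    case (step n)
    have "1 / (real (Suc n))\<^sup>2 \<le> 1 / real n - 1 / real (Suc n)"
      using step(1) by (simp add: divide_simps power2_eq_square)
    then show ?case using step by simp
  qed
  then show ?thesis
  proof (cases "n \<ge> 2")
    case True
    then show ?thesis using \<open>n \<ge> 2 \<Longrightarrow> _\<close> by (smt (verit) divide_nonneg_nonneg of_nat_0_le_iff)
  qed simp
qed

lemma mu_k_range: "mu_k k n = 0 \<or> mu_k k n = 1"
  by (simp add: mu_k_def)

text \<open>A union bound over squares instead of k-th powers: d^k dividing n forces d^2 to divide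
  n, so one numerical bound serves all k >= 2.\<close>

lemma mu_k_ge:
  assumes "n > 0" "k \<ge> 2"
  shows "mu_k k n \<ge> 1 - (\<Sum>d\<in>{d\<in>{2..n}. d\<^sup>2 dvd n}. 1)"
proof (cases "\<exists>d>1. d ^ k dvd n")
  case True
  then obtain d where d: "d > 1" "d ^ k dvd n" by blast
  have "d\<^sup>2 dvd n" using d assms by (meson dvd_trans le_imp_power_dvd)
  moreover have "d \<le> n"
    using d assms \<open>d\<^sup>2 dvd n\<close> by (meson dvd_imp_le dvd_trans dvd_power zero_less_numeral)
  ultimately have "{d\<in>{2..n}. d\<^sup>2 dvd n} \<noteq> {}" using d by fastforce
  then have "card {d\<in>{2..n}. d\<^sup>2 dvd n} > 0" by (subst card_gt_0_iff) auto
  then show ?thesis by (simp add: mu_k_def)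
next
  case False
  then show ?thesis by (auto simp: mu_k_def)
qed

text \<open>The bound \<open>3/4\<close> for the sum of \<open>1/d\<^sup>2\<close> over \<open>d \<ge> 2\<close> leaves a quarter of the weight to the
  \<open>k\<close>-free numbers.\<close>

lemma sum_mu_k_weighted_ge:
  fixes w :: "nat \<Rightarrow> real"
  assumes k: "k \<ge> 2" and w: "\<And>n. n \<in> {1..N} \<Longrightarrow> w n \<ge> 0"
    and W: "\<And>d. d \<ge> 2 \<Longrightarrow> (\<Sum>n\<in>{n\<in>{1..N}. d\<^sup>2 dvd n}. w n) \<le> W / (real d)\<^sup>2"
    and W2: "W = (\<Sum>n=1..N. w n)"
  shows "(\<Sum>n=1..N. mu_k k n * w n) \<ge> W / 4"
proof -
  have W0: "W \<ge> 0" unfolding W2 using w by (intro sum_nonneg) auto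
  have "W - (\<Sum>n=1..N. mu_k k n * w n) = (\<Sum>n=1..N. (1 - mu_k k n) * w n)"
    by (simp add: W2 left_diff_distrib sum_subtractf)
  also have "\<dots> \<le> (\<Sum>n=1..N. (\<Sum>d\<in>{d\<in>{2..N}. d\<^sup>2 dvd n}. 1) * w n)"
  proof (intro sum_mono mult_right_mono)
    fix n assume n: "n \<in> {1..N}"
    have "1 - mu_k k n \<le> (\<Sum>d\<in>{d\<in>{2..n}. d\<^sup>2 dvd n}. 1)" using mu_k_ge[of n k] n k by auto
    also have "\<dots> \<le> (\<Sum>d\<in>{d\<in>{2..N}. d\<^sup>2 dvd n}. 1)" using n by (intro sum_mono2) auto
    finally show "1 - mu_k k n \<le> (\<Sum>d\<in>{d\<in>{2..N}. d\<^sup>2 dvd n}. 1)" .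
  qed (use w in auto)
  also have "\<dots> = (\<Sum>n=1..N. \<Sum>d\<in>{d\<in>{2..N}. d\<^sup>2 dvd n}. w n)"
    by (simp add: sum_distrib_right)
  also have "\<dots> = (\<Sum>d=2..N. \<Sum>n\<in>{n\<in>{1..N}. d\<^sup>2 dvd n}. w n)"
    by (rule sum.swap_restrict) auto
  also have "\<dots> \<le> (\<Sum>d=2..N. W * (1 / (real d)\<^sup>2))"
    using W by (intro sum_mono) auto
  also have "\<dots> \<le> W * (3 / 4)"
    unfolding sum_distrib_left[symmetric] by (intro mult_left_mono sum_inverse_squares_le W0)
  finally show ?thesis by simp
qed

lemma multiples_eq_image:
  assumes "q > 0"
  shows "{n\<in>{1..N}. q dvd n} = (\<lambda>m. q * m) ` {1..N div q :: nat}"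
proof (intro equalityI subsetI)
  fix n assume "n \<in> {n\<in>{1..N}. q dvd n}"
  then obtain m where m: "n = q * m" "1 \<le> n" "n \<le> N" by auto
  then have "m \<in> {1..N div q}" using assms
    by (auto simp: less_eq_div_iff_mult_less_eq mult.commute Suc_le_eq)
  then show "n \<in> (\<lambda>m. q * m) ` {1..N div q}" using m by blast
next
  fix n assume "n \<in> (\<lambda>m. q * m) ` {1..N div q}"
  then show "n \<in> {n\<in>{1..N}. q dvd n}" using assms
    by (auto simp: less_eq_div_iff_mult_less_eq mult.commute Suc_le_eq)
qed

lemma sum_multiples:
  assumes "q > 0"
  shows "(\<Sum>n\<in>{n\<in>{1..N}. q dvd n}. f n) = (\<Sum>m=1..N div q. f (q * m :: nat))"
  unfolding multiples_eq_image[OF assms] using assms by (subst sum.reindex) (auto simp: inj_on_def)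

lemma sum_mu_k_ge:
  assumes "k \<ge> 2"
  shows "(\<Sum>n=1..N. mu_k k n) \<ge> real N / 4"
proof -
  have "(\<Sum>n=1..N. mu_k k n * 1) \<ge> real N / 4"
  proof (rule sum_mu_k_weighted_ge[OF assms])
    fix d :: nat assume d: "d \<ge> 2"
    have "(\<Sum>n\<in>{n\<in>{1..N}. d\<^sup>2 dvd n}. 1::real) = real (N div d\<^sup>2)"
      using d by (subst sum_multiples) auto
    also have "\<dots> \<le> real N / (real d)\<^sup>2" using of_nat_div_le_of_nat[of N "d\<^sup>2", where 'a = real] by simp
    finally show "(\<Sum>n\<in>{n\<in>{1..N}. d\<^sup>2 dvd n}. 1::real) \<le> real N / (real d)\<^sup>2" .
  qed auto
  then show ?thesis by simp
qed

text \<open>At the critical exponent a squarefree d contributes in proportion to 1/d; this sum then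
  produces the factor log N of the lower bound.\<close>

lemma sum_mu_k_inverse_ge:
  assumes "k \<ge> 2"
  shows "(\<Sum>n=1..N. mu_k k n * (1 / real n)) \<ge> ln (real N + 1) / 4"
proof -
  have h: "harm n = (\<Sum>m=1..n. 1 / real m)" for n
    by (simp add: harm_def inverse_eq_divide)
  have "(\<Sum>n=1..N. mu_k k n * (1 / real n)) \<ge> harm N / 4"
  proof (rule sum_mu_k_weighted_ge[OF assms])
    fix d :: nat assume d: "d \<ge> 2"
    have "(\<Sum>n\<in>{n\<in>{1..N}. d\<^sup>2 dvd n}. 1 / real n) = (\<Sum>m=1..N div d\<^sup>2. 1 / real (d\<^sup>2 * m))"
      using d by (subst sum_multiples) auto
    also have "\<dots> = (\<Sum>m=1..N div d\<^sup>2. 1 / real m) / (real d)\<^sup>2"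
      by (simp add: sum_divide_distrib mult.commute)
    also have "\<dots> \<le> harm N / (real d)\<^sup>2"
      unfolding h by (intro divide_right_mono sum_mono2) (auto intro: order_trans[OF _ div_le_dividend])
    finally show "(\<Sum>n\<in>{n\<in>{1..N}. d\<^sup>2 dvd n}. 1 / real n) \<le> harm N / (real d)\<^sup>2" .
  qed (auto simp: h)
  moreover have "ln (real N + 1) \<le> harm N" by (rule ln_le_harm)
  ultimately show ?thesis by linarith
qed

lemma squarefree_if_mu_2:
  assumes "mu_k 2 n = 1"
  shows "squarefree n"
proof (rule squarefreeI)
  fix x assume "x\<^sup>2 dvd n"
  with assms have "\<not> x > 1" by (auto simp: mu_k_def split: if_splits)
  moreover have "mu_k 2 0 = 0" by (auto simp: mu_k_def intro: exI[of _ 2])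
  then have "n \<noteq> 0" using assms by (cases "n = 0") auto
  then have "x \<noteq> 0" using \<open>x\<^sup>2 dvd n\<close> by auto
  ultimately show "x dvd 1" by (simp add: not_less le_Suc_eq)
qed

subsection \<open>Mean squares of dyadic blocks\<close>

lemma card_multiples_int_le:
  fixes u l :: int
  assumes q: "q > 0" and l: "l \<ge> 0"
  shows "real (card {m \<in> {u..<u + l}. q dvd m}) \<le> of_int l / of_int q + 1"
proof -
  have "{m \<in> {u..<u + l}. q dvd m} \<subseteq> (\<lambda>t. q * t) ` {u' . u \<le> q * u' \<and> q * u' < u + l}"
    by (auto elim!: dvdE)
  also have "{t. u \<le> q * t \<and> q * t < u + l} \<subseteq> {\<lceil>of_int u / of_int q :: real\<rceil>..<\<lceil>(of_int u + of_int l) / of_int q :: real\<rceil>}"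
    using q by (auto simp: ceiling_le_iff less_ceiling_iff field_simps simp flip: of_int_mult of_int_add)
  finally have sub: "{m \<in> {u..<u + l}. q dvd m} \<subseteq> (\<lambda>t. q * t) ` {\<lceil>of_int u / of_int q :: real\<rceil>..<\<lceil>(of_int u + of_int l) / of_int q :: real\<rceil>}"
    by blast
  have "card {m \<in> {u..<u + l}. q dvd m} \<le> card {\<lceil>of_int u / of_int q :: real\<rceil>..<\<lceil>(of_int u + of_int l) / of_int q :: real\<rceil>}"
    using sub by (rule surj_card_le[rotated]) simp
  also have "\<dots> = nat (\<lceil>(of_int u + of_int l) / of_int q :: real\<rceil> - \<lceil>of_int u / of_int q :: real\<rceil>)" by simp
  finally have "real (card {m \<in> {u..<u + l}. q dvd m}) \<le> real (nat (\<lceil>(of_int u + of_int l) / of_int q :: real\<rceil> - \<lceil>of_int u / of_int q :: real\<rceil>))"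
    by simp
  also have "\<dots> \<le> max 0 ((of_int u + of_int l) / of_int q + 1 - of_int u / of_int q)"
    by (auto simp: of_nat_nat max_def) linarith+
  also have "\<dots> = of_int l / of_int q + 1"
    using q l by (auto simp: add_divide_distrib max_def not_le dest: order.strict_trans1)
  finally show ?thesis .
qed

text \<open>Replace gcd^k by the sum of g^k over all common divisors g and exchange sums. A block
  holds at most 2 D / g multiples of g, so g contributes at most 4 D^2 g^(k-2); because k >= 2 this
  is largest at the top of the range and no logarithm arises.\<close>

lemma sum_gcd_power_le:
  fixes D k :: nat
  assumes k: "k \<ge> 2"
  shows "(\<Sum>d1\<in>{D..<2*D}. \<Sum>d2\<in>{D..<2*D}. real (gcd d1 d2) ^ k) \<le> 2 ^ (k + 1) * real D ^ (k + 1)"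
proof -
  have "(\<Sum>d1\<in>{D..<2*D}. \<Sum>d2\<in>{D..<2*D}. real (gcd d1 d2) ^ k)
      \<le> (\<Sum>d1\<in>{D..<2*D}. \<Sum>d2\<in>{D..<2*D}. \<Sum>g\<in>{1..<2*D}. if g dvd d1 \<and> g dvd d2 then real g ^ k else 0)"
  proof (intro sum_mono)
    fix d1 d2 assume d: "d1 \<in> {D..<2*D}" "d2 \<in> {D..<2*D}"
    then have d0: "d1 > 0" by auto
    have "gcd d1 d2 \<le> d1" using d0 by (intro dvd_imp_le) auto
    also have "d1 < 2 * D" using d by simp
    finally have mem: "gcd d1 d2 \<in> {1..<2*D}" using d0 by (auto simp: Suc_le_eq)
    have "(\<Sum>g\<in>{gcd d1 d2}. if g dvd d1 \<and> g dvd d2 then real g ^ k else 0)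
        \<le> (\<Sum>g\<in>{1..<2*D}. if g dvd d1 \<and> g dvd d2 then real g ^ k else 0)"
      using mem by (intro sum_mono2) auto
    then show "real (gcd d1 d2) ^ k \<le> (\<Sum>g\<in>{1..<2*D}. if g dvd d1 \<and> g dvd d2 then real g ^ k else 0)"
      by simp
  qed
  also have "\<dots> = (\<Sum>d1\<in>{D..<2*D}. \<Sum>g\<in>{1..<2*D}. \<Sum>d2\<in>{D..<2*D}. if g dvd d1 \<and> g dvd d2 then real g ^ k else 0)"
    by (intro sum.cong refl sum.swap)
  also have "\<dots> = (\<Sum>g\<in>{1..<2*D}. \<Sum>d1\<in>{D..<2*D}. \<Sum>d2\<in>{D..<2*D}. if g dvd d1 \<and> g dvd d2 then real g ^ k else 0)"
    by (rule sum.swap)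
  also have "\<dots> \<le> (\<Sum>g\<in>{1..<2*D}. 4 * real D ^ 2 * (2 * real D) ^ (k - 2))"
  proof (intro sum_mono)
    fix g assume g: "g \<in> {1..<2*D}"
    define c where "c = card {d \<in> {D..<2*D}. g dvd d}"
    have "{d \<in> {D..<2*D}. g dvd d} \<subseteq> {d \<in> {1..2*D}. g dvd d}" using g by auto
    also have "\<dots> = (\<lambda>m. g * m) ` {1..2*D div g}" using g by (intro multiples_eq_image) auto
    finally have "c \<le> card {1..2*D div g}" unfolding c_def by (rule surj_card_le[rotated]) simp
    then have "real c \<le> real (2 * D div g)" by simp
    also have "\<dots> \<le> real (2 * D) / real g" by (rule of_nat_div_le_of_nat)
    finally have c: "real c \<le> 2 * real D / real g" by simp
    have "(\<Sum>d1\<in>{D..<2*D}. \<Sum>d2\<in>{D..<2*D}. if g dvd d1 \<and> g dvd d2 then real g ^ k else 0)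
        = (\<Sum>d1\<in>{D..<2*D}. if g dvd d1 then real c * real g ^ k else 0)"
      by (intro sum.cong refl) (auto simp: c_def sum.inter_filter[symmetric])
    also have "\<dots> = real c * (real c * real g ^ k)"
      by (simp add: c_def sum.inter_filter[symmetric])
    also have "\<dots> \<le> (2 * real D / real g) * ((2 * real D / real g) * real g ^ k)"
      by (intro mult_mono c) auto
    also have "\<dots> = 4 * real D ^ 2 * real g ^ (k - 2)"
      using g k by (simp add: power_diff power2_eq_square field_simps)
    also have "\<dots> \<le> 4 * real D ^ 2 * (2 * real D) ^ (k - 2)"
      using g by (intro mult_left_mono power_mono) auto
    finally show "(\<Sum>d1\<in>{D..<2*D}. \<Sum>d2\<in>{D..<2*D}. if g dvd d1 \<and> g dvd d2 then real g ^ k else 0)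
        \<le> 4 * real D ^ 2 * (2 * real D) ^ (k - 2)" .
  qed
  also have "\<dots> \<le> (2 * real D) * (4 * real D ^ 2 * (2 * real D) ^ (k - 2))"
  proof -
    have "real (card {1..<2*D}) \<le> 2 * real D" by simp
    then show ?thesis unfolding sum_constant by (intro mult_right_mono) auto
  qed
  also have "\<dots> = (2 * real D) ^ (k + 1)"
  proof -
    obtain j where j: "k = j + 2" using k by (metis add.commute le_Suc_ex)
    show ?thesis unfolding j by (simp add: power2_eq_square)
  qed
  finally show ?thesis unfolding power_mult_distrib .
qed

text \<open>Two frequencies \<open>d1\<^sup>k m1\<close> and \<open>d2\<^sup>k m2\<close> coincide only if \<open>(d2 / gcd d1 d2)\<^sup>k\<close> divides \<open>m1\<close>,
  and then \<open>m1\<close> determines \<open>m2\<close>.\<close>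

lemma mean_square_block_le:
  fixes W :: "nat \<Rightarrow> int set" and b :: "nat \<Rightarrow> int \<Rightarrow> complex"
  assumes k: "k \<ge> 2" and D: "D \<ge> 1"
    and W: "\<And>d. d \<in> {D..<2*D} \<Longrightarrow> finite (W d)"
    and b: "\<And>d m. d \<in> {D..<2*D} \<Longrightarrow> m \<in> W d \<Longrightarrow> norm (b d m) \<le> 1"
    and lc: "l \<ge> 0" "c \<ge> 0"
    and cnt: "\<And>d q. d \<in> {D..<2*D} \<Longrightarrow> q > 0 \<Longrightarrow> real (card {m \<in> W d. q dvd m}) \<le> l / of_int q + c"
  shows "moment 2 (\<lambda>\<alpha>. \<Sum>d\<in>{D..<2*D}. \<Sum>m\<in>W d. b d m * e_exp (\<alpha> * real (d ^ k) * of_int m))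
       \<le> 2 ^ (k + 1) * l * real D + c * (real D)\<^sup>2"
proof -
  define X where "X = Sigma {D..<2*D} W"
  define \<nu> where "\<nu> = (\<lambda>(d, m). int (d ^ k) * m)"
  have finX: "finite X" unfolding X_def using W by auto
  have eq: "(\<lambda>\<alpha>. \<Sum>d\<in>{D..<2*D}. \<Sum>m\<in>W d. b d m * e_exp (\<alpha> * real (d ^ k) * of_int m))
      = (\<lambda>\<alpha>. \<Sum>x\<in>X. (case x of (d, m) \<Rightarrow> b d m) * e_exp (\<alpha> * of_int (\<nu> x)))"
    unfolding X_def using W by (intro ext, subst sum.Sigma) (auto simp: \<nu>_def mult.assoc intro!: sum.cong)
  have "moment 2 (\<lambda>\<alpha>. \<Sum>d\<in>{D..<2*D}. \<Sum>m\<in>W d. b d m * e_exp (\<alpha> * real (d ^ k) * of_int m))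
      \<le> real (card {(x, x') \<in> X \<times> X. \<nu> x = \<nu> x'})"
    unfolding eq moment_2 using b by (intro parseval_le finX) (auto simp: X_def)
  also have "card {(x, x') \<in> X \<times> X. \<nu> x = \<nu> x'}
      \<le> card (\<Union>d1\<in>{D..<2*D}. \<Union>d2\<in>{D..<2*D}. {((d1, m1), (d2, m2)) | m1 m2. m1 \<in> W d1 \<and> m2 \<in> W d2 \<and> int (d1 ^ k) * m1 = int (d2 ^ k) * m2})"
    (is "_ \<le> card (\<Union>d1\<in>_. \<Union>d2\<in>_. ?Z d1 d2)")
  proof (intro card_mono)
    show "finite (\<Union>d1\<in>{D..<2*D}. \<Union>d2\<in>{D..<2*D}. ?Z d1 d2)"
      by (rule finite_subset[of _ "X \<times> X"]) (use finX in \<open>auto simp: X_def\<close>)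
  qed (auto simp: X_def \<nu>_def)
  also have "\<dots> \<le> (\<Sum>d1\<in>{D..<2*D}. \<Sum>d2\<in>{D..<2*D}. card (?Z d1 d2))"
    by (intro order_trans[OF card_UN_le] sum_mono card_UN_le) auto
  finally have "moment 2 (\<lambda>\<alpha>. \<Sum>d\<in>{D..<2*D}. \<Sum>m\<in>W d. b d m * e_exp (\<alpha> * real (d ^ k) * of_int m))
      \<le> (\<Sum>d1\<in>{D..<2*D}. \<Sum>d2\<in>{D..<2*D}. real (card (?Z d1 d2)))"
    by simp
  also have "\<dots> \<le> (\<Sum>d1\<in>{D..<2*D}. \<Sum>d2\<in>{D..<2*D}. (l / real D ^ k) * real (gcd d1 d2) ^ k + c)"
  proof (intro sum_mono)
    fix d1 d2 assume d: "d1 \<in> {D..<2*D}" "d2 \<in> {D..<2*D}"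
    define g where "g = gcd d1 d2"
    have g0: "g > 0" using d D by (auto simp: g_def)
    obtain u v where uv: "d1 = u * g" "d2 = v * g" "coprime u v"
      using gcd_coprime_exists[of d1 d2] g0 unfolding g_def by (auto simp: mult.commute)
    have v0: "v > 0" using uv d D by (cases "v = 0") auto
    have div: "int (v ^ k) dvd m1 \<and> m2 = int (u ^ k) * (m1 div int (v ^ k))"
      if eq: "int (d1 ^ k) * m1 = int (d2 ^ k) * m2" for m1 m2
    proof -
      have "int (g ^ k) * (int (u ^ k) * m1) = int (g ^ k) * (int (v ^ k) * m2)"
        using eq by (simp add: uv power_mult_distrib mult_ac)
      then have e: "int (u ^ k) * m1 = int (v ^ k) * m2" using g0 by simp
      have "coprime (int (v ^ k)) (int (u ^ k))" using uv by (simp add: coprime_commute)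
      moreover have "int (v ^ k) dvd int (u ^ k) * m1" unfolding e by simp
      ultimately have dv: "int (v ^ k) dvd m1" by (simp add: coprime_dvd_mult_right_iff)
      then obtain t where t: "m1 = int (v ^ k) * t" by blast
      have "m2 = int (u ^ k) * t" using e v0 unfolding t by simp
      then show ?thesis using dv t v0 by simp
    qed
    have "card (?Z d1 d2) \<le> card {m1 \<in> W d1. int (v ^ k) dvd m1}"
    proof (rule surj_card_le)
      show "finite {m1 \<in> W d1. int (v ^ k) dvd m1}" using W d by auto
      show "?Z d1 d2 \<subseteq> (\<lambda>m1. ((d1, m1), (d2, int (u ^ k) * (m1 div int (v ^ k))))) ` {m1 \<in> W d1. int (v ^ k) dvd m1}"
        using div by blast
    qed
    then have "real (card (?Z d1 d2)) \<le> real (card {m1 \<in> W d1. int (v ^ k) dvd m1})" by simp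
    also have "\<dots> \<le> l / of_int (int (v ^ k)) + c"
      using d v0 by (intro cnt) auto
    also have "l / of_int (int (v ^ k)) = l / real d2 ^ k * real g ^ k"
      using g0 v0 by (simp add: uv power_mult_distrib)
    also have "\<dots> \<le> l / real D ^ k * real g ^ k"
      using d D lc by (intro mult_right_mono divide_left_mono power_mono mult_pos_pos) auto
    finally show "real (card (?Z d1 d2)) \<le> (l / real D ^ k) * real (gcd d1 d2) ^ k + c"
      by (simp add: g_def)
  qed
  also have "\<dots> = (l / real D ^ k) * (\<Sum>d1\<in>{D..<2*D}. \<Sum>d2\<in>{D..<2*D}. real (gcd d1 d2) ^ k) + c * (real D)\<^sup>2"
    by (simp add: sum.distrib sum_distrib_left power2_eq_square)
  also have "\<dots> \<le> (l / real D ^ k) * (2 ^ (k + 1) * real D ^ (k + 1)) + c * (real D)\<^sup>2"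
    using lc by (intro add_mono mult_left_mono sum_gcd_power_le k) auto
  also have "(l / real D ^ k) * (2 ^ (k + 1) * real D ^ (k + 1)) = 2 ^ (k + 1) * l * real D"
    using D by (simp add: field_simps)
  finally show ?thesis .
qed

subsection \<open>Dirichlet and trapezoidal kernels\<close>

definition dirichlet_kernel :: "nat \<Rightarrow> real \<Rightarrow> complex" where
  "dirichlet_kernel L \<beta> = (\<Sum>s<L. e_exp (\<beta> * real s))"

lemma continuous_on_dirichlet_kernel [continuous_intros]:
  "continuous_on A f \<Longrightarrow> continuous_on A (\<lambda>x. dirichlet_kernel L (f x))"
  unfolding dirichlet_kernel_def by (intro continuous_intros)

lemma norm_dirichlet_kernel_le: "norm (dirichlet_kernel L \<beta>) \<le> real L"
  unfolding dirichlet_kernel_def by (rule order_trans[OF norm_sum]) simp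

lemma norm_dirichlet_kernel_reflect: "norm (dirichlet_kernel L (1 - \<beta>)) = norm (dirichlet_kernel L \<beta>)"
proof -
  have "dirichlet_kernel L (1 - \<beta>) = cnj (dirichlet_kernel L \<beta>)"
    unfolding dirichlet_kernel_def cnj_sum
    by (intro sum.cong refl) (simp add: left_diff_distrib cnj_e_exp e_exp_diff)
  then show ?thesis by simp
qed

lemma dirichlet_kernel_periodic: "dirichlet_kernel L (\<beta> + 1) = dirichlet_kernel L \<beta>"
  unfolding dirichlet_kernel_def by (intro sum.cong refl) (simp add: ring_distribs e_exp_add)

text \<open>Jordan's inequality for the sine, from its concavity.\<close>

lemma norm_e_exp_minus_1_ge:
  assumes "0 \<le> \<beta>" "\<beta> \<le> 1/2"
  shows "norm (e_exp \<beta> - 1) \<ge> 4 * \<beta>"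
proof -
  have "concave_on {0..pi} sin"
    by (intro f''_le0_imp_concave[where f' = cos and f'' = "\<lambda>x. - sin x"])
       (auto intro!: derivative_eq_intros sin_ge_zero)
  then have "(1 - 2 * \<beta>) * sin 0 + 2 * \<beta> * sin (pi / 2) \<le> sin ((1 - 2 * \<beta>) *\<^sub>R 0 + (2 * \<beta>) *\<^sub>R (pi / 2))"
    using assms by (intro concave_onD) auto
  then have "2 * \<beta> \<le> sin (pi * \<beta>)" by (simp add: mult.commute)
  moreover have "norm (e_exp \<beta> - 1) = 2 * \<bar>sin (pi * \<beta>)\<bar>"
    using dist_exp_i_1[of "2 * pi * \<beta>"] by (simp add: e_exp_cis cis_conv_exp)
  ultimately show ?thesis by linarith
qed

text \<open>The bounds L and 1 / (2 \<beta>), weighted by 1 / (2 L) and \<beta>, add up to 1. The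
  result is a single rational function with an explicit antiderivative, without a case split at 1 /
  L.\<close>

lemma norm_dirichlet_kernel_decay:
  assumes L: "L \<ge> 1" and \<beta>: "0 \<le> \<beta>" "\<beta> \<le> 1/2"
  shows "norm (dirichlet_kernel L \<beta>) \<le> 1 / (1 / (2 * real L) + \<beta>)"
proof -
  have "(e_exp \<beta> - 1) * dirichlet_kernel L \<beta> = e_exp \<beta> ^ L - 1"
    unfolding dirichlet_kernel_def using power_diff_1_eq[of "e_exp \<beta>" L] by (simp add: e_exp_power mult.commute)
  then have "norm (e_exp \<beta> - 1) * norm (dirichlet_kernel L \<beta>) = norm (e_exp \<beta> ^ L - 1)"
    by (metis norm_mult)
  also have "\<dots> \<le> 2"
    using norm_triangle_ineq4[of "e_exp \<beta> ^ L" 1] by (simp add: norm_power)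
  finally have "4 * \<beta> * norm (dirichlet_kernel L \<beta>) \<le> 2"
    using norm_e_exp_minus_1_ge[OF \<beta>] by (meson mult_right_mono norm_ge_zero order_trans)
  moreover have "1 / (2 * real L) * norm (dirichlet_kernel L \<beta>) \<le> 1/2"
    using norm_dirichlet_kernel_le[of L \<beta>] L by (simp add: field_simps)
  ultimately have "(1 / (2 * real L) + \<beta>) * norm (dirichlet_kernel L \<beta>) \<le> 1"
    by (simp add: algebra_simps)
  moreover have "1 / (2 * real L) + \<beta> > 0" using L \<beta> by (intro add_pos_nonneg) auto
  ultimately show ?thesis by (simp add: field_simps)
qed

lemma integral_symmetric_le:
  fixes f g :: "real \<Rightarrow> real"
  assumes f: "continuous_on {0..1} f" and sym: "\<And>x. f (1 - x) = f x"
    and g: "(g has_integral I) {0..1/2}" and le: "\<And>x. x \<in> {0..1/2} \<Longrightarrow> f x \<le> g x"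
  shows "integral {0..1} f \<le> 2 * I"
proof -
  have int: "f integrable_on {0..1}" by (rule integrable_continuous_interval[OF f])
  have f1: "f integrable_on {0..1/2}"
    by (rule integrable_continuous_interval, rule continuous_on_subset[OF f]) auto
  have "integral {0..1} f = integral {0..1/2} f + integral {1/2..1} f"
    using Henstock_Kurzweil_Integration.integral_combine[OF _ _ int, of "1/2"] by simp
  also have "integral {1/2..1} f = integral {0..1/2} f"
  proof -
    have "((\<lambda>x. f (- 1 * x + 1)) has_integral (1 / \<bar>- 1\<bar> ^ DIM(real)) *\<^sub>R integral {0..1/2} f)
        ((\<lambda>x. (1 / (- 1)) *\<^sub>R x + - ((1 / (- 1)) *\<^sub>R 1)) ` cbox 0 (1/2))"
      using has_integral_affinity[of f "integral {0..1/2} f" 0 "1/2" "-1" 1] f1 by (simp add: has_integral_integral)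
    moreover have "(\<lambda>x::real. (1 / (- 1)) *\<^sub>R x + - ((1 / (- 1)) *\<^sub>R 1)) ` cbox 0 (1/2) = {1/2..1}"
      by (simp add: image_affinity_atLeastAtMost_diff[of "-1" "-1", simplified] flip: diff_conv_add_uminus)
    moreover have "f (- 1 * x + 1) = f x" for x using sym[of x] by (simp add: algebra_simps)
    ultimately have "(f has_integral integral {0..1/2} f) {1/2..1}" by simp
    then show ?thesis by (rule integral_unique)
  qed
  also have "integral {0..1/2} f \<le> I"
    using f1 g le by (intro has_integral_le[OF integrable_integral[OF f1] g]) auto
  finally show ?thesis by linarith
qed

text \<open>Up to a phase, \<open>trap L h\<close> has trapezoidal Fourier coefficients with flanks of length \<open>h\<close>; it
  equals \<open>1\<close> at the \<open>L - h + 1\<close> frequencies of the plateau.\<close>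

definition trap :: "nat \<Rightarrow> nat \<Rightarrow> real \<Rightarrow> complex" where
  "trap L h \<beta> = dirichlet_kernel L \<beta> * dirichlet_kernel h \<beta> / of_nat h"

lemma continuous_on_trap [continuous_intros]:
  "continuous_on A f \<Longrightarrow> h > 0 \<Longrightarrow> continuous_on A (\<lambda>x. trap L h (f x))"
  unfolding trap_def by (intro continuous_intros) auto

lemma trap_periodic: "trap L h (\<beta> + 1) = trap L h \<beta>"
  by (simp add: trap_def dirichlet_kernel_periodic)

lemma norm_trap_reflect: "norm (trap L h (1 - \<beta>)) = norm (trap L h \<beta>)"
  by (simp add: trap_def norm_mult norm_divide norm_dirichlet_kernel_reflect)

text \<open>Beyond 1/h the second kernel makes the decay quadratic, so the logarithm only collects
  the range from 1/L to 1/h.\<close>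

lemma moment_1_trap:
  assumes h: "1 \<le> h" "h \<le> L"
  shows "moment 1 (trap L h) \<le> 8 * ln (4 * real L / real h)"
proof -
  define a where "a = 1 / (2 * real L)"
  have a: "a > 0" using h by (simp add: a_def)
  have ah: "a * real h \<le> 1/2" using h by (simp add: a_def field_simps)
  \<comment> \<open>Partial fractions: (1 - a h) / ((a + x) (1 + h x)) = 1 / (a + x) - h / (1 + h
    x).\<close>
  define G where "G = (\<lambda>\<beta>. 2 * (ln (a + \<beta>) - ln (1 + real h * \<beta>)) / (1 - a * real h))"
  have "((\<lambda>\<beta>. 2 / ((a + \<beta>) * (1 + real h * \<beta>))) has_integral (G (1/2) - G 0)) {0..1/2}"
  proof (rule fundamental_theorem_of_calculus)
    fix x :: real assume x: "x \<in> {0..1/2}"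
    have pos: "a + x > 0" "1 + real h * x > 0" "1 - a * real h > 0"
      using a x ah by (auto intro: add_pos_nonneg)
    have "2 * (1 / (a + x) - real h / (1 + real h * x)) / (1 - a * real h) = 2 / ((a + x) * (1 + real h * x))"
      using pos by (simp add: divide_simps) (simp add: algebra_simps)
    moreover have "(G has_real_derivative 2 * (1 / (a + x) - real h / (1 + real h * x)) / (1 - a * real h)) (at x within {0..1/2})"
      unfolding G_def using pos by (auto intro!: derivative_eq_intros simp: divide_simps)
    ultimately show "(G has_vector_derivative 2 / ((a + x) * (1 + real h * x))) (at x within {0..1/2})"
      by (simp add: has_real_derivative_iff_has_vector_derivative)
  qed simp
  moreover have "norm (trap L h x) \<le> 2 / ((a + x) * (1 + real h * x))" if x: "x \<in> {0..1/2}" for x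
  proof -
    have "norm (trap L h x) = norm (dirichlet_kernel L x) * norm (dirichlet_kernel h x) / real h"
      by (simp add: trap_def norm_mult norm_divide)
    also have "\<dots> \<le> (1 / (a + x)) * (1 / (1 / (2 * real h) + x)) / real h"
      using h x a norm_dirichlet_kernel_decay[of L x] norm_dirichlet_kernel_decay[of h x]
      by (intro divide_right_mono mult_mono) (auto simp: a_def)
    also have "\<dots> = 2 / ((a + x) * (1 + 2 * real h * x))"
    proof -
      have "1 / (2 * real h) + x = (1 + 2 * real h * x) / (2 * real h)"
        using h by (simp add: field_simps)
      then show ?thesis using h by simp
    qed
    \<comment> \<open>The factor 2 before h is given away on purpose: with it the partial fractions
      would divide by 1 - 2 a h, which is 0 for h = L, whereas 1 - a h >= 1/2.\<close>
    also have "\<dots> \<le> 2 / ((a + x) * (1 + real h * x))"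
      using x a h by (intro divide_left_mono mult_left_mono mult_pos_pos add_pos_nonneg) auto
    finally show ?thesis .
  qed
  ultimately have "moment 1 (trap L h) \<le> 2 * (G (1/2) - G 0)"
    unfolding moment_1 using h
    by (intro integral_symmetric_le continuous_intros norm_trap_reflect) auto
  also have "G (1/2) - G 0 = 2 * ln ((1 + real L) / (1 + real h / 2)) / (1 - a * real h)"
  proof -
    have "ln (a + 1/2) - ln a = ln ((a + 1/2) / a)" using a by (simp add: ln_div)
    also have "(a + 1/2) / a = 1 + real L" using h by (simp add: a_def field_simps)
    finally have "ln (a + 1/2) - ln (1 + real h / 2) - ln a = ln ((1 + real L) / (1 + real h / 2))"
      by (simp add: ln_div add_pos_nonneg)
    moreover have "G (1/2) - G 0 = 2 * (ln (a + 1/2) - ln (1 + real h / 2) - ln a) / (1 - a * real h)"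
      unfolding G_def diff_divide_distrib[symmetric] right_diff_distrib[symmetric] by simp
    ultimately show ?thesis by simp
  qed
  also have "\<dots> \<le> 2 * ln (4 * real L / real h) / (1/2)"
  proof (intro frac_le mult_left_mono)
    have "(1 + real L) / (1 + real h / 2) \<le> (2 * real L) / (real h / 2)"
      using h by (intro frac_le) auto
    then show "ln ((1 + real L) / (1 + real h / 2)) \<le> ln (4 * real L / real h)"
      using h by (subst ln_le_cancel_iff) auto
    have "1 \<le> 4 * real L / real h" using h by (simp add: field_simps)
    then show "0 \<le> 2 * ln (4 * real L / real h)" by simp
  qed (use ah in auto)
  finally show ?thesis by simp
qed

text \<open>For q > 1 the decay of the long kernel alone is integrable near its peak, so the short
  kernel is bounded trivially and no logarithm appears.\<close>

lemma moment_trap_le: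
  assumes h: "1 \<le> h" "1 \<le> L" and q: "q > 1"
  shows "moment q (trap L h) \<le> 2 * (2 * real L) powr (q - 1) / (q - 1)"
proof -
  define a where "a = 1 / (2 * real L)"
  have a: "a > 0" using h by (simp add: a_def)
  define G where "G = (\<lambda>\<beta>. (a + \<beta>) powr (1 - q) / (1 - q))"
  have "((\<lambda>\<beta>. (a + \<beta>) powr (- q)) has_integral (G (1/2) - G 0)) {0..1/2}"
  proof (rule fundamental_theorem_of_calculus)
    fix x :: real assume x: "x \<in> {0..1/2}"
    have pos: "a + x > 0" using a x by auto
    have "((\<lambda>\<beta>. (a + \<beta>) powr (1 - q)) has_real_derivative (1 - q) * (a + x) powr (1 - q - 1) * (0 + 1)) (at x within {0..1/2})"
      by (rule DERIV_chain2[OF has_real_derivative_powr]) (use pos in \<open>auto intro!: derivative_eq_intros\<close>)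
    from DERIV_cdivide[OF this, of "1 - q"]
    have "(G has_real_derivative (a + x) powr (- q)) (at x within {0..1/2})"
      unfolding G_def using q by simp
    then show "(G has_vector_derivative (a + x) powr (- q)) (at x within {0..1/2})"
      by (simp add: has_real_derivative_iff_has_vector_derivative)
  qed simp
  moreover have "norm (trap L h x) powr q \<le> (a + x) powr (- q)" if x: "x \<in> {0..1/2}" for x
  proof -
    have "norm (trap L h x) = norm (dirichlet_kernel L x) * (norm (dirichlet_kernel h x) / real h)"
      by (simp add: trap_def norm_mult norm_divide)
    also have "\<dots> \<le> (1 / (a + x)) * 1"
      using h x a norm_dirichlet_kernel_decay[of L x] norm_dirichlet_kernel_le[of h x]
      by (intro mult_mono) (auto simp: a_def)
    finally have "norm (trap L h x) powr q \<le> (1 / (a + x)) powr q"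
      using q by (intro powr_mono2) auto
    also have "\<dots> = (a + x) powr (- q)"
      using a x by (simp add: powr_minus powr_divide field_simps)
    finally show ?thesis .
  qed
  ultimately have "moment q (trap L h) \<le> 2 * (G (1/2) - G 0)"
    unfolding moment_def using h q
    by (intro integral_symmetric_le continuous_intros continuous_on_powr') (auto simp: norm_trap_reflect)
  also have "\<dots> \<le> 2 * (a powr (1 - q) / (q - 1))"
  proof -
    have "G (1/2) \<le> 0" using a q by (auto simp: G_def divide_le_0_iff)
    moreover have "- G 0 = a powr (1 - q) / (q - 1)"
      using q by (simp add: G_def divide_simps) (simp add: algebra_simps)
    ultimately have "G (1/2) - G 0 \<le> a powr (1 - q) / (q - 1)" by linarith
    then show ?thesis by (rule mult_left_mono) simp
  qed
  also have "a powr (1 - q) = (2 * real L) powr (q - 1)"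
    using h by (simp add: a_def powr_divide powr_diff)
  finally show ?thesis by simp
qed

lemma integral_periodic_multiple:
  fixes f :: "real \<Rightarrow> real"
  assumes f: "continuous_on UNIV f" and per: "\<And>x. f (x + 1) = f x"
  shows "integral {0..real n} f = real n * integral {0..1} f"
proof (induction n)
  case 0
  then show ?case by simp
next
  case (Suc n)
  have per': "f (x + real n) = f x" for x
  proof (induction n)
    case (Suc n)
    then show ?case using per[of "x + real n"] by (simp add: algebra_simps)
  qed simp
  have "integral {0..real (Suc n)} f = integral {0..real n} f + integral {real n..real (Suc n)} f"
    by (rule Henstock_Kurzweil_Integration.integral_combine[symmetric])
       (auto intro!: integrable_continuous_interval continuous_on_subset[OF f])
  also have "integral {real n..real (Suc n)} f = integral {0..1} (f \<circ> ((+) (real n)))"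
    by (subst integral_shift_Icc_real) (simp add: add.commute)
  also have "f \<circ> ((+) (real n)) = f" using per' by (auto simp: fun_eq_iff add.commute)
  finally show ?case using Suc by (simp add: algebra_simps)
qed

lemma integral_periodic_stretch:
  fixes f :: "real \<Rightarrow> real"
  assumes f: "continuous_on UNIV f" and per: "\<And>x. f (x + 1) = f x" and n: "n > 0"
  shows "integral {0..1} (\<lambda>x. f (real n * x)) = integral {0..1} f"
proof -
  have "f integrable_on {0..real n}"
    by (intro integrable_continuous_interval continuous_on_subset[OF f]) auto
  then have "(f has_integral (real n * integral {0..1} f)) {0..real n}"
    using integral_periodic_multiple[OF f per] by (metis integrable_integral)
  then have "((\<lambda>x. f (real n * x)) has_integral (1 / \<bar>real n\<bar>) *\<^sub>R (real n * integral {0..1} f)) ((\<lambda>x. x / real n) ` {0..real n})"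
    using n by (intro has_integral_stretch_real) auto
  moreover have "(\<lambda>x. x / real n) ` {0..real n} = {0..1}"
    using n by simp
  ultimately show ?thesis using n by (simp add: integral_unique)
qed

text \<open>A 1-periodic function keeps its mean under dilation by a positive integer, so the factor
  d^k disappears from the moments of single kernels.\<close>

lemma moment_stretch_trap:
  assumes "n > 0" "h > 0" "q > 0"
  shows "moment q (\<lambda>\<alpha>. trap L h (\<alpha> * real n)) = moment q (trap L h)"
  unfolding moment_def using assms
    integral_periodic_stretch[where f = "\<lambda>x. norm (trap L h x) powr q" and n = n]
  by (simp add: trap_periodic mult.commute continuous_intros continuous_on_powr')

subsection \<open>Dyadic decomposition\<close>

text \<open>The inner index runs over integers because the smoothed version, which is compared with
  it term by term, also has frequencies m <= 0.\<close>

definition dyadic_block :: "nat \<Rightarrow> nat \<Rightarrow> nat \<Rightarrow> real \<Rightarrow> complex" where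
  "dyadic_block k N D \<alpha> = (\<Sum>d\<in>{D..<2*D}. \<Sum>m\<in>{1..int (N div d ^ k)}.
      of_real (moebius d) * e_exp (\<alpha> * real (d ^ k) * of_int m))"

lemma sum_int_atLeastAtMost_1: "(\<Sum>m\<in>{1..int M}. f m) = (\<Sum>m=1..M. f (int m))"
proof -
  have "{1..int M} = int ` {1..M}" by (simp add: image_int_atLeastAtMost)
  then show ?thesis by (simp add: sum.reindex)
qed

lemma sum_dyadic: "(\<Sum>d\<in>{1..<2 ^ J}. f d) = (\<Sum>j<J. \<Sum>d\<in>{2 ^ j..<2 * 2 ^ j :: nat}. f d)"
proof (induction J)
  case (Suc J)
  have "{1..<2 ^ Suc J :: nat} = {1..<2 ^ J} \<union> {2 ^ J..<2 * 2 ^ J}" by auto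
  then have "(\<Sum>d\<in>{1..<2 ^ Suc J}. f d) = (\<Sum>d\<in>{1..<2 ^ J}. f d) + (\<Sum>d\<in>{2 ^ J..<2 * 2 ^ J}. f d)"
    by (simp add: sum.union_disjoint)
  then show ?case using Suc by simp
qed simp

text \<open>Any cutoff \<open>Y\<close> beyond N is harmless: d with d^k > N has an empty inner
  sum.\<close>

lemma S_k_eq_sum_moebius:
  assumes k: "k > 0" and J: "N < Y"
  shows "S_k k N \<alpha> = (\<Sum>d\<in>{1..<Y}. \<Sum>m=1..N div d ^ k. of_real (moebius d) * e_exp (\<alpha> * real (d ^ k) * real m))"
proof -
  have "S_k k N \<alpha> = (\<Sum>n=1..N. \<Sum>d\<in>{d\<in>{1..<Y}. d ^ k dvd n}. of_real (moebius d) * e_exp (\<alpha> * real n))"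
    unfolding S_k_def
  proof (intro sum.cong refl)
    fix n assume n: "n \<in> {1..N}"
    have "{d. d ^ k dvd n} = {d\<in>{1..<Y}. d ^ k dvd n}"
    proof (intro equalityI subsetI)
      fix d assume "d \<in> {d. d ^ k dvd n}"
      then have d: "d ^ k dvd n" by simp
      then have "d ^ k \<le> n" using n by (auto intro: dvd_imp_le)
      moreover have "d \<noteq> 0" using d n k by (intro notI) (auto simp: zero_power)
      moreover from this have "d \<le> d ^ k" using k by (intro self_le_power) auto
      ultimately show "d \<in> {d\<in>{1..<Y}. d ^ k dvd n}" using d n J by auto
    qed auto
    then have "mu_k k n = (\<Sum>d\<in>{d\<in>{1..<Y}. d ^ k dvd n}. moebius d)"
      using mu_k_eq_sum_moebius[of n k] n k by simp
    then show "of_real (mu_k k n) * e_exp (\<alpha> * real n) = (\<Sum>d\<in>{d\<in>{1..<Y}. d ^ k dvd n}. of_real (moebius d) * e_exp (\<alpha> * real n))"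
      by (simp add: sum_distrib_right)
  qed
  also have "\<dots> = (\<Sum>d\<in>{1..<Y}. \<Sum>n\<in>{n\<in>{1..N}. d ^ k dvd n}. of_real (moebius d) * e_exp (\<alpha> * real n))"
    by (rule sum.swap_restrict) auto
  also have "\<dots> = (\<Sum>d\<in>{1..<Y}. \<Sum>m=1..N div d ^ k. of_real (moebius d) * e_exp (\<alpha> * real (d ^ k) * real m))"
  proof (rule sum.cong[OF refl])
    fix d assume "d \<in> {1..<Y}"
    then have "d ^ k > 0" by simp
    then show "(\<Sum>n\<in>{n\<in>{1..N}. d ^ k dvd n}. of_real (moebius d) * e_exp (\<alpha> * real n))
        = (\<Sum>m=1..N div d ^ k. of_real (moebius d) * e_exp (\<alpha> * real (d ^ k) * real m))"
      by (subst sum_multiples) (auto simp: mult.assoc)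
  qed
  finally show ?thesis .
qed

definition low_part :: "nat \<Rightarrow> nat \<Rightarrow> nat \<Rightarrow> real \<Rightarrow> complex" where
  "low_part k N Y \<alpha> = (\<Sum>d\<in>{1..<Y}. \<Sum>m=1..N div d ^ k. of_real (moebius d) * e_exp (\<alpha> * real (d ^ k) * real m))"

lemma low_part_eq_sum_dyadic_block: "low_part k N (2 ^ J) \<alpha> = (\<Sum>j<J. dyadic_block k N (2 ^ j) \<alpha>)"
  unfolding low_part_def dyadic_block_def sum_dyadic sum_int_atLeastAtMost_1 by simp

lemma S_k_eq_sum_dyadic_block:
  assumes "k > 0" "J \<le> N"
  shows "S_k k N \<alpha> = low_part k N (2 ^ J) \<alpha> + (\<Sum>j\<in>{J..<N}. dyadic_block k N (2 ^ j) \<alpha>)"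
proof -
  \<comment> \<open>The generous cutoff 2^N exceeds N, so the blocks j < N exhaust the sum.\<close>
  have "S_k k N \<alpha> = low_part k N (2 ^ N) \<alpha>"
    unfolding low_part_def using assms by (intro S_k_eq_sum_moebius) auto
  also have "\<dots> = (\<Sum>j<J. dyadic_block k N (2 ^ j) \<alpha>) + (\<Sum>j\<in>{J..<N}. dyadic_block k N (2 ^ j) \<alpha>)"
    unfolding low_part_eq_sum_dyadic_block lessThan_atLeast0 using assms(2)
    by (intro sum.atLeastLessThan_concat[symmetric]) auto
  finally show ?thesis by (simp add: low_part_eq_sum_dyadic_block)
qed

lemma continuous_on_dyadic_block [continuous_intros]: "continuous_on A (dyadic_block k N D)"
  unfolding dyadic_block_def by (intro continuous_intros)

lemma continuous_on_low_part [continuous_intros]: "continuous_on A (low_part k N Y)"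
  unfolding low_part_def by (intro continuous_intros)

lemma continuous_on_S_k [continuous_intros]: "continuous_on A (S_k k N)"
  unfolding S_k_def by (intro continuous_intros)

lemma moment_2_dyadic_block_le:
  assumes k: "k \<ge> 2" and D: "D \<ge> 1"
  shows "moment 2 (dyadic_block k N D) \<le> 2 ^ (k + 1) * real N / real D ^ (k - 1)"
proof -
  \<comment> \<open>The additive counting error is 0: the range starts at 1, so the multiples of q
    in it number exactly \<open>M div q\<close>.\<close>
  have "moment 2 (dyadic_block k N D) \<le> 2 ^ (k + 1) * (real N / real D ^ k) * real D + 0 * (real D)\<^sup>2"
    unfolding dyadic_block_def
  proof (intro mean_square_block_le k D)
    fix d and q :: int assume d: "d \<in> {D..<2*D}" and q: "q > 0"
    define M where "M = N div d ^ k"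
    have "{m \<in> {1..int M}. q dvd m} = int ` {m \<in> {1..M}. nat q dvd m}"
    proof (intro equalityI subsetI)
      fix m assume m: "m \<in> {m \<in> {1..int M}. q dvd m}"
      then have "m = int (nat m)" "nat m \<in> {m \<in> {1..M}. nat q dvd m}" using q by (auto simp: nat_dvd_iff)
      then show "m \<in> int ` {m \<in> {1..M}. nat q dvd m}" by blast
    qed (use q in \<open>auto simp: nat_dvd_iff\<close>)
    also have "card \<dots> = card {m \<in> {1..M}. nat q dvd m}" by (intro card_image) auto
    also have "\<dots> = M div nat q"
      using q by (subst multiples_eq_image) (auto simp: card_image inj_on_def)
    finally have "real (card {m \<in> {1..int M}. q dvd m}) = real (M div nat q)" by simp
    also have "\<dots> \<le> real M / real (nat q)" by (rule of_nat_div_le_of_nat)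
    also have "\<dots> = real M / of_int q" using q by simp
    also have "\<dots> \<le> (real N / real D ^ k) / of_int q"
    proof (intro divide_right_mono)
      have "real M \<le> real N / real (d ^ k)" unfolding M_def by (rule of_nat_div_le_of_nat)
      also have "\<dots> \<le> real N / real D ^ k"
        using d D by (simp add: divide_left_mono power_mono)
      finally show "real M \<le> real N / real D ^ k" .
    qed (use q in auto)
    finally show "real (card {m \<in> {1..int (N div d ^ k)}. q dvd m}) \<le> real N / real D ^ k / of_int q + 0"
      by (simp add: M_def)
  qed (auto simp: abs_moebius_le_1)
  also have "\<dots> = 2 ^ (k + 1) * real N / real D ^ (k - 1)"
    using k D by (simp add: power_diff)
  finally show ?thesis .
qed

section \<open>Smoothing the blocks\<close>

definition trap_weight :: "nat \<Rightarrow> nat \<Rightarrow> int \<Rightarrow> real" where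
  "trap_weight L h m = real (card {t\<in>{..<h}. 0 \<le> m + int h - 1 - int t \<and> m + int h - 1 - int t < int L}) / real h"

lemma trap_weight_bounds:
  assumes "h > 0"
  shows "0 \<le> trap_weight L h m" "trap_weight L h m \<le> 1"
proof -
  have "card {t\<in>{..<h}. 0 \<le> m + int h - 1 - int t \<and> m + int h - 1 - int t < int L} \<le> card {..<h}"
    by (intro card_mono) auto
  then show "trap_weight L h m \<le> 1" using assms by (simp add: trap_weight_def)
qed (simp add: trap_weight_def)

lemma trap_weight_plateau:
  assumes "h > 0" "0 \<le> m" "m \<le> int L - int h"
  shows "trap_weight L h m = 1"
proof -
  have "{t\<in>{..<h}. 0 \<le> m + int h - 1 - int t \<and> m + int h - 1 - int t < int L} = {..<h}"
    using assms by auto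
  then show ?thesis using assms by (simp add: trap_weight_def)
qed

text \<open>In the product of the two kernels, frequency m + h - 1 arises from each index t of the
  short kernel for which m + h - 1 - t is an index of the long one; \<open>trap_weight\<close>
  counts these t. The phase shifts the plateau to 0, ..., L - h.\<close>

lemma trap_expand:
  assumes h: "h > 0"
  shows "e_exp (- (\<beta> * (real h - 1))) * trap L h \<beta> = (\<Sum>m\<in>{1 - int h..<int L}. of_real (trap_weight L h m) * e_exp (\<beta> * of_int m))"
proof -
  let ?c = "\<lambda>m t. 0 \<le> m + int h - 1 - int t \<and> m + int h - 1 - int t < int L"
  have "(\<Sum>m\<in>{1 - int h..<int L}. of_real (trap_weight L h m) * e_exp (\<beta> * of_int m))
      = (\<Sum>m\<in>{1 - int h..<int L}. \<Sum>t\<in>{t\<in>{..<h}. ?c m t}. e_exp (\<beta> * of_int m) / of_nat h)"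
    by (simp add: trap_weight_def)
  also have "\<dots> = (\<Sum>t<h. \<Sum>m\<in>{m\<in>{1 - int h..<int L}. ?c m t}. e_exp (\<beta> * of_int m) / of_nat h)"
    by (rule sum.swap_restrict) auto
  also have "\<dots> = (\<Sum>t<h. \<Sum>s<L. e_exp (\<beta> * real s) * e_exp (\<beta> * real t) * e_exp (- (\<beta> * (real h - 1))) / of_nat h)"
  proof (intro sum.cong refl)
    fix t assume t: "t \<in> {..<h}"
    have "{m\<in>{1 - int h..<int L}. ?c m t} = (\<lambda>s. int s + int t - int h + 1) ` {..<L}"
    proof (intro equalityI subsetI)
      fix m assume "m \<in> {m\<in>{1 - int h..<int L}. ?c m t}"
      then show "m \<in> (\<lambda>s. int s + int t - int h + 1) ` {..<L}"
        by (intro image_eqI[of _ _ "nat (m + int h - 1 - int t)"]) auto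
    qed (use t in auto)
    then have "(\<Sum>m\<in>{m\<in>{1 - int h..<int L}. ?c m t}. e_exp (\<beta> * of_int m) / of_nat h)
        = (\<Sum>s<L. e_exp (\<beta> * of_int (int s + int t - int h + 1)) / of_nat h)"
      by (simp add: sum.reindex inj_on_def)
    also have "\<dots> = (\<Sum>s<L. e_exp (\<beta> * real s) * e_exp (\<beta> * real t) * e_exp (- (\<beta> * (real h - 1))) / of_nat h)"
      by (intro sum.cong refl) (simp add: algebra_simps flip: e_exp_add)
    finally show "(\<Sum>m\<in>{m\<in>{1 - int h..<int L}. ?c m t}. e_exp (\<beta> * of_int m) / of_nat h) = \<dots>" .
  qed
  also have "\<dots> = e_exp (- (\<beta> * (real h - 1))) * trap L h \<beta>"
    unfolding trap_def dirichlet_kernel_def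
    by (simp add: sum_distrib_left sum_distrib_right sum_divide_distrib mult_ac sum.swap[of _ "{..<L}"])
  finally show ?thesis by simp
qed

text \<open>The sharp ranges \<open>1 \<le> m \<le> N div d\<^sup>k\<close> of \<open>dyadic_block\<close> are replaced by trapezoids with flanks of
  length \<open>D\<close>. With this length both flanks together cost only \<open>O(D)\<close> in the \<open>L\<^sup>2\<close> norm, while the \<open>L\<^sup>1\<close> norm of
  each kernel drops from \<open>log N\<close> to \<open>1 + log (y / D)\<close> with \<open>y = N^(1/(k+1))\<close>.\<close>

definition smooth_block :: "nat \<Rightarrow> nat \<Rightarrow> nat \<Rightarrow> real \<Rightarrow> complex" where
  "smooth_block k N D \<alpha> = (\<Sum>d\<in>{D..<2*D}. of_real (moebius d) *
      (e_exp (- (\<alpha> * real (d ^ k) * (real D - 1))) * trap (N div d ^ k + D) D (\<alpha> * real (d ^ k))))"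

lemma continuous_on_smooth_block [continuous_intros]: "D > 0 \<Longrightarrow> continuous_on A (smooth_block k N D)"
  unfolding smooth_block_def by (intro continuous_intros) auto

text \<open>For each d the difference lives on two windows of at most D integers, which contain at
  most 2 D / q + 2 multiples of q. Hence the bound D^2, independent of N.\<close>

lemma moment_2_edge_le:
  assumes k: "k \<ge> 2" and D: "D \<ge> 1"
  shows "moment 2 (\<lambda>\<alpha>. smooth_block k N D \<alpha> - dyadic_block k N D \<alpha>) \<le> (2 ^ (k + 2) + 2) * (real D)\<^sup>2"
proof -
  define M where "M = (\<lambda>d. N div d ^ k)"
  \<comment> \<open>The left window ends at 0, not at -1: the frequency 0 lies on the plateau but
    does not occur in the block.\<close>
  define W where "W = (\<lambda>d. {1 - int D..0} \<union> {int (M d) + 1..<int (M d + D)})"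
  have eq: "(\<lambda>\<alpha>. smooth_block k N D \<alpha> - dyadic_block k N D \<alpha>) = (\<lambda>\<alpha>. \<Sum>d\<in>{D..<2*D}. \<Sum>m\<in>W d. of_real (moebius d * trap_weight (M d + D) D m) * e_exp (\<alpha> * real (d ^ k) * of_int m))"
    unfolding smooth_block_def dyadic_block_def sum_subtractf[symmetric]
  proof (intro ext sum.cong refl)
    fix d \<alpha>
    have "{1 - int D..<int (M d + D)} = W d \<union> {1..int (M d)}" using D by (auto simp: W_def)
    moreover have "W d \<inter> {1..int (M d)} = {}" by (auto simp: W_def)
    ultimately have "(\<Sum>m\<in>{1 - int D..<int (M d + D)}. of_real (trap_weight (M d + D) D m) * e_exp (\<alpha> * real (d ^ k) * of_int m))
        = (\<Sum>m\<in>W d. of_real (trap_weight (M d + D) D m) * e_exp (\<alpha> * real (d ^ k) * of_int m))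
        + (\<Sum>m\<in>{1..int (M d)}. of_real (trap_weight (M d + D) D m) * e_exp (\<alpha> * real (d ^ k) * of_int m))"
      by (simp add: sum.union_disjoint W_def)
    also have "(\<Sum>m\<in>{1..int (M d)}. of_real (trap_weight (M d + D) D m) * e_exp (\<alpha> * real (d ^ k) * of_int m))
        = (\<Sum>m\<in>{1..int (M d)}. e_exp (\<alpha> * real (d ^ k) * of_int m))"
      using D by (intro sum.cong refl) (auto simp: trap_weight_plateau)
    finally have "(\<Sum>m\<in>{1 - int D..<int (M d + D)}. of_real (trap_weight (M d + D) D m) * e_exp (\<alpha> * real (d ^ k) * of_int m))
        - (\<Sum>m\<in>{1..int (M d)}. e_exp (\<alpha> * real (d ^ k) * of_int m))
        = (\<Sum>m\<in>W d. of_real (trap_weight (M d + D) D m) * e_exp (\<alpha> * real (d ^ k) * of_int m))" by simp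
    then have "of_real (moebius d) * ((\<Sum>m\<in>{1 - int D..<int (M d + D)}. of_real (trap_weight (M d + D) D m) * e_exp (\<alpha> * real (d ^ k) * of_int m))
        - (\<Sum>m\<in>{1..int (M d)}. e_exp (\<alpha> * real (d ^ k) * of_int m)))
        = of_real (moebius d) * (\<Sum>m\<in>W d. of_real (trap_weight (M d + D) D m) * e_exp (\<alpha> * real (d ^ k) * of_int m))" by simp
    then show "of_real (moebius d) * (e_exp (- (\<alpha> * real (d ^ k) * (real D - 1))) * trap (N div d ^ k + D) D (\<alpha> * real (d ^ k)))
        - (\<Sum>m\<in>{1..int (N div d ^ k)}. of_real (moebius d) * e_exp (\<alpha> * real (d ^ k) * of_int m))
        = (\<Sum>m\<in>W d. of_real (moebius d * trap_weight (M d + D) D m) * e_exp (\<alpha> * real (d ^ k) * of_int m))"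
      using D trap_expand[of D "\<alpha> * real (d ^ k)" "N div d ^ k + D"]
      by (simp add: M_def sum_distrib_left right_diff_distrib mult.assoc)
  qed
  have "moment 2 (\<lambda>\<alpha>. smooth_block k N D \<alpha> - dyadic_block k N D \<alpha>) \<le> 2 ^ (k + 1) * (2 * real D) * real D + 2 * (real D)\<^sup>2"
    unfolding eq
  proof (intro mean_square_block_le k D)
    fix d and m assume "m \<in> W d"
    show "norm (of_real (moebius d * trap_weight (M d + D) D m) :: complex) \<le> 1"
      using mult_mono[OF abs_moebius_le_1[of d] trap_weight_bounds(2)[of D "M d + D" m]] trap_weight_bounds(1)[of D "M d + D" m] D
      by (simp add: norm_mult abs_mult)
  next
    fix d and q :: int assume d: "d \<in> {D..<2*D}" and q: "q > 0"
    have "{m \<in> W d. q dvd m} \<subseteq> {m \<in> {1 - int D..<(1 - int D) + int D}. q dvd m} \<union> {m \<in> {int (M d) + 1..<(int (M d) + 1) + int D}. q dvd m}"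
      by (auto simp: W_def)
    then have "card {m \<in> W d. q dvd m} \<le> card ({m \<in> {1 - int D..<(1 - int D) + int D}. q dvd m} \<union> {m \<in> {int (M d) + 1..<(int (M d) + 1) + int D}. q dvd m})"
      by (intro card_mono finite_UnI finite_Collect_conjI disjI1) simp_all
    also have "\<dots> \<le> card {m \<in> {1 - int D..<(1 - int D) + int D}. q dvd m} + card {m \<in> {int (M d) + 1..<(int (M d) + 1) + int D}. q dvd m}"
      by (rule card_Un_le)
    finally have "real (card {m \<in> W d. q dvd m}) \<le> real (card {m \<in> {1 - int D..<(1 - int D) + int D}. q dvd m}) + real (card {m \<in> {int (M d) + 1..<(int (M d) + 1) + int D}. q dvd m})"
      by linarith
    also have "\<dots> \<le> (of_int (int D) / of_int q + 1) + (of_int (int D) / of_int q + 1)"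
      using q by (intro add_mono card_multiples_int_le) auto
    finally show "real (card {m \<in> W d. q dvd m}) \<le> 2 * real D / of_int q + 2" by simp
  qed (auto simp: W_def)
  also have "\<dots> = (2 ^ (k + 2) + 2) * (real D)\<^sup>2"
    by (simp add: power2_eq_square algebra_simps)
  finally show ?thesis .
qed

text \<open>The triangle inequality over the D kernels of the block; cancellation between different
  d is exploited only in mean squares.\<close>

lemma moment_smooth_block_le:
  assumes D: "D \<ge> 1" and q: "q \<ge> 1" and C: "C > 0"
    and le: "\<And>d. d \<in> {D..<2*D} \<Longrightarrow> moment q (trap (N div d ^ k + D) D) \<le> C"
  shows "moment q (smooth_block k N D) \<le> real D powr q * C"
proof -
  have "moment q (smooth_block k N D) \<le> (\<Sum>d\<in>{D..<2*D}. C powr (1 / q)) powr q"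
    unfolding smooth_block_def
  proof (intro moment_sum_le)
    fix d assume d: "d \<in> {D..<2*D}"
    have "moment q (\<lambda>\<alpha>. of_real (moebius d) * (e_exp (- (\<alpha> * real (d ^ k) * (real D - 1))) * trap (N div d ^ k + D) D (\<alpha> * real (d ^ k))))
        \<le> moment q (\<lambda>\<alpha>. trap (N div d ^ k + D) D (\<alpha> * real (d ^ k)))"
      using D q abs_moebius_le_1[of d]
      by (intro moment_mono continuous_intros) (auto simp: norm_mult intro: mult_left_le_one_le)
    also have "\<dots> = moment q (trap (N div d ^ k + D) D)"
      using d D q by (intro moment_stretch_trap) auto
    also have "\<dots> \<le> C" by (rule le[OF d])
    also have "C = (C powr (1 / q)) powr q" using C q by (simp add: powr_powr)
    finally show "moment q (\<lambda>\<alpha>. of_real (moebius d) * (e_exp (- (\<alpha> * real (d ^ k) * (real D - 1))) * trap (N div d ^ k + D) D (\<alpha> * real (d ^ k))))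
        \<le> (C powr (1 / q)) powr q" .
  qed (use D q C in \<open>auto intro!: continuous_intros\<close>)
  also have "\<dots> = real D powr q * C"
    using C q by (simp add: powr_mult powr_powr)
  finally show ?thesis .
qed

subsection \<open>Upper bounds\<close>

lemma ex_dyadic:
  fixes y :: real
  assumes "y \<ge> 1"
  obtains J :: nat where "2 ^ J \<le> y" "y < 2 ^ (J + 1)"
proof -
  define n where "n = nat \<lfloor>y\<rfloor>"
  have n: "1 \<le> n" "real n \<le> y" "y < real n + 1"
    using assms by (auto simp: n_def le_nat_iff le_floor_iff)
  obtain J where J: "2 ^ J \<le> n" "n < 2 ^ (J + 1)"
    using ex_power_ivl1[of 2 n] n by auto
  have "2 ^ J \<le> y" using J n by (metis of_nat_le_iff of_nat_numeral of_nat_power order_trans)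
  moreover have "real n + 1 \<le> 2 ^ (J + 1)"
  proof -
    have "Suc n \<le> 2 ^ (J + 1)" using J by simp
    then have "real (Suc n) \<le> real (2 ^ (J + 1))" by (rule of_nat_mono)
    then show ?thesis by simp
  qed
  ultimately show ?thesis using n that[of J] by linarith
qed

text \<open>Since k >= 2, the bounds N / D^(k-1) at least halve from block to block, so the first
  block dominates.\<close>

lemma moment_2_tail_le:
  assumes k: "k \<ge> 2" and N: "N \<ge> 1"
  shows "moment 2 (\<lambda>\<alpha>. \<Sum>j\<in>{J..<N}. dyadic_block k N (2 ^ j) \<alpha>)
    \<le> 2 ^ (k + 1) * real N / (2 ^ J) ^ (k - 1) * (1 / (1 - (1/2) powr (1/2))) powr 2"
proof (rule moment_sum_geometric_le[where \<pi> = "\<lambda>j. j - J"])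
  fix j assume j: "j \<in> {J..<N}"
  have "moment 2 (dyadic_block k N (2 ^ j)) \<le> 2 ^ (k + 1) * real N / real (2 ^ j) ^ (k - 1)"
    by (rule moment_2_dyadic_block_le) (use k in auto)
  also have "\<dots> \<le> 2 ^ (k + 1) * real N / ((2 ^ J) ^ (k - 1) * 2 ^ (j - J))"
  proof (intro divide_left_mono mult_pos_pos)
    have "(2::real) ^ j = 2 ^ J * 2 ^ (j - J)" using j by (simp flip: power_add)
    then have "real (2 ^ j) ^ (k - 1) = (2 ^ J) ^ (k - 1) * (2 ^ (j - J)) ^ (k - 1)"
      by (simp add: power_mult_distrib)
    also have "\<dots> \<ge> (2 ^ J) ^ (k - 1) * 2 ^ (j - J)"
      using k by (intro mult_left_mono self_le_power) auto
    finally show "(2 ^ J) ^ (k - 1) * 2 ^ (j - J) \<le> real (2 ^ j) ^ (k - 1)" .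
  qed auto
  also have "\<dots> = 2 ^ (k + 1) * real N / (2 ^ J) ^ (k - 1) * (1 / 2) ^ (j - J)"
    by (simp add: power_divide)
  finally show "moment 2 (dyadic_block k N (2 ^ j)) \<le> 2 ^ (k + 1) * real N / (2 ^ J) ^ (k - 1) * (1 / 2) ^ (j - J)" .
next
  show "inj_on (\<lambda>j. j - J) {J..<N}" by (auto simp: inj_on_def)
qed (use N in \<open>auto intro!: continuous_intros\<close>)

text \<open>The flank bounds grow like D^2, so here the largest block dominates.\<close>

lemma moment_2_edges_le:
  assumes k: "k \<ge> 2" and y: "2 ^ J \<le> y"
  shows "moment 2 (\<lambda>\<alpha>. \<Sum>j<J. smooth_block k N (2 ^ j) \<alpha> - dyadic_block k N (2 ^ j) \<alpha>)
    \<le> (2 ^ (k + 2) + 2) * y\<^sup>2 * (1 / (1 - (1/4) powr (1/2))) powr 2"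
proof (rule moment_sum_geometric_le[where \<pi> = "\<lambda>j. J - j"])
  have y0: "y > 0" using y by (rule less_le_trans[rotated]) simp
  then show "(2 ^ (k + 2) + 2) * y\<^sup>2 > 0" by (simp add: add_pos_pos)
  fix j assume j: "j \<in> {..<J}"
  have "moment 2 (\<lambda>\<alpha>. smooth_block k N (2 ^ j) \<alpha> - dyadic_block k N (2 ^ j) \<alpha>) \<le> (2 ^ (k + 2) + 2) * (real (2 ^ j))\<^sup>2"
    by (rule moment_2_edge_le) (use k in auto)
  also have "(real (2 ^ j))\<^sup>2 = (2 ^ J)\<^sup>2 * (1/4) ^ (J - j)"
  proof -
    have "(2::real) ^ J = 2 ^ j * 2 ^ (J - j)" using j by (simp flip: power_add)
    then have "(2 ^ J)\<^sup>2 = (2 ^ j)\<^sup>2 * (4::real) ^ (J - j)"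
      using power_mult[of "2::real" "J - j" 2] power_mult[of "2::real" 2 "J - j"]
      by (simp add: power_mult_distrib mult.commute)
    then show ?thesis by (simp add: power_divide)
  qed
  also have "(2 ^ (k + 2) + 2) * ((2 ^ J)\<^sup>2 * (1/4) ^ (J - j)) \<le> (2 ^ (k + 2) + 2) * (y\<^sup>2 * (1/4) ^ (J - j))"
    using y by (intro mult_left_mono mult_right_mono power_mono) auto
  finally show "moment 2 (\<lambda>\<alpha>. smooth_block k N (2 ^ j) \<alpha> - dyadic_block k N (2 ^ j) \<alpha>) \<le> (2 ^ (k + 2) + 2) * y\<^sup>2 * (1/4) ^ (J - j)"
    by (simp add: mult.assoc)
next
  show "inj_on (\<lambda>j. J - j) {..<J}" by (auto simp: inj_on_def)
qed (auto intro!: continuous_intros)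

lemma dyadic_index_le:
  fixes y :: real
  assumes "y ^ (k + 1) = real N" "2 ^ J \<le> y"
  shows "J \<le> N" "y \<ge> 1" "y \<le> real N" "N \<ge> 1"
proof -
  show y1: "y \<ge> 1" using assms(2) by (rule order_trans[rotated]) simp
  then have "y ^ 1 \<le> y ^ (k + 1)" by (intro power_increasing) auto
  then show yN: "y \<le> real N" using assms by simp
  then show "N \<ge> 1" using y1 by linarith
  have "real J < 2 ^ J" by simp
  then show "J \<le> N" using assms(2) yN by linarith
qed

text \<open>With 2^J within a factor 2 of y, the tail has mean square of order N / y^(k-1) = y^2,
  which is also the bound for the flanks.\<close>

lemma moment_2_rest_le:
  assumes k: "k \<ge> 2"
  obtains C where "C > 0"
    "\<And>N J y. y ^ (k + 1) = real N \<Longrightarrow> 2 ^ J \<le> y \<Longrightarrow> y < 2 ^ (J + 1) \<Longrightarrow>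
      moment 2 (\<lambda>\<alpha>. S_k k N \<alpha> - (\<Sum>j<J. smooth_block k N (2 ^ j) \<alpha>)) \<le> C * y\<^sup>2"
proof -
  define c1 where "c1 = (1 / (1 - (1/2) powr (1/2)) :: real) powr 2"
  define c2 where "c2 = (1 / (1 - (1/4) powr (1/2)) :: real) powr 2"
  define C :: real where "C = 4 * (2 ^ (k + 1) * 2 ^ (k - 1) * c1 + (2 ^ (k + 2) + 2) * c2) + 1"
  have c: "c1 \<ge> 0" "c2 \<ge> 0" by (simp_all add: c1_def c2_def)
  have C: "C > 0" unfolding C_def using c by (intro add_nonneg_pos mult_nonneg_nonneg add_nonneg_nonneg) auto
  moreover have "moment 2 (\<lambda>\<alpha>. S_k k N \<alpha> - (\<Sum>j<J. smooth_block k N (2 ^ j) \<alpha>)) \<le> C * y\<^sup>2"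
    if y: "y ^ (k + 1) = real N" "2 ^ J \<le> y" "y < 2 ^ (J + 1)" for N J y
  proof -
    note NJ = dyadic_index_le[OF y(1,2)]
    have "(\<lambda>\<alpha>. S_k k N \<alpha> - (\<Sum>j<J. smooth_block k N (2 ^ j) \<alpha>)) =
        (\<lambda>\<alpha>. (\<Sum>j\<in>{J..<N}. dyadic_block k N (2 ^ j) \<alpha>) + - (\<Sum>j<J. smooth_block k N (2 ^ j) \<alpha> - dyadic_block k N (2 ^ j) \<alpha>))"
      using k NJ by (intro ext) (simp add: S_k_eq_sum_dyadic_block low_part_eq_sum_dyadic_block sum_subtractf)
    then have "moment 2 (\<lambda>\<alpha>. S_k k N \<alpha> - (\<Sum>j<J. smooth_block k N (2 ^ j) \<alpha>))
        \<le> 2 powr 2 * (moment 2 (\<lambda>\<alpha>. \<Sum>j\<in>{J..<N}. dyadic_block k N (2 ^ j) \<alpha>) + moment 2 (\<lambda>\<alpha>. - (\<Sum>j<J. smooth_block k N (2 ^ j) \<alpha> - dyadic_block k N (2 ^ j) \<alpha>)))"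
      by (simp only:) (intro moment_add_le continuous_intros, auto)
    also have "\<dots> \<le> 2 powr 2 * (2 ^ (k + 1) * real N / (2 ^ J) ^ (k - 1) * c1 + (2 ^ (k + 2) + 2) * y\<^sup>2 * c2)"
      unfolding c1_def c2_def moment_minus
      using NJ y k by (intro mult_left_mono add_mono moment_2_tail_le moment_2_edges_le) auto
    also have "\<dots> \<le> 4 * (2 ^ (k + 1) * (2 ^ (k - 1) * y\<^sup>2) * c1 + (2 ^ (k + 2) + 2) * y\<^sup>2 * c2)"
    proof -
      have "real N / (2 ^ J) ^ (k - 1) \<le> real N / (y / 2) ^ (k - 1)"
        using y NJ by (intro divide_left_mono power_mono mult_pos_pos) auto
      also have "\<dots> = 2 ^ (k - 1) * y\<^sup>2"
      proof -
        have "k + 1 = 2 + (k - 1)" using k by simp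
        then have "y ^ (k + 1) = y\<^sup>2 * y ^ (k - 1)" by (metis power_add)
        then show ?thesis using y(1)[symmetric] NJ by (simp add: power_divide)
      qed
      finally have "2 ^ (k + 1) * real N / (2 ^ J) ^ (k - 1) \<le> 2 ^ (k + 1) * (2 ^ (k - 1) * y\<^sup>2)"
        by (simp add: mult_left_mono flip: times_divide_eq_right)
      then have "2 ^ (k + 1) * real N / (2 ^ J) ^ (k - 1) * c1 \<le> 2 ^ (k + 1) * (2 ^ (k - 1) * y\<^sup>2) * c1"
        using c by (intro mult_right_mono)
      then show ?thesis by (simp add: powr_numeral)
    qed
    also have "\<dots> = (C - 1) * y\<^sup>2" by (simp add: C_def algebra_simps)
    also have "\<dots> \<le> C * y\<^sup>2" by (simp add: algebra_simps)
    finally show ?thesis .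
  qed
  ultimately show ?thesis by (rule that)
qed

text \<open>As p <= 2, Lyapunov's inequality turns the mean square O(y^2) of the rest into O(y^p);
  only the smooth blocks remain to be estimated.\<close>

lemma moment_S_k_reduce:
  assumes k: "k \<ge> 2" and p: "0 \<le> p" "p \<le> 2"
  obtains C where "C > 0"
    "\<And>N J y. y ^ (k + 1) = real N \<Longrightarrow> 2 ^ J \<le> y \<Longrightarrow> y < 2 ^ (J + 1) \<Longrightarrow>
      I_k k N p \<le> C * (moment p (\<lambda>\<alpha>. \<Sum>j<J. smooth_block k N (2 ^ j) \<alpha>) + y powr p)"
proof -
  obtain C where C: "C > 0" "\<And>N J y. y ^ (k + 1) = real N \<Longrightarrow> 2 ^ J \<le> y \<Longrightarrow> y < 2 ^ (J + 1) \<Longrightarrow>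
      moment 2 (\<lambda>\<alpha>. S_k k N \<alpha> - (\<Sum>j<J. smooth_block k N (2 ^ j) \<alpha>)) \<le> C * y\<^sup>2"
    using moment_2_rest_le[OF k] by blast
  define B where "B = 2 powr p * (1 + C powr (p / 2))"
  have "B > 0" by (simp add: B_def add_pos_nonneg)
  moreover have "I_k k N p \<le> B * (moment p (\<lambda>\<alpha>. \<Sum>j<J. smooth_block k N (2 ^ j) \<alpha>) + y powr p)"
    if y: "y ^ (k + 1) = real N" "2 ^ J \<le> y" "y < 2 ^ (J + 1)" for N J y
  proof -
    note NJ = dyadic_index_le[OF y(1,2)]
    have "moment p (\<lambda>\<alpha>. S_k k N \<alpha> - (\<Sum>j<J. smooth_block k N (2 ^ j) \<alpha>)) \<le> (C * y\<^sup>2) powr (p / 2)"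
      using p C(1) C(2)[OF y] NJ by (intro moment_lyapunov continuous_intros) auto
    also have "\<dots> = C powr (p / 2) * y powr p"
      using NJ C(1) by (simp add: powr_mult powr_powr flip: powr_numeral)
    finally have R: "moment p (\<lambda>\<alpha>. S_k k N \<alpha> - (\<Sum>j<J. smooth_block k N (2 ^ j) \<alpha>)) \<le> C powr (p / 2) * y powr p" .
    have "I_k k N p = moment p (\<lambda>\<alpha>. (\<Sum>j<J. smooth_block k N (2 ^ j) \<alpha>) + (S_k k N \<alpha> - (\<Sum>j<J. smooth_block k N (2 ^ j) \<alpha>)))"
      by (simp add: I_k_def moment_def)
    also have "\<dots> \<le> 2 powr p * (moment p (\<lambda>\<alpha>. \<Sum>j<J. smooth_block k N (2 ^ j) \<alpha>) + moment p (\<lambda>\<alpha>. S_k k N \<alpha> - (\<Sum>j<J. smooth_block k N (2 ^ j) \<alpha>)))"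
      using p by (intro moment_add_le continuous_intros) auto
    also have "\<dots> \<le> 2 powr p * ((1 + C powr (p / 2)) * moment p (\<lambda>\<alpha>. \<Sum>j<J. smooth_block k N (2 ^ j) \<alpha>) + (1 + C powr (p / 2)) * y powr p)"
      using R moment_nonneg[of p "\<lambda>\<alpha>. \<Sum>j<J. smooth_block k N (2 ^ j) \<alpha>"]
      by (intro mult_left_mono add_mono) (auto simp: ring_distribs intro: add_increasing)
    finally show ?thesis by (simp add: B_def algebra_simps)
  qed
  ultimately show ?thesis by (rule that)
qed

section \<open>Moments of a single smooth block\<close>

context
  fixes k N D :: nat and y :: real
  assumes k: "k \<ge> 2" and y: "y ^ (k + 1) = real N" and D: "D \<ge> 1" "real D \<le> y"
begin

lemma block_D_power_le: "real D ^ (k + 1) \<le> real N"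
  unfolding y[symmetric] using D by (intro power_mono) auto

lemma block_N_pos: "real N > 0"
proof -
  have "1 \<le> real D ^ (k + 1)" using D by (intro one_le_power) auto
  then show ?thesis using block_D_power_le by linarith
qed

lemma trap_length_le:
  assumes d: "d \<in> {D..<2*D}"
  shows "real (N div d ^ k + D) \<le> 2 * real N / real D ^ k"
proof -
  have "real (N div d ^ k) \<le> real N / real (d ^ k)" by (rule of_nat_div_le_of_nat)
  also have "\<dots> \<le> real N / real D ^ k" using d D by (simp add: divide_left_mono power_mono)
  finally have "real (N div d ^ k) \<le> real N / real D ^ k" .
  moreover have "real D \<le> real N / real D ^ k" using block_D_power_le D by (simp add: field_simps)
  ultimately show ?thesis by simp
qed

text \<open>The logarithm is that of length over flank: (N / D^k) / D = (y / D)^(k+1). It is bounded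
  when D is of size y.\<close>

lemma moment_1_smooth_block_le: "moment 1 (smooth_block k N D) \<le> 8 * real D * ln (8 * (y / real D) ^ (k + 1))"
proof -
  have z: "1 \<le> y / real D" using D by simp
  then have z1: "1 \<le> (y / real D) ^ (k + 1)" by (rule one_le_power)
  then have pos: "0 < ln (8 * (y / real D) ^ (k + 1))" by (intro ln_gt_zero) simp
  have "moment 1 (smooth_block k N D) \<le> real D powr 1 * (8 * ln (8 * (y / real D) ^ (k + 1)))"
  proof (intro moment_smooth_block_le D)
    fix d assume d: "d \<in> {D..<2*D}"
    have "moment 1 (trap (N div d ^ k + D) D) \<le> 8 * ln (4 * real (N div d ^ k + D) / real D)"
      using D by (intro moment_1_trap) auto
    also have "\<dots> \<le> 8 * ln (4 * (2 * real N / real D ^ k) / real D)"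
      using trap_length_le[OF d] D
      by (intro mult_left_mono ln_mono divide_right_mono) auto
    also have "4 * (2 * real N / real D ^ k) / real D = 8 * (y / real D) ^ (k + 1)"
      using D y by (simp add: power_divide mult.commute)
    finally show "moment 1 (trap (N div d ^ k + D) D) \<le> 8 * ln (8 * (y / real D) ^ (k + 1))" .
  qed (use pos in auto)
  then show ?thesis by (simp add: mult_ac)
qed

text \<open>D <= y makes the flank term D^2 at most N / D^(k-1), so smoothing does not change the
  order of the mean square.\<close>

lemma moment_2_smooth_block_le: "moment 2 (smooth_block k N D) \<le> 2 ^ (k + 6) * (real N / real D ^ (k - 1))"
proof -
  have "moment 2 (smooth_block k N D) = moment 2 (\<lambda>\<alpha>. dyadic_block k N D \<alpha> + (smooth_block k N D \<alpha> - dyadic_block k N D \<alpha>))" by simp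
  also have "\<dots> \<le> 2 powr 2 * (moment 2 (dyadic_block k N D) + moment 2 (\<lambda>\<alpha>. smooth_block k N D \<alpha> - dyadic_block k N D \<alpha>))"
    using D by (intro moment_add_le continuous_intros) auto
  also have "\<dots> \<le> 4 * (2 ^ (k + 1) * real N / real D ^ (k - 1) + (2 ^ (k + 2) + 2) * (real D)\<^sup>2)"
    using moment_2_dyadic_block_le[OF k D(1), of N] moment_2_edge_le[OF k D(1), of N] by (simp add: powr_numeral)
  also have "\<dots> \<le> 4 * (2 ^ (k + 1) * real N / real D ^ (k - 1) + (2 ^ (k + 2) + 2) * (real N / real D ^ (k - 1)))"
  proof -
    have "k + 1 = 2 + (k - 1)" using k by simp
    then have "(real D)\<^sup>2 * real D ^ (k - 1) \<le> real N" using block_D_power_le by (metis power_add)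
    then have "(real D)\<^sup>2 \<le> real N / real D ^ (k - 1)" using D by (simp add: field_simps)
    then show ?thesis by (intro mult_left_mono add_mono) auto
  qed
  also have "\<dots> = (4 * 2 ^ (k + 1) + 4 * 2 ^ (k + 2) + 8) * (real N / real D ^ (k - 1))"
    by (simp add: algebra_simps)
  also have "\<dots> \<le> 2 ^ (k + 6) * (real N / real D ^ (k - 1))"
  proof (intro mult_right_mono)
    have "4 * 2 ^ (k + 1) + 4 * 2 ^ (k + 2) + 8 = 24 * 2 ^ k + (8::real)" "(2::real) ^ (k + 6) = 64 * 2 ^ k"
      by (simp_all add: power_add)
    moreover have "(1::real) \<le> 2 ^ k" by simp
    ultimately show "4 * 2 ^ (k + 1) + 4 * 2 ^ (k + 2) + 8 \<le> (2::real) ^ (k + 6)" by linarith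
  qed auto
  finally show ?thesis .
qed

lemma moment_smooth_block_gt1_le:
  assumes q: "q > 1"
  shows "moment q (smooth_block k N D) \<le> real D powr q * (2 * (4 * (real N / real D ^ k)) powr (q - 1) / (q - 1))"
proof (intro moment_smooth_block_le D)
  show "0 < 2 * (4 * (real N / real D ^ k)) powr (q - 1) / (q - 1)"
    using q D block_N_pos by simp
  fix d assume d: "d \<in> {D..<2*D}"
  have "moment q (trap (N div d ^ k + D) D) \<le> 2 * (2 * real (N div d ^ k + D)) powr (q - 1) / (q - 1)"
    using D q by (intro moment_trap_le) auto
  also have "\<dots> \<le> 2 * (4 * (real N / real D ^ k)) powr (q - 1) / (q - 1)"
    using trap_length_le[OF d] q by (intro divide_right_mono mult_left_mono powr_mono2) auto
  finally show "moment q (trap (N div d ^ k + D) D) \<le> \<dots>" .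
qed (use q in auto)

end

lemma dyadic_le:
  fixes y :: real
  assumes "j < J" "2 ^ J \<le> y"
  shows "real (2 ^ j) \<le> y"
proof -
  have "(2::real) ^ j \<le> 2 ^ J" using assms by (intro power_increasing) auto
  from order_trans[OF this assms(2)] show ?thesis by simp
qed

lemma power_powr:
  fixes x :: real
  assumes "x > 0"
  shows "(x ^ n) powr s = x powr (real n * s)"
  unfolding powr_realpow[OF assms, symmetric] by (rule powr_powr)

lemma root_power_eq:
  assumes "N \<ge> 1"
  shows "(real N powr (1 / real (k + 1))) ^ (k + 1) = real N"
proof -
  have "(real N powr (1 / real (k + 1))) ^ (k + 1) = (real N powr (1 / real (k + 1))) powr real (k + 1)"
    using assms by (intro powr_realpow[symmetric]) simp
  also have "\<dots> = real N powr (1 / real (k + 1) * real (k + 1))" by (rule powr_powr)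
  also have "1 / real (k + 1) * real (k + 1) = 1" by simp
  finally show ?thesis using assms by simp
qed

text \<open>Interpolation with p = (2 - p) 1 + (p - 1) 2. The last factor equals N^(p-1)
  D^(1-k(p-1)); written in y / D, it shows by the sign of its exponent whether blocks decay away
  from D = y.\<close>

lemma moment_smooth_block_interpolated_le:
  assumes k: "k \<ge> 2" and y: "y ^ (k + 1) = real N" and D: "D \<ge> 1" "real D \<le> y"
    and p: "1 \<le> p" "p \<le> 2"
  shows "moment p (smooth_block k N D) \<le> 8 powr (2 - p) * (2 ^ (k + 6)) powr (p - 1) *
    ln (8 * (y / real D) ^ (k + 1)) powr (2 - p) * (y powr p * (y / real D) powr (real k * (p - 1) - 1))"
proof -
  define z where "z = y / real D"
  have z: "z \<ge> 1" using D by (simp add: z_def)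
  have y0: "y > 0" using D by linarith
  have Dz: "real D = y / z" using D y0 by (simp add: z_def)
  define l where "l = ln (8 * z ^ (k + 1))"
  have "1 \<le> z ^ (k + 1)" using z by (rule one_le_power)
  then have l: "l > 0" unfolding l_def by (intro ln_gt_zero) simp
  have NB: "real N / real D ^ (k - 1) = y powr 2 * z powr (real k - 1)"
  proof -
    have "k + 1 = 2 + (k - 1)" using k by simp
    then have "real N = y\<^sup>2 * y ^ (k - 1)" using y by (metis power_add)
    then have "real N / real D ^ (k - 1) = y\<^sup>2 * z ^ (k - 1)"
      using y0 z unfolding Dz by (simp add: power_divide)
    also have "\<dots> = y powr 2 * z powr real (k - 1)" using y0 z by (simp add: powr_realpow powr_numeral)
    finally show ?thesis using k by (simp add: of_nat_diff)
  qed
  have "moment p (smooth_block k N D) \<le> (8 * real D * l) powr (2 - p) * (2 ^ (k + 6) * (real N / real D ^ (k - 1))) powr (p - 1)"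
  proof (rule moment_interpolate[where q = 1 and s = 2])
    show "moment 1 (smooth_block k N D) \<le> 8 * real D * l"
      using moment_1_smooth_block_le[OF k y D] by (simp add: l_def z_def)
    show "moment 2 (smooth_block k N D) \<le> 2 ^ (k + 6) * (real N / real D ^ (k - 1))"
      by (rule moment_2_smooth_block_le[OF k y D])
    show "0 < 2 ^ (k + 6) * (real N / real D ^ (k - 1))" unfolding NB using y0 z by simp
  qed (use p D l in \<open>auto intro!: continuous_intros\<close>)
  also have "\<dots> = 8 powr (2 - p) * (2 ^ (k + 6)) powr (p - 1) * l powr (2 - p) *
      ((y / z) powr (2 - p) * (y powr 2 * z powr (real k - 1)) powr (p - 1))"
  proof -
    have "(8 * real D * l) powr (2 - p) = 8 powr (2 - p) * (y / z) powr (2 - p) * l powr (2 - p)"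
      using l unfolding Dz[symmetric] by (simp add: powr_mult)
    moreover have "(2 ^ (k + 6) * (y powr 2 * z powr (real k - 1))) powr (p - 1)
        = (2 ^ (k + 6)) powr (p - 1) * (y powr 2 * z powr (real k - 1)) powr (p - 1)"
      by (rule powr_mult)
    ultimately show ?thesis unfolding NB by (simp only: mult_ac)
  qed
  also have "(y / z) powr (2 - p) * (y powr 2 * z powr (real k - 1)) powr (p - 1)
      = (y powr (2 - p) * y powr (2 * (p - 1))) * (z powr (- (2 - p)) * z powr ((real k - 1) * (p - 1)))"
  proof -
    have "(y / z) powr (2 - p) = y powr (2 - p) * z powr (- (2 - p))"
      by (simp only: powr_divide powr_minus_divide times_divide_eq_right mult_1_right)
    moreover have "(y powr 2 * z powr (real k - 1)) powr (p - 1) = y powr (2 * (p - 1)) * z powr ((real k - 1) * (p - 1))"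
      by (simp only: powr_mult powr_powr)
    ultimately show ?thesis by (simp only: mult_ac)
  qed
  also have "\<dots> = y powr p * z powr (real k * (p - 1) - 1)"
    by (simp add: algebra_simps flip: powr_add)
  finally show ?thesis by (simp add: l_def z_def)
qed

section \<open>Upper bounds in the three ranges of p\<close>

lemma I_k_upper_subcritical_ge1:
  assumes k: "k \<ge> 2" and p: "1 \<le> p" "p < 1 + 1 / real k"
  obtains C where "C > 0" "\<And>N. N \<ge> 1 \<Longrightarrow> I_k k N p \<le> C * real N powr (p / real (k + 1))"
proof -
  have "1 / real k \<le> 1" using k by simp
  then have p2: "p \<le> 2" and p0: "0 \<le> p" using p by linarith+
  define \<sigma> where "\<sigma> = 1 - real k * (p - 1)"
  have \<sigma>: "\<sigma> > 0" using p k by (simp add: \<sigma>_def field_simps)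
  \<comment> \<open>With this s the power s of z^(k+1) is z^(\<sigma>/2): the logarithm is paid for
    with half of the decay z^(-\<sigma>).\<close>
  define s where "s = \<sigma> / (2 * real (k + 1))"
  have s: "s > 0" using \<sigma> by (simp add: s_def)
  define K where "K = 8 powr (2 - p) * (2 ^ (k + 6)) powr (p - 1) * (8 powr s / s) powr (2 - p)"
  have K: "K > 0" using s by (simp add: K_def)
  have blkb: "moment p (smooth_block k N D) \<le> K * (y powr p * (y / real D) powr (- \<sigma> / 2))"
    if y: "y ^ (k + 1) = real N" and D: "D \<ge> 1" "real D \<le> y" for N D y
  proof -
    define z where "z = y / real D"
    have z: "z \<ge> 1" using D by (simp add: z_def)
    have z1: "1 \<le> z ^ (k + 1)" using z by (rule one_le_power)
    have "ln (8 * z ^ (k + 1)) \<le> (8 * z ^ (k + 1)) powr s / s"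
      using z1 s by (intro ln_powr_bound) auto
    also have "(8 * z ^ (k + 1)) powr s = 8 powr s * z powr (\<sigma> / 2)"
    proof -
      have "(z ^ (k + 1)) powr s = z powr (real (k + 1) * s)"
        using z by (intro power_powr) auto
      also have "real (k + 1) * s = \<sigma> / 2" by (simp add: s_def field_simps)
      finally show ?thesis using z by (simp add: powr_mult)
    qed
    finally have "ln (8 * z ^ (k + 1)) powr (2 - p) \<le> (8 powr s * z powr (\<sigma> / 2) / s) powr (2 - p)"
      using z1 p2 by (intro powr_mono2) auto
    also have "\<dots> = (8 powr s / s) powr (2 - p) * z powr (\<sigma> / 2 * (2 - p))"
      using s z by (simp add: powr_mult powr_divide powr_powr)
    also have "\<dots> \<le> (8 powr s / s) powr (2 - p) * z powr (\<sigma> / 2)"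
      using z p \<sigma> by (intro mult_left_mono powr_mono) (auto simp: field_simps)
    finally have ln: "ln (8 * z ^ (k + 1)) powr (2 - p) \<le> (8 powr s / s) powr (2 - p) * z powr (\<sigma> / 2)" .
    have "moment p (smooth_block k N D) \<le> 8 powr (2 - p) * (2 ^ (k + 6)) powr (p - 1) *
        ln (8 * z ^ (k + 1)) powr (2 - p) * (y powr p * z powr (- \<sigma>))"
      using moment_smooth_block_interpolated_le[OF k y D p(1) p2] by (simp add: z_def \<sigma>_def)
    also have "\<dots> \<le> 8 powr (2 - p) * (2 ^ (k + 6)) powr (p - 1) *
        ((8 powr s / s) powr (2 - p) * z powr (\<sigma> / 2)) * (y powr p * z powr (- \<sigma>))"
      by (intro mult_right_mono mult_left_mono ln) auto
    also have "\<dots> = K * (y powr p * (z powr (\<sigma> / 2) * z powr (- \<sigma>)))"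
      by (simp add: K_def mult_ac)
    also have "z powr (\<sigma> / 2) * z powr (- \<sigma>) = z powr (- \<sigma> / 2)"
      by (simp flip: powr_add)
    finally show ?thesis by (simp add: z_def)
  qed
  define \<rho> where "\<rho> = 2 powr (- \<sigma> / 2)"
  have \<rho>: "0 < \<rho>" "\<rho> < 1" using \<sigma> powr_less_mono[of "- \<sigma> / 2" 0 2] by (auto simp: \<rho>_def)
  obtain B where B: "B > 0"
    "\<And>N J y. y ^ (k + 1) = real N \<Longrightarrow> 2 ^ J \<le> y \<Longrightarrow> y < 2 ^ (J + 1) \<Longrightarrow>
      I_k k N p \<le> B * (moment p (\<lambda>\<alpha>. \<Sum>j<J. smooth_block k N (2 ^ j) \<alpha>) + y powr p)"
    using moment_S_k_reduce[OF k p0 p2] by blast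
  define G where "G = (1 / (1 - \<rho> powr (1 / p))) powr p"
  have "B * (K * G + 1) > 0" using B K by (simp add: G_def add_nonneg_pos)
  moreover have "I_k k N p \<le> B * (K * G + 1) * real N powr (p / real (k + 1))" if N: "N \<ge> 1" for N
  proof -
    define y where "y = real N powr (1 / real (k + 1))"
    have y: "y ^ (k + 1) = real N" unfolding y_def using root_power_eq[OF N] .
    have y1: "y \<ge> 1" unfolding y_def using N by (intro ge_one_powr_ge_zero) auto
    obtain J where J: "2 ^ J \<le> y" "y < 2 ^ (J + 1)" using ex_dyadic[OF y1] .
    \<comment> \<open>The blocks decay downwards from the largest, so they are ranked by
      \<open>J - j\<close>.\<close>
    have "moment p (\<lambda>\<alpha>. \<Sum>j<J. smooth_block k N (2 ^ j) \<alpha>) \<le> K * y powr p * (1 / (1 - \<rho> powr (1 / p))) powr p"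
    proof (rule moment_sum_geometric_le[where \<pi> = "\<lambda>j. J - j"])
      fix j assume j: "j \<in> {..<J}"
      have le: "(2::real) ^ j * 2 ^ (J - j) \<le> y" using j J by (simp flip: power_add)
      have "real (2 ^ j) \<le> y" using dyadic_le[OF _ J(1)] j by blast
      then have "moment p (smooth_block k N (2 ^ j)) \<le> K * (y powr p * (y / real (2 ^ j)) powr (- \<sigma> / 2))"
        using y by (intro blkb) auto
      also have "\<dots> \<le> K * (y powr p * (2 ^ (J - j)) powr (- \<sigma> / 2))"
        using le K \<sigma> by (intro mult_left_mono powr_mono2') (auto simp: field_simps)
      also have "(2 ^ (J - j)) powr (- \<sigma> / 2) = \<rho> ^ (J - j)"
        by (simp add: \<rho>_def powr_powr mult.commute flip: powr_realpow)
      finally show "moment p (smooth_block k N (2 ^ j)) \<le> K * y powr p * \<rho> ^ (J - j)" by (simp add: mult_ac)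
    next
      show "inj_on (\<lambda>j. J - j) {..<J}" by (auto simp: inj_on_def)
    qed (use p \<rho> K y1 in \<open>auto intro!: continuous_intros\<close>)
    then have "I_k k N p \<le> B * (K * y powr p * G + y powr p)"
      using B(2)[OF y J] B(1) by (smt (verit) G_def mult_left_mono)
    also have "y powr p = real N powr (p / real (k + 1))"
      by (simp add: y_def powr_powr)
    finally show ?thesis by (simp add: algebra_simps)
  qed
  ultimately show ?thesis by (rule that)
qed

lemma I_k_nonneg: "I_k k N p \<ge> 0"
  using moment_nonneg[of p "S_k k N"] by (simp add: I_k_def moment_def)

lemma I_k_eq_mom: "I_k k N p = moment p (S_k k N)"
  by (simp add: I_k_def moment_def)

lemma I_k_upper_subcritical:
  assumes k: "k \<ge> 2" and p: "0 \<le> p" "p < 1 + 1 / real k"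
  obtains C where "C > 0" "\<And>N. N \<ge> 1 \<Longrightarrow> I_k k N p \<le> C * real N powr (p / real (k + 1))"
proof -
  \<comment> \<open>Minkowski's inequality fails below 1; those exponents are deduced from exponent
    1.\<close>
  define q where "q = max p 1"
  have q: "1 \<le> q" "q < 1 + 1 / real k" "p \<le> q" using p k by (auto simp: q_def)
  obtain C where C: "C > 0" "\<And>N. N \<ge> 1 \<Longrightarrow> I_k k N q \<le> C * real N powr (q / real (k + 1))"
    using I_k_upper_subcritical_ge1[OF k q(1,2)] by blast
  have "I_k k N p \<le> C powr (p / q) * real N powr (p / real (k + 1))" if N: "N \<ge> 1" for N
  proof -
    have "moment p (S_k k N) \<le> (C * real N powr (q / real (k + 1))) powr (p / q)"
      using p q C(2)[OF N] C(1) N by (intro moment_lyapunov continuous_intros) (auto simp: I_k_eq_mom)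
    also have "\<dots> = C powr (p / q) * real N powr (p / real (k + 1))"
      using C(1) q by (simp add: powr_mult powr_powr)
    finally show ?thesis by (simp add: I_k_eq_mom)
  qed
  then show ?thesis using C(1) by (intro that[of "C powr (p / q)"]) auto
qed

lemma ln_2_ge_half: "ln (2::real) \<ge> 1 / 2"
  using ln2_ge_two_thirds by linarith

text \<open>Every block has moment at most a constant times y^p (log N)^(2-p), and there are at most
  2 log N of them; Minkowski's inequality multiplies this by (log N)^p.\<close>

lemma I_k_upper_critical:
  assumes k: "k \<ge> 2" and p: "p = 1 + 1 / real k"
  obtains C where "C > 0" "\<And>N. N \<ge> 2 \<Longrightarrow> I_k k N p \<le> C * (real N powr (1 / real k) * (ln (real N))\<^sup>2)"
proof -
  have "1 / real k \<le> 1" "1 / real k > 0" using k by auto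
  then have p12: "1 \<le> p" "p \<le> 2" using p by linarith+
  have p0: "p > 0" using p12 by linarith
  obtain B where B: "B > 0"
    "\<And>N J y. y ^ (k + 1) = real N \<Longrightarrow> 2 ^ J \<le> y \<Longrightarrow> y < 2 ^ (J + 1) \<Longrightarrow>
      I_k k N p \<le> B * (moment p (\<lambda>\<alpha>. \<Sum>j<J. smooth_block k N (2 ^ j) \<alpha>) + y powr p)"
    using moment_S_k_reduce[OF k less_imp_le[OF p0] p12(2)] by blast
  define K where "K = 8 powr (2 - p) * (2 ^ (k + 6)) powr (p - 1)"
  have K: "K > 0" by (simp add: K_def)
  have "B * (K * 4 powr (2 - p) * 2 powr p + 4) > 0" using B K by (simp add: add_nonneg_pos)
  moreover have "I_k k N p \<le> B * (K * 4 powr (2 - p) * 2 powr p + 4) * (real N powr (1 / real k) * (ln (real N))\<^sup>2)"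
    if N: "N \<ge> 2" for N
  proof -
    define y where "y = real N powr (1 / real (k + 1))"
    define l where "l = ln (real N)"
    have "ln 2 \<le> l" unfolding l_def using N by (intro ln_mono) auto
    then have l: "l \<ge> 1 / 2" using ln_2_ge_half by linarith
    have y: "y ^ (k + 1) = real N" unfolding y_def using N by (intro root_power_eq) auto
    have y1: "y \<ge> 1" unfolding y_def using N by (intro ge_one_powr_ge_zero) auto
    obtain J where J: "2 ^ J \<le> y" "y < 2 ^ (J + 1)" using ex_dyadic[OF y1] .
    note NJ = dyadic_index_le[OF y J(1)]
    have Jl: "real J \<le> 2 * l"
    proof -
      have "real J * ln 2 = ln (2 ^ J)" by (simp add: ln_realpow)
      also have "\<dots> \<le> l" unfolding l_def by (intro ln_mono order_trans[OF J(1) NJ(3)]) auto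
      finally have "real J * (1 / 2) \<le> l"
        using ln_2_ge_half by (smt (verit) mult_left_mono of_nat_0_le_iff)
      then show ?thesis by simp
    qed
    \<comment> \<open>A common bound for the L^p norms: at the critical exponent the power of y / D
      in the interpolated bound is 0.\<close>
    define c where "c = (K * 4 powr (2 - p) * l powr (2 - p) * y powr p) powr (1 / p)"
    have cp: "c powr p = K * 4 powr (2 - p) * l powr (2 - p) * y powr p"
      unfolding c_def using K y1 p0 by (simp add: powr_powr)
    have "moment p (\<lambda>\<alpha>. \<Sum>j<J. smooth_block k N (2 ^ j) \<alpha>) \<le> (\<Sum>j<J. c) powr p"
    proof (rule moment_sum_le)
      fix j assume j: "j \<in> {..<J}"
      have D: "real (2 ^ j) \<le> y" using dyadic_le[OF _ J(1)] j by blast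
      define z where "z = y / real (2 ^ j)"
      have z: "z \<ge> 1" using D by (simp add: z_def)
      have "z \<le> y" using y1 by (simp add: z_def divide_le_eq mult_left_mono)
      then have "z ^ (k + 1) \<le> real N" unfolding y[symmetric] using z by (intro power_mono) auto
      moreover have z1: "1 \<le> z ^ (k + 1)" using z by (rule one_le_power)
      \<comment> \<open>As N >= 2, the constant 8 is absorbed into a power of N, which gives ln (8
        z^(k+1)) <= 4 ln N.\<close>
      moreover have "8 * real N \<le> real N ^ 4"
      proof -
        have "2 ^ 3 \<le> real N ^ 3" using N by (intro power_mono) auto
        then have "2 ^ 3 * real N \<le> real N ^ 3 * real N" by (intro mult_right_mono) auto
        then show ?thesis by (simp add: power_numeral_reduce mult_ac)
      qed
      ultimately have "ln (8 * z ^ (k + 1)) \<le> ln (real N ^ 4)" by (intro ln_mono) auto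
      also have "\<dots> = 4 * l" unfolding l_def using N by (simp add: ln_realpow)
      finally have "ln (8 * z ^ (k + 1)) powr (2 - p) \<le> (4 * l) powr (2 - p)"
        using z1 p12 by (intro powr_mono2) auto
      also have "\<dots> = 4 powr (2 - p) * l powr (2 - p)" using l by (simp add: powr_mult)
      finally have ln: "ln (8 * z ^ (k + 1)) powr (2 - p) \<le> 4 powr (2 - p) * l powr (2 - p)" .
      have "real k * (p - 1) - 1 = 0" using k by (simp add: p)
      then have "moment p (smooth_block k N (2 ^ j)) \<le> K * ln (8 * z ^ (k + 1)) powr (2 - p) * (y powr p * z powr 0)"
        using moment_smooth_block_interpolated_le[OF k y _ D p12] by (simp add: z_def K_def)
      also have "\<dots> = K * ln (8 * z ^ (k + 1)) powr (2 - p) * y powr p" using z by simp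
      also have "\<dots> \<le> K * (4 powr (2 - p) * l powr (2 - p)) * y powr p"
        using K by (intro mult_right_mono mult_left_mono ln) auto
      finally show "moment p (smooth_block k N (2 ^ j)) \<le> c powr p" by (simp add: cp mult_ac)
    next
      show "c > 0" unfolding c_def using K l y1 by simp
    qed (use p12 in \<open>auto intro!: continuous_intros\<close>)
    also have "\<dots> = (real J * c) powr p" by simp
    also have "\<dots> \<le> (2 * l * c) powr p"
      using Jl p0 by (intro powr_mono2 mult_right_mono) (auto simp: c_def)
    also have "\<dots> = 2 powr p * l powr p * c powr p"
      using l by (simp add: powr_mult c_def)
    also have "\<dots> = K * 4 powr (2 - p) * 2 powr p * (y powr p * (l powr p * l powr (2 - p)))"
      unfolding cp by (simp add: mult_ac)
    also have "l powr p * l powr (2 - p) = l\<^sup>2"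
      using l by (simp add: powr_numeral flip: powr_add)
    finally have 1: "moment p (\<lambda>\<alpha>. \<Sum>j<J. smooth_block k N (2 ^ j) \<alpha>) \<le> K * 4 powr (2 - p) * 2 powr p * (y powr p * l\<^sup>2)" .
    \<comment> \<open>The lower bound ln N >= 1/2, due to N >= 2, lets the rest y^p be absorbed into
      the main term.\<close>
    have "(1/2)\<^sup>2 \<le> l\<^sup>2" using l by (intro power_mono) auto
    then have "1 \<le> 4 * l\<^sup>2" by (simp add: power2_eq_square)
    then have "y powr p * 1 \<le> y powr p * (4 * l\<^sup>2)" by (intro mult_left_mono) auto
    then have 2: "y powr p \<le> 4 * (y powr p * l\<^sup>2)" by simp
    have "I_k k N p \<le> B * (moment p (\<lambda>\<alpha>. \<Sum>j<J. smooth_block k N (2 ^ j) \<alpha>) + y powr p)" by (rule B(2)[OF y J])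
    also have "\<dots> \<le> B * (K * 4 powr (2 - p) * 2 powr p * (y powr p * l\<^sup>2) + 4 * (y powr p * l\<^sup>2))"
      using B(1) 1 2 by (intro mult_left_mono add_mono) auto
    also have "\<dots> = B * (K * 4 powr (2 - p) * 2 powr p + 4) * (y powr p * l\<^sup>2)"
      by (simp add: algebra_simps)
    also have "y powr p = real N powr (1 / real k)"
    proof -
      have "p = real (k + 1) / real k" using k by (simp add: p add_divide_distrib)
      then have "p / real (k + 1) = 1 / real k" by simp
      then show ?thesis by (simp add: y_def powr_powr)
    qed
    finally show ?thesis by (simp add: l_def)
  qed
  ultimately show ?thesis by (rule that)
qed

lemma norm_S_k_le: "norm (S_k k N \<alpha>) \<le> real N"
proof -
  have "norm (S_k k N \<alpha>) \<le> (\<Sum>n=1..N. 1)"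
    unfolding S_k_def using mu_k_range[of k] by (intro sum_norm_le) (auto simp: norm_mult mu_k_def)
  then show ?thesis by simp
qed

lemma I_k_2_le: "I_k k N 2 \<le> real N"
proof -
  have "I_k k N 2 = moment 2 (\<lambda>\<alpha>. \<Sum>n\<in>{1..N}. of_real (mu_k k n) * e_exp (\<alpha> * of_int (int n)))"
    by (simp add: I_k_eq_mom S_k_def[abs_def])
  also have "\<dots> \<le> real (card {(n, n') \<in> {1..N} \<times> {1..N}. int n = int n'})"
    unfolding moment_2 by (intro parseval_le) (auto simp: mu_k_def)
  also have "{(n, n') \<in> {1..N} \<times> {1..N}. int n = int n'} = (\<lambda>n. (n, n)) ` {1..N}" by auto
  also have "card \<dots> = N" by (simp add: card_image inj_on_def)
  finally show ?thesis .
qed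

text \<open>For p >= 2 the pointwise bound N and the mean square N suffice. For p < 2 the block D =
  1 dominates, where interpolation from L^1 would leave a power of log N; an exponent q > 1 avoids
  it.\<close>

lemma I_k_upper_supercritical:
  assumes k: "k \<ge> 2" and p: "p > 1 + 1 / real k"
  obtains C where "C > 0" "\<And>N. N \<ge> 1 \<Longrightarrow> I_k k N p \<le> C * real N powr (p - 1)"
proof (cases "p < 2")
  case False
  have "I_k k N p \<le> 1 * real N powr (p - 1)" if N: "N \<ge> 1" for N
  proof -
    have "I_k k N p \<le> integral {0..1} (\<lambda>\<alpha>. real N powr (p - 2) * norm (S_k k N \<alpha>) powr 2)"
      unfolding I_k_def
    proof (intro integral_le integrable_on_mult_right integrable_norm_powr continuous_intros)
      fix \<alpha>
      have "norm (S_k k N \<alpha>) powr p = norm (S_k k N \<alpha>) powr (p - 2) * norm (S_k k N \<alpha>) powr 2"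
        by (subst powr_add[symmetric]) simp
      also have "\<dots> \<le> real N powr (p - 2) * norm (S_k k N \<alpha>) powr 2"
        using False norm_S_k_le by (intro mult_right_mono powr_mono2) auto
      finally show "norm (S_k k N \<alpha>) powr p \<le> real N powr (p - 2) * norm (S_k k N \<alpha>) powr 2" .
    qed (use False in auto)
    also have "\<dots> = real N powr (p - 2) * I_k k N 2" by (simp add: I_k_def)
    also have "\<dots> \<le> real N powr (p - 2) * real N powr 1" using I_k_2_le N by (intro mult_left_mono) auto
    also have "\<dots> = real N powr (p - 1)" by (subst powr_add[symmetric]) simp
    finally show ?thesis by simp
  qed
  then show ?thesis using that[of 1] by simp
next
  case True
  have kp: "real k * (p - 1) > 1" using p k by (simp add: field_simps)
  have p1: "p > 1" using p k by (smt (verit) divide_nonneg_nonneg of_nat_0_le_iff)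
  then have p0: "0 \<le> p" by linarith
  \<comment> \<open>Midway between 1 and the smaller of p and k (p - 1): below p for the
    interpolation, below k (p - 1) to keep the decay exponent \<open>\<tau>\<close>
    positive.\<close>
  define q where "q = (1 + min p (real k * (p - 1))) / 2"
  have q: "1 < q" "q < p" "q < real k * (p - 1)" using kp p1 by (auto simp: q_def min_def)
  define a b where "a = (2 - p) / (2 - q)" and "b = (p - q) / (2 - q)"
  have ab: "a \<ge> 0" "b \<ge> 0" "a + b = 1" using q True by (auto simp: a_def b_def simp flip: add_divide_distrib)
  have pab: "p = a * q + b * 2"
  proof -
    have "(2 - q) * a = 2 - p" "(2 - q) * b = p - q" using q True by (auto simp: a_def b_def)
    then have "(2 - q) * (a * q + b * 2) = (2 - p) * q + (p - q) * 2"
      by (metis distrib_left mult.assoc)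
    also have "\<dots> = (2 - q) * p" by (simp add: algebra_simps)
    finally show ?thesis using q True by simp
  qed
  \<comment> \<open>The interpolated bound for a block is N^(p-1) times D to the power -\<tau>;
    positivity follows from q a + b <= q.\<close>
  define \<tau> where "\<tau> = real k * (p - 1) - (q * a + b)"
  have \<tau>: "\<tau> > 0"
  proof -
    have "q * a + b \<le> q * a + q * b" using q ab by (simp add: mult_le_cancel_right1)
    also have "\<dots> = q" using ab by (simp flip: distrib_left)
    finally show ?thesis using q by (simp add: \<tau>_def)
  qed
  define K where "K = (2 * 4 powr (q - 1) / (q - 1)) powr a * (2 ^ (k + 6)) powr b"
  have K: "K > 0" using q by (simp add: K_def)
  have blkb: "moment p (smooth_block k N D) \<le> K * real N powr (p - 1) * real D powr (- \<tau>)"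
    if y: "y ^ (k + 1) = real N" and D: "D \<ge> 1" "real D \<le> y" for N D y
  proof -
    note N0 = block_N_pos[OF k y D]
    have NDk: "real N / real D ^ k = real N powr 1 * real D powr (- real k)"
      using D N0 by (simp add: powr_minus_divide powr_realpow)
    have NDk1: "real N / real D ^ (k - 1) = real N powr 1 * real D powr (1 - real k)"
      using D N0 k by (simp add: powr_diff powr_realpow power_diff)
    have "moment p (smooth_block k N D) \<le> (real D powr q * (2 * (4 * (real N / real D ^ k)) powr (q - 1) / (q - 1))) powr a
        * (2 ^ (k + 6) * (real N / real D ^ (k - 1))) powr b"
      using D N0 q ab
      by (intro moment_interpolate[where q = q and s = 2] pab moment_smooth_block_gt1_le[OF k y D] moment_2_smooth_block_le[OF k y D])
         (auto intro!: continuous_intros)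
    also have "real D powr q * (2 * (4 * (real N / real D ^ k)) powr (q - 1) / (q - 1))
        = (2 * 4 powr (q - 1) / (q - 1)) * (real N powr (q - 1) * real D powr (q - real k * (q - 1)))"
    proof -
      have "(4 * (real N / real D ^ k)) powr (q - 1) = 4 powr (q - 1) * (real N powr (q - 1) * real D powr (- real k * (q - 1)))"
        unfolding NDk by (simp only: powr_mult powr_powr mult_1_left)
      moreover have "real D powr (q - real k * (q - 1)) = real D powr q * real D powr (- real k * (q - 1))"
        by (simp flip: powr_add)
      ultimately show ?thesis by simp
    qed
    also have "\<dots> powr a = (2 * 4 powr (q - 1) / (q - 1)) powr a * (real N powr ((q - 1) * a) * real D powr ((q - real k * (q - 1)) * a))"
      by (simp only: powr_mult powr_powr)
    also have "(2 ^ (k + 6) * (real N / real D ^ (k - 1))) powr b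
        = (2 ^ (k + 6)) powr b * (real N powr b * real D powr ((1 - real k) * b))"
      unfolding NDk1 by (simp only: powr_mult powr_powr mult_1_left)
    also have "(2 * 4 powr (q - 1) / (q - 1)) powr a * (real N powr ((q - 1) * a) * real D powr ((q - real k * (q - 1)) * a)) * \<dots>
        = K * (real N powr ((q - 1) * a) * real N powr b) * (real D powr ((q - real k * (q - 1)) * a) * real D powr ((1 - real k) * b))"
      by (simp add: K_def mult_ac)
    also have "\<dots> = K * real N powr ((q - 1) * a + b) * real D powr ((q - real k * (q - 1)) * a + (1 - real k) * b)"
      by (simp only: powr_add)
    also have "(q - 1) * a + b = p - 1" using ab pab by (simp add: algebra_simps)
    also have "(q - real k * (q - 1)) * a + (1 - real k) * b = - \<tau>"
    proof -
      have "(q - real k * (q - 1)) * a + (1 - real k) * b = (q * a + b) - real k * ((q - 1) * a + b)"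
        by (simp add: algebra_simps)
      also have "(q - 1) * a + b = p - 1" using ab pab by (simp add: algebra_simps)
      finally show ?thesis by (simp add: \<tau>_def)
    qed
    finally show ?thesis .
  qed
  define \<rho> where "\<rho> = 2 powr (- \<tau>)"
  have \<rho>: "0 < \<rho>" "\<rho> < 1" using \<tau> powr_less_mono[of "- \<tau>" 0 2] by (auto simp: \<rho>_def)
  obtain B where B: "B > 0"
    "\<And>N J y. y ^ (k + 1) = real N \<Longrightarrow> 2 ^ J \<le> y \<Longrightarrow> y < 2 ^ (J + 1) \<Longrightarrow>
      I_k k N p \<le> B * (moment p (\<lambda>\<alpha>. \<Sum>j<J. smooth_block k N (2 ^ j) \<alpha>) + y powr p)"
    using moment_S_k_reduce[OF k p0 less_imp_le[OF True]] by blast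
  define G where "G = (1 / (1 - \<rho> powr (1 / p))) powr p"
  have "B * (K * G + 1) > 0" using B K by (simp add: G_def add_nonneg_pos)
  moreover have "I_k k N p \<le> B * (K * G + 1) * real N powr (p - 1)" if N: "N \<ge> 1" for N
  proof -
    define y where "y = real N powr (1 / real (k + 1))"
    have y: "y ^ (k + 1) = real N" unfolding y_def using root_power_eq[OF N] .
    have y1: "y \<ge> 1" unfolding y_def using N by (intro ge_one_powr_ge_zero) auto
    obtain J where J: "2 ^ J \<le> y" "y < 2 ^ (J + 1)" using ex_dyadic[OF y1] .
    have 1: "moment p (\<lambda>\<alpha>. \<Sum>j<J. smooth_block k N (2 ^ j) \<alpha>) \<le> K * real N powr (p - 1) * (1 / (1 - \<rho> powr (1 / p))) powr p"
    proof (rule moment_sum_geometric_le[where \<pi> = "\<lambda>j. j"])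
      fix j assume j: "j \<in> {..<J}"
      have "real (2 ^ j) \<le> y" using dyadic_le[OF _ J(1)] j by blast
      then have "moment p (smooth_block k N (2 ^ j)) \<le> K * real N powr (p - 1) * real (2 ^ j) powr (- \<tau>)"
        using y by (intro blkb) auto
      also have "real (2 ^ j) powr (- \<tau>) = \<rho> ^ j"
        by (simp add: \<rho>_def powr_powr mult.commute flip: powr_realpow)
      finally show "moment p (smooth_block k N (2 ^ j)) \<le> K * real N powr (p - 1) * \<rho> ^ j" .
    qed (use p1 \<rho> K N in \<open>auto intro!: continuous_intros\<close>)
    \<comment> \<open>The rest y^p is at most N^(p-1) because k (p - 1) > 1.\<close>
    have 2: "y powr p \<le> real N powr (p - 1)"
    proof -
      have "p * 1 \<le> p * real k - real k + p - 1" using kp by (simp add: algebra_simps)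
      then have "p / real (k + 1) \<le> p - 1" by (simp add: field_simps)
      then show ?thesis unfolding y_def powr_powr using N by (intro powr_mono) auto
    qed
    have "I_k k N p \<le> B * (K * real N powr (p - 1) * G + real N powr (p - 1))"
      using B(2)[OF y J] B(1) 1 2 by (smt (verit) G_def mult_left_mono)
    then show ?thesis by (simp add: algebra_simps)
  qed
  ultimately show ?thesis by (rule that)
qed

subsection \<open>Major arcs\<close>

text \<open>For \<beta> <= 1 / (6 N) every phase is at most pi/3, so each cosine is at least 1/2;
  the k-free numbers have density at least 1/4.\<close>

lemma norm_S_k_near_0:
  assumes k: "k \<ge> 2" and N: "N \<ge> 1" and \<beta>: "0 \<le> \<beta>" "\<beta> \<le> 1 / (6 * real N)"
  shows "norm (S_k k N \<beta>) \<ge> real N / 8"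
proof -
  have "real N / 8 \<le> (\<Sum>n=1..N. mu_k k n) * (1 / 2)"
    using sum_mu_k_ge[OF k, of N] by simp
  also have "\<dots> \<le> (\<Sum>n=1..N. mu_k k n * cos (2 * pi * (\<beta> * real n)))"
    unfolding sum_distrib_right
  proof (intro sum_mono mult_left_mono)
    fix n assume n: "n \<in> {1..N}"
    have "\<beta> * real n \<le> 1 / (6 * real N) * real N"
      using n \<beta> by (intro mult_mono) auto
    then have "2 * pi * (\<beta> * real n) \<le> 2 * pi * (1 / 6)"
      using N by (intro mult_left_mono) auto
    then have "cos (pi / 3) \<le> cos (2 * pi * (\<beta> * real n))"
      using \<beta> by (intro cos_monotone_0_pi_le) auto
    then show "1 / 2 \<le> cos (2 * pi * (\<beta> * real n))" by (simp add: cos_60)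
  qed (auto simp: mu_k_def)
  also have "\<dots> = Re (S_k k N \<beta>)"
    by (simp add: S_k_def e_exp_cis)
  also have "\<dots> \<le> norm (S_k k N \<beta>)" by (rule complex_Re_le_cmod)
  finally show ?thesis .
qed

text \<open>Only the arc next to 0 is used: size N^p on length 1 / (6 N). Valid for every p >= 0, it
  also yields positivity of all moments and settles bounded N for the first moment.\<close>

lemma I_k_lower_supercritical:
  assumes k: "k \<ge> 2" and p: "p \<ge> 0" and N: "N \<ge> 1"
  shows "real N powr (p - 1) \<le> 6 * 8 powr p * I_k k N p"
proof -
  define \<eta> where "\<eta> = 1 / (6 * real N)"
  have \<eta>: "0 < \<eta>" "\<eta> \<le> 1" using N by (auto simp: \<eta>_def field_simps)
  have "(real N / 8) powr p * \<eta> = integral {0..\<eta>} (\<lambda>_::real. (real N / 8) powr p)"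
    using \<eta> by simp
  also have "\<dots> \<le> integral {0..\<eta>} (\<lambda>\<beta>. norm (S_k k N \<beta>) powr p)"
    using p N norm_S_k_near_0[OF k N]
    by (intro integral_le integrable_norm_powr continuous_intros powr_mono2 integrable_const_ivl) (auto simp: \<eta>_def)
  also have "\<dots> \<le> I_k k N p"
    unfolding I_k_def using p \<eta>
    by (intro integral_subset_le integrable_norm_powr continuous_intros) auto
  finally have "(real N / 8) powr p * \<eta> \<le> I_k k N p" .
  moreover have "(real N / 8) powr p * \<eta> = real N powr (p - 1) / (6 * 8 powr p)"
    using N by (simp add: \<eta>_def powr_divide powr_diff)
  ultimately have "real N powr (p - 1) / (6 * 8 powr p) \<le> I_k k N p" by simp
  then show ?thesis by (subst (asm) pos_divide_le_eq) (simp_all add: mult.commute)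
qed

text \<open>The condition is weaker than coprimality of \<open>a\<close> and \<open>d\<close>, but it still makes the fractions
  \<open>a / d\<^sup>k\<close> pairwise distinct for varying \<open>a\<close> and \<open>d\<close>.\<close>

definition kfree_numerators :: "nat \<Rightarrow> nat \<Rightarrow> nat set" where
  "kfree_numerators k d = {a \<in> {..<d ^ k}. \<forall>f. f dvd d \<longrightarrow> f > 1 \<longrightarrow> \<not> f ^ k dvd a}"

lemma finite_kfree_numerators [simp]: "finite (kfree_numerators k d)"
  by (simp add: kfree_numerators_def)

lemma card_kfree_numerators_le: "card (kfree_numerators k d) \<le> d ^ k"
proof -
  have "card (kfree_numerators k d) \<le> card {..<d ^ k}" by (intro card_mono) (auto simp: kfree_numerators_def)
  then show ?thesis by simp
qed

section \<open>Sums over the shifts a / d^k\<close>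

lemma sum_moebius_common:
  assumes d: "d > 0"
  shows "(\<Sum>f | f dvd d \<and> f ^ k dvd a. moebius f) = (if \<forall>f. f dvd d \<longrightarrow> f > 1 \<longrightarrow> \<not> f ^ k dvd a then 1 else 0)"
proof -
  define F where "F = {f. f dvd d \<and> f ^ k dvd a}"
  have "finite F" by (rule finite_subset[of _ "{f. f dvd d}"]) (use d in \<open>auto simp: F_def\<close>)
  moreover have F0: "0 \<notin> F" using d by (auto simp: F_def)
  moreover have F1: "1 \<in> F" by (simp add: F_def)
  moreover have "c \<in> F" if "b \<in> F" "c dvd b" for b c
    using that by (auto simp: F_def intro: dvd_trans dvd_power_same)
  moreover have "lcm b c \<in> F" if "b \<in> F" "c \<in> F" for b c
    using that lcm_power_dvd by (auto simp: F_def)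
  ultimately have "(\<Sum>f\<in>F. moebius f) = (if F = {1} then 1 else 0)" by (intro sum_moebius_closed)
  moreover have "F = {1} \<longleftrightarrow> (\<forall>f. f dvd d \<longrightarrow> f > 1 \<longrightarrow> \<not> f ^ k dvd a)"
  proof
    assume F: "F = {1}"
    show "\<forall>f. f dvd d \<longrightarrow> f > 1 \<longrightarrow> \<not> f ^ k dvd a"
    proof (intro allI impI notI)
      fix f assume "f dvd d" "f > 1" "f ^ k dvd a"
      then have "f \<in> F" by (simp add: F_def)
      with F \<open>f > 1\<close> show False by simp
    qed
  next
    assume *: "\<forall>f. f dvd d \<longrightarrow> f > 1 \<longrightarrow> \<not> f ^ k dvd a"
    have "f = 1" if "f \<in> F" for f
    proof -
      have "\<not> f > 1" using * that by (auto simp: F_def)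
      moreover have "f \<noteq> 0" using that F0 by metis
      ultimately show ?thesis by simp
    qed
    with F1 show "F = {1}" by blast
  qed
  ultimately show ?thesis unfolding F_def by simp
qed

text \<open>Inclusion-exclusion over the f with f^k dividing a. It is kept for arbitrary
  \<open>g\<close>: exponentials lead to the shift identity, the indicator of a divisibility to
  \<open>sum_moebius_gcd_power_eq_0\<close>.\<close>

lemma sum_kfree_numerators:
  fixes g :: "nat \<Rightarrow> complex"
  assumes d: "d > 0"
  shows "(\<Sum>a\<in>kfree_numerators k d. g a) = (\<Sum>f | f dvd d. of_real (moebius f) * (\<Sum>b<(d div f) ^ k. g (f ^ k * b)))"
proof -
  have "(\<Sum>a\<in>kfree_numerators k d. g a) = (\<Sum>a<d ^ k. if \<forall>f. f dvd d \<longrightarrow> f > 1 \<longrightarrow> \<not> f ^ k dvd a then g a else 0)"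
    unfolding kfree_numerators_def by (rule sum.inter_filter) simp
  also have "\<dots> = (\<Sum>a<d ^ k. \<Sum>f\<in>{f\<in>{f. f dvd d}. f ^ k dvd a}. of_real (moebius f) * g a)"
  proof (intro sum.cong refl)
    fix a
    have eq: "(\<Sum>f\<in>{f\<in>{f. f dvd d}. f ^ k dvd a}. of_real (moebius f) * g a) = of_real (\<Sum>f | f dvd d \<and> f ^ k dvd a. moebius f) * g a"
      by (simp add: sum_distrib_right)
    show "(if \<forall>f. f dvd d \<longrightarrow> f > 1 \<longrightarrow> \<not> f ^ k dvd a then g a else 0) = (\<Sum>f\<in>{f\<in>{f. f dvd d}. f ^ k dvd a}. of_real (moebius f) * g a)"
    proof (cases "\<forall>f. f dvd d \<longrightarrow> f > 1 \<longrightarrow> \<not> f ^ k dvd a")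
      case True
      show ?thesis unfolding eq sum_moebius_common[OF d] if_P[OF True] by simp
    next
      case False
      show ?thesis unfolding eq sum_moebius_common[OF d] if_not_P[OF False] by simp
    qed
  qed
  also have "\<dots> = (\<Sum>f\<in>{f. f dvd d}. \<Sum>a\<in>{a\<in>{..<d ^ k}. f ^ k dvd a}. of_real (moebius f) * g a)"
    using d by (intro sum.swap_restrict) auto
  also have "\<dots> = (\<Sum>f | f dvd d. of_real (moebius f) * (\<Sum>b<(d div f) ^ k. g (f ^ k * b)))"
  proof (intro sum.cong refl)
    fix f assume "f \<in> {f. f dvd d}"
    then have f: "f dvd d" "f > 0" using d by (auto intro: Nat.gr0I)
    have dk: "d ^ k = f ^ k * (d div f) ^ k" using f by (simp flip: power_mult_distrib)
    have "{a\<in>{..<d ^ k}. f ^ k dvd a} = (\<lambda>b. f ^ k * b) ` {..<(d div f) ^ k}"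
      unfolding dk using f by (auto elim!: dvdE)
    then have "(\<Sum>a\<in>{a\<in>{..<d ^ k}. f ^ k dvd a}. g a) = (\<Sum>b<(d div f) ^ k. g (f ^ k * b))"
      using f by (simp add: sum.reindex inj_on_def)
    then show "(\<Sum>a\<in>{a\<in>{..<d ^ k}. f ^ k dvd a}. of_real (moebius f) * g a) = of_real (moebius f) * (\<Sum>b<(d div f) ^ k. g (f ^ k * b))"
      by (simp flip: sum_distrib_left)
  qed
  finally show ?thesis .
qed

lemma sum_roots_of_unity:
  assumes q: "q > 0"
  shows "(\<Sum>b<q. e_exp (real b * real n / real q)) = (if q dvd n then of_nat q else 0)"
proof (cases "q dvd n")
  case True
  then obtain m where m: "n = q * m" by blast
  have "e_exp (real b * real n / real q) = 1" for b
    using e_exp_of_nat[of "b * m"] q by (simp add: m)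
  then show ?thesis using True by simp
next
  case False
  define w where "w = e_exp (real n / real q)"
  have "w \<noteq> 1"
  proof
    assume "w = 1"
    then obtain i :: int where "real n / real q = of_int i" unfolding w_def e_exp_eq_1_iff by (auto elim: Ints_cases)
    then have "real_of_int (int n) = of_int (int q * i)" using q by (simp add: field_simps)
    then have "int n = int q * i" by (simp only: of_int_eq_iff)
    then have "int q dvd int n" by simp
    then show False using False by simp
  qed
  have "(w - 1) * (\<Sum>b<q. w ^ b) = w ^ q - 1" by (rule power_diff_1_eq[symmetric])
  also have "w ^ q = 1" using q by (simp add: w_def e_exp_power)
  finally have "(\<Sum>b<q. w ^ b) = 0" using \<open>w \<noteq> 1\<close> by simp
  then show ?thesis using False by (simp add: w_def e_exp_power)
qed

text \<open>Cohen's generalisation of Ramanujan's sum and its evaluation by divisors.\<close>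

lemma sum_kfree_numerators_e_exp:
  assumes d: "d > 0"
  shows "(\<Sum>a\<in>kfree_numerators k d. e_exp (real a / real (d ^ k) * real n))
    = (\<Sum>f | f dvd d. of_real (moebius f) * (if (d div f) ^ k dvd n then of_nat ((d div f) ^ k) else 0))"
proof -
  have "(\<Sum>a\<in>kfree_numerators k d. e_exp (real a / real (d ^ k) * real n))
      = (\<Sum>f | f dvd d. of_real (moebius f) * (\<Sum>b<(d div f) ^ k. e_exp (real (f ^ k * b) / real (d ^ k) * real n)))"
    by (rule sum_kfree_numerators[OF d])
  also have "\<dots> = (\<Sum>f | f dvd d. of_real (moebius f) * (if (d div f) ^ k dvd n then of_nat ((d div f) ^ k) else 0))"
  proof (intro sum.cong refl)
    fix f assume "f \<in> {f. f dvd d}"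
    then have f: "f dvd d" "f > 0" using d by (auto intro: Nat.gr0I)
    define e where "e = d div f"
    have e: "d = f * e" "e > 0" using f d by (auto simp: e_def div_greater_zero_iff dvd_imp_le)
    have "real (f ^ k * b) / real (d ^ k) * real n = real b * real n / real (e ^ k)" for b
      using f e by (simp add: power_mult_distrib)
    then show "of_real (moebius f) * (\<Sum>b<(d div f) ^ k. e_exp (real (f ^ k * b) / real (d ^ k) * real n))
        = of_real (moebius f) * (if (d div f) ^ k dvd n then of_nat ((d div f) ^ k) else 0)"
      using sum_roots_of_unity[of "e ^ k" n] e unfolding e_def[symmetric] by simp
  qed
  finally show ?thesis .
qed

text \<open>For \<open>k\<close>-free \<open>n\<close> only the divisor \<open>f = d\<close> survives in the previous identity.\<close>

lemma sum_kfree_numerators_S_k: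
  assumes d: "d > 0" and k: "k > 0"
  shows "(\<Sum>a\<in>kfree_numerators k d. S_k k N (real a / real (d ^ k) + \<beta>)) = of_real (moebius d) * S_k k N \<beta>"
proof -
  have "(\<Sum>a\<in>kfree_numerators k d. S_k k N (real a / real (d ^ k) + \<beta>))
      = (\<Sum>n=1..N. \<Sum>a\<in>kfree_numerators k d. of_real (mu_k k n) * e_exp ((real a / real (d ^ k) + \<beta>) * real n))"
    unfolding S_k_def by (rule sum.swap)
  also have "\<dots> = (\<Sum>n=1..N. of_real (mu_k k n) * e_exp (\<beta> * real n) * (\<Sum>a\<in>kfree_numerators k d. e_exp (real a / real (d ^ k) * real n)))"
    unfolding sum_distrib_left by (intro sum.cong refl) (simp only: distrib_right e_exp_add, simp only: mult_ac)
  also have "\<dots> = (\<Sum>n=1..N. of_real (mu_k k n) * e_exp (\<beta> * real n) * of_real (moebius d))"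
  proof (intro sum.cong refl)
    fix n assume n: "n \<in> {1..N}"
    show "of_real (mu_k k n) * e_exp (\<beta> * real n) * (\<Sum>a\<in>kfree_numerators k d. e_exp (real a / real (d ^ k) * real n))
        = of_real (mu_k k n) * e_exp (\<beta> * real n) * of_real (moebius d)"
    proof (cases "\<exists>e>1. e ^ k dvd n")
      case False
      have "(\<Sum>f | f dvd d. of_real (moebius f) * (if (d div f) ^ k dvd n then of_nat ((d div f) ^ k) else 0))
          = (\<Sum>f | f dvd d. if f = d then of_real (moebius d) else (0::complex))"
      proof (intro sum.cong refl)
        fix f assume "f \<in> {f. f dvd d}"
        then have f: "f dvd d" "f > 0" using d by (auto intro: Nat.gr0I)
        show "of_real (moebius f) * (if (d div f) ^ k dvd n then of_nat ((d div f) ^ k) else 0)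
            = (if f = d then of_real (moebius d) else (0::complex))"
        proof (cases "f = d")
          case True
          then show ?thesis using d by simp
        next
          case f_ne: False
          have "d div f \<noteq> 1" using f f_ne by (metis dvd_div_mult_self mult_1)
          moreover have "d div f > 0" using f d by (simp add: div_greater_zero_iff dvd_imp_le)
          ultimately have "\<not> (d div f) ^ k dvd n" using False by auto
          then show ?thesis using f_ne by simp
        qed
      qed
      also have "\<dots> = of_real (moebius d)" using d by simp
      finally show ?thesis unfolding sum_kfree_numerators_e_exp[OF d] by (simp only:)
    qed (auto simp: mu_k_def)
  qed
  also have "\<dots> = of_real (moebius d) * S_k k N \<beta>"
    unfolding S_k_def sum_distrib_left by (intro sum.cong refl) (simp only: mult_ac)
  finally show ?thesis .
qed

text \<open>Write d1 = u g and d2 = v g with u, v coprime. Equality of the fractions forces u^k to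
  divide a1 and v^k to divide a2; as u divides d1 and v divides d2, both are 1.\<close>

lemma kfree_numerators_fractions_distinct:
  assumes d: "d1 > 0" "d2 > 0" and a: "a1 \<in> kfree_numerators k d1" "a2 \<in> kfree_numerators k d2" and eq: "a1 * d2 ^ k = a2 * d1 ^ k"
  shows "d1 = d2 \<and> a1 = a2"
proof -
  define g where "g = gcd d1 d2"
  have g0: "g > 0" using d by (simp add: g_def)
  obtain u v where uv: "d1 = u * g" "d2 = v * g" "coprime u v"
    using gcd_coprime_exists[of d1 d2] g0 unfolding g_def by (auto simp: mult.commute)
  have "g ^ k * (a1 * v ^ k) = g ^ k * (a2 * u ^ k)" using eq by (simp add: uv power_mult_distrib mult_ac)
  then have e: "a1 * v ^ k = a2 * u ^ k" using g0 by simp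
  have "coprime (u ^ k) (v ^ k)" using uv by simp
  moreover have "u ^ k dvd a1 * v ^ k" unfolding e by simp
  ultimately have "u ^ k dvd a1" by (simp add: coprime_dvd_mult_left_iff)
  then have u: "\<not> u > 1" using a(1) uv by (auto simp: kfree_numerators_def)
  have "coprime (v ^ k) (u ^ k)" using uv by (simp add: coprime_commute)
  moreover have "v ^ k dvd a2 * u ^ k" unfolding e[symmetric] by simp
  ultimately have "v ^ k dvd a2" by (simp add: coprime_dvd_mult_left_iff)
  then have v: "\<not> v > 1" using a(2) uv by (auto simp: kfree_numerators_def)
  have "u > 0" "v > 0" using uv d by (auto intro: Nat.gr0I)
  then have "u = 1" "v = 1" using u v by auto
  then show ?thesis using uv e by simp
qed

section \<open>Arcs at the fractions and the critical lower bound\<close>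

lemma has_integral_arcs:
  fixes h :: "real \<Rightarrow> real" and c :: "'x \<Rightarrow> real"
  assumes X: "finite X" and c: "\<And>x. x \<in> X \<Longrightarrow> 0 \<le> c x \<and> c x + \<eta> \<le> 1"
    and h: "continuous_on UNIV h" and \<eta>: "\<eta> \<ge> 0"
  shows "((\<lambda>\<alpha>. \<Sum>x\<in>X. if \<alpha> \<in> {c x..c x + \<eta>} then h \<alpha> else 0) has_integral
      (\<Sum>x\<in>X. integral {0..\<eta>} (\<lambda>\<beta>. h (c x + \<beta>)))) {0..1}"
proof (intro has_integral_sum X)
  fix x assume x: "x \<in> X"
  have "integral {c x..c x + \<eta>} h = integral {0..\<eta>} (\<lambda>\<beta>. h (c x + \<beta>))"
    using integral_shift_Icc_real[of 0 \<eta> h "c x"] by (simp add: o_def add.commute)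
  moreover have "(h has_integral integral {c x..c x + \<eta>} h) {c x..c x + \<eta>}"
    by (intro integrable_integral integrable_continuous_interval continuous_on_subset[OF h]) auto
  ultimately have "(h has_integral integral {0..\<eta>} (\<lambda>\<beta>. h (c x + \<beta>))) {c x..c x + \<eta>}" by simp
  then show "((\<lambda>\<alpha>. if \<alpha> \<in> {c x..c x + \<eta>} then h \<alpha> else 0) has_integral integral {0..\<eta>} (\<lambda>\<beta>. h (c x + \<beta>))) {0..1}"
    using c[OF x] by (subst has_integral_restrict) auto
qed

text \<open>The arcs extend only to the right of a / d^k <= 1 - 1 / d^k, so they stay inside the
  unit interval and never wrap around.\<close>

lemma kfree_numerators_arc_subset:
  assumes d: "1 \<le> d" "d \<le> P" and a: "a \<in> kfree_numerators k d" and \<eta>: "\<eta> \<le> 1 / real P ^ k"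
  shows "0 \<le> real a / real (d ^ k)" "real a / real (d ^ k) + \<eta> \<le> 1"
proof -
  have "a + 1 \<le> d ^ k" using a by (auto simp: kfree_numerators_def)
  then have "real (a + 1) \<le> real (d ^ k)" by (rule of_nat_mono)
  then have "real a / real (d ^ k) \<le> 1 - 1 / real (d ^ k)" using d by (simp add: field_simps)
  moreover have "1 / real P ^ k \<le> 1 / real (d ^ k)"
    using d by (simp add: frac_le power_mono)
  ultimately show "real a / real (d ^ k) + \<eta> \<le> 1" using \<eta> by linarith
qed simp

text \<open>If at most d^k shifted values have a sum of norm at least T, then by Jensen their p-th
  powers sum to at least T^p d^(k(1-p)). \<open>G\<close> is general because it will be the full sum
  as well as the sum without its low part.\<close>

lemma kfree_numerators_arcs_ge:
  fixes G :: "real \<Rightarrow> complex"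
  assumes G: "continuous_on UNIV G" and \<eta>: "\<eta> \<ge> 0" and p: "p \<ge> 1" and d: "d \<ge> 1" and T: "T \<ge> 0"
    and le: "\<And>\<beta>. \<beta> \<in> {0..\<eta>} \<Longrightarrow> T \<le> norm (\<Sum>a\<in>kfree_numerators k d. G (real a / real (d ^ k) + \<beta>))"
  shows "\<eta> * (T powr p * real (d ^ k) powr (1 - p)) \<le> (\<Sum>a\<in>kfree_numerators k d. integral {0..\<eta>} (\<lambda>\<beta>. norm (G (real a / real (d ^ k) + \<beta>)) powr p))"
proof -
  have int: "(\<lambda>\<beta>. norm (G (real a / real (d ^ k) + \<beta>)) powr p) integrable_on {0..\<eta>}" for a
    using p by (intro integrable_norm_powr continuous_on_compose2[OF G] continuous_intros) auto
  have "\<eta> * (T powr p * real (d ^ k) powr (1 - p)) = integral {0..\<eta>} (\<lambda>_. T powr p * real (d ^ k) powr (1 - p))"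
    using \<eta> by simp
  also have "\<dots> \<le> integral {0..\<eta>} (\<lambda>\<beta>. \<Sum>a\<in>kfree_numerators k d. norm (G (real a / real (d ^ k) + \<beta>)) powr p)"
  proof (intro integral_le integrable_const_ivl integrable_sum int)
    fix \<beta> assume \<beta>: "\<beta> \<in> {0..\<eta>}"
    let ?s = "\<Sum>a\<in>kfree_numerators k d. norm (G (real a / real (d ^ k) + \<beta>)) powr p"
    have s0: "?s \<ge> 0" by (intro sum_nonneg) auto
    have "T powr p \<le> (\<Sum>a\<in>kfree_numerators k d. norm (G (real a / real (d ^ k) + \<beta>))) powr p"
      using T p order_trans[OF le[OF \<beta>] norm_sum] by (intro powr_mono2) auto
    also have "\<dots> \<le> (\<Sum>a\<in>kfree_numerators k d. 1) powr (p - 1) * (\<Sum>a\<in>kfree_numerators k d. 1 powr (1 - p) * norm (G (real a / real (d ^ k) + \<beta>)) powr p)"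
      using p by (intro powr_sum_le) auto
    also have "\<dots> \<le> real (d ^ k) powr (p - 1) * ?s"
      using s0 p card_kfree_numerators_le[of k d] by (auto intro!: mult_right_mono powr_mono2 simp flip: of_nat_power)
    finally have "T powr p * real (d ^ k) powr (1 - p) \<le> real (d ^ k) powr (p - 1) * ?s * real (d ^ k) powr (1 - p)"
      by (intro mult_right_mono) auto
    also have "\<dots> = ?s * (real (d ^ k) powr (p - 1) * real (d ^ k) powr (1 - p))" by (simp only: mult_ac)
    also have "real (d ^ k) powr (p - 1) * real (d ^ k) powr (1 - p) = 1"
      using d by (simp flip: powr_add)
    finally show "T powr p * real (d ^ k) powr (1 - p) \<le> ?s" by simp
  qed auto
  also have "\<dots> = (\<Sum>a\<in>kfree_numerators k d. integral {0..\<eta>} (\<lambda>\<beta>. norm (G (real a / real (d ^ k) + \<beta>)) powr p))"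
    by (intro integral_sum int) auto
  finally show ?thesis .
qed

lemma I_k_lower_critical:
  assumes k: "k \<ge> 2" and p: "p = 1 + 1 / real k" and N: "N \<ge> 2"
  shows "real N powr (1 / real k) * ln (real N) \<le> 48 * real k * 8 powr p * I_k k N p"
proof -
  define \<eta> where "\<eta> = 1 / (6 * real N)"
  have \<eta>: "\<eta> > 0" using N by (simp add: \<eta>_def)
  have p1: "p \<ge> 1" using p by simp
  \<comment> \<open>Distinct fractions with denominators at most P^k differ by at least P^(-2k) >= 1
    / N, while the arcs have length 1 / (6 N).\<close>
  define P where "P = nat \<lfloor>real N powr (1 / (2 * real k))\<rfloor>"
  have r1: "real N powr (1 / (2 * real k)) \<ge> 1" using N by (intro ge_one_powr_ge_zero) auto
  have P: "P \<ge> 1" "real P \<le> real N powr (1 / (2 * real k))" "real N powr (1 / (2 * real k)) < real P + 1"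
    using r1 by (auto simp: P_def le_nat_iff le_floor_iff)
  have P2k: "real P ^ (2 * k) \<le> real N"
  proof -
    have "real P ^ (2 * k) \<le> (real N powr (1 / (2 * real k))) ^ (2 * k)" using P by (intro power_mono) auto
    also have "\<dots> = (real N powr (1 / (2 * real k))) powr real (2 * k)" using N by (intro powr_realpow[symmetric]) simp
    also have "\<dots> = real N" using N k by (simp add: powr_powr)
    finally show ?thesis .
  qed
  have Pk: "real P ^ k \<le> real N"
  proof -
    have "real P ^ k \<le> real P ^ (2 * k)" using P by (intro power_increasing) auto
    then show ?thesis using P2k by linarith
  qed
  define Q where "Q = {d \<in> {1..P}. mu_k 2 d = 1}"
  define X where "X = Sigma Q (kfree_numerators k)"
  define c where "c = (\<lambda>(d, a). real a / real (d ^ k))"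
  define h where "h = (\<lambda>\<alpha>. norm (S_k k N \<alpha>) powr p)"
  have hc: "continuous_on UNIV h"
    unfolding h_def using p1 by (intro continuous_on_powr' continuous_intros) auto
  have finX: "finite X" by (auto simp: X_def Q_def)
  have cX: "0 \<le> c x \<and> c x + \<eta> \<le> 1" if "x \<in> X" for x
  proof -
    have "real P ^ k \<le> 6 * real N" using Pk by linarith
    then have "\<eta> \<le> 1 / real P ^ k" unfolding \<eta>_def using P N by (intro frac_le) auto
    then show ?thesis using that kfree_numerators_arc_subset by (auto simp: X_def Q_def c_def)
  qed
  have disj: "(\<Sum>x\<in>X. if \<alpha> \<in> {c x..c x + \<eta>} then h \<alpha> else 0) \<le> h \<alpha>" for \<alpha>
  proof -
    have uniq: "x = x'" if x: "x \<in> X" "x' \<in> X" "\<alpha> \<in> {c x..c x + \<eta>}" "\<alpha> \<in> {c x'..c x' + \<eta>}" for x x'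
    proof (rule ccontr)
      assume ne: "x \<noteq> x'"
      obtain d1 a1 d2 a2 where xx: "x = (d1, a1)" "x' = (d2, a2)" by (metis surj_pair)
      have d: "1 \<le> d1" "d1 \<le> P" "1 \<le> d2" "d2 \<le> P" "a1 \<in> kfree_numerators k d1" "a2 \<in> kfree_numerators k d2"
        using x xx by (auto simp: X_def Q_def)
      have "a1 * d2 ^ k \<noteq> a2 * d1 ^ k"
        using kfree_numerators_fractions_distinct[of d1 d2 a1 k a2] ne d xx by auto
      then have "1 \<le> \<bar>int (a1 * d2 ^ k) - int (a2 * d1 ^ k)\<bar>" by linarith
      then have "1 \<le> real_of_int \<bar>int (a1 * d2 ^ k) - int (a2 * d1 ^ k)\<bar>" by linarith
      then have "1 \<le> \<bar>real a1 * real d2 ^ k - real a2 * real d1 ^ k\<bar>" by simp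
      also have "real a1 * real d2 ^ k - real a2 * real d1 ^ k = (c x - c x') * (real d1 ^ k * real d2 ^ k)"
        using d by (simp add: c_def xx field_simps)
      also have "\<bar>\<dots>\<bar> = \<bar>c x - c x'\<bar> * (real d1 ^ k * real d2 ^ k)" by (simp add: abs_mult)
      also have "\<dots> \<le> \<eta> * (real P ^ k * real P ^ k)"
        using x d \<eta> by (intro mult_mono power_mono) auto
      also have "\<dots> = \<eta> * real P ^ (2 * k)" by (simp add: mult_2 power_add)
      also have "\<dots> \<le> \<eta> * real N" using P2k \<eta> by (intro mult_left_mono) auto
      also have "\<dots> = 1 / 6" using N by (simp add: \<eta>_def)
      finally show False by simp
    qed
    have h0: "h \<alpha> \<ge> 0" by (simp add: h_def)
    have "(\<Sum>x\<in>X. if \<alpha> \<in> {c x..c x + \<eta>} then h \<alpha> else 0) = (\<Sum>x\<in>{x\<in>X. \<alpha> \<in> {c x..c x + \<eta>}}. h \<alpha>)"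
      by (rule sum.inter_filter[symmetric]) (rule finX)
    also have "\<dots> = real (card {x\<in>X. \<alpha> \<in> {c x..c x + \<eta>}}) * h \<alpha>" by simp
    also have "\<dots> \<le> 1 * h \<alpha>"
    proof (intro mult_right_mono h0)
      have "card {x\<in>X. \<alpha> \<in> {c x..c x + \<eta>}} \<le> Suc 0"
        using uniq finX by (subst card_le_Suc0_iff_eq) auto
      then show "real (card {x\<in>X. \<alpha> \<in> {c x..c x + \<eta>}}) \<le> 1" by simp
    qed
    finally show ?thesis by simp
  qed
  have "(\<Sum>x\<in>X. integral {0..\<eta>} (\<lambda>\<beta>. h (c x + \<beta>))) \<le> integral {0..1} h"
    using \<eta> by (intro has_integral_le[OF has_integral_arcs[OF finX cX hc] integrable_integral] disj
        integrable_continuous_interval continuous_on_subset[OF hc]) auto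
  also have "\<dots> = I_k k N p" by (simp add: h_def I_k_def)
  finally have up: "(\<Sum>x\<in>X. integral {0..\<eta>} (\<lambda>\<beta>. h (c x + \<beta>))) \<le> I_k k N p" .
  \<comment> \<open>The 8 k combines the density 1/4 of squarefree numbers with ln (P + 1) >= ln N /
    (2 k).\<close>
  have "\<eta> * (real N / 8) powr p * (ln (real N) / (8 * real k)) \<le> \<eta> * (real N / 8) powr p * (\<Sum>d\<in>Q. 1 / real d)"
  proof (intro mult_left_mono)
    have "(\<Sum>d\<in>Q. 1 / real d) = (\<Sum>d=1..P. mu_k 2 d * (1 / real d))"
    proof -
      have "(\<Sum>d\<in>Q. 1 / real d) = (\<Sum>d=1..P. if mu_k 2 d = 1 then 1 / real d else 0)"
        unfolding Q_def by (rule sum.inter_filter) simp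
      also have "\<dots> = (\<Sum>d=1..P. mu_k 2 d * (1 / real d))"
        by (intro sum.cong refl) (use mu_k_range[of 2] in auto)
      finally show ?thesis .
    qed
    moreover have "ln (real P + 1) / 4 \<le> (\<Sum>d=1..P. mu_k 2 d * (1 / real d))"
      by (rule sum_mu_k_inverse_ge) simp
    moreover have "ln (real N) / (2 * real k) \<le> ln (real P + 1)"
    proof -
      have "ln (real N) / (2 * real k) = ln (real N powr (1 / (2 * real k)))" using N by (simp add: ln_powr)
      also have "\<dots> \<le> ln (real P + 1)" using P r1 N by (intro ln_mono) auto
      finally show ?thesis .
    qed
    ultimately show "ln (real N) / (8 * real k) \<le> (\<Sum>d\<in>Q. 1 / real d)" by simp
  qed (use \<eta> in auto)
  also have "\<dots> = (\<Sum>d\<in>Q. \<eta> * ((real N / 8) powr p * real (d ^ k) powr (1 - p)))"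
    unfolding sum_distrib_left
  proof (intro sum.cong refl)
    fix d assume "d \<in> Q"
    then have "d \<ge> 1" by (auto simp: Q_def)
    then have "real (d ^ k) powr (1 - p) = real d powr (real k * (1 - p))" by (simp add: power_powr)
    \<comment> \<open>Exactly at the critical exponent the contribution of d is proportional to 1 /
      d.\<close>
    also have "real k * (1 - p) = - 1" using k by (simp add: p)
    finally have "real (d ^ k) powr (1 - p) = 1 / real d" using \<open>d \<ge> 1\<close> by (simp add: powr_minus_divide)
    then show "\<eta> * (real N / 8) powr p * (1 / real d) = \<eta> * ((real N / 8) powr p * real (d ^ k) powr (1 - p))"
      by simp
  qed
  also have "\<dots> \<le> (\<Sum>d\<in>Q. \<Sum>a\<in>kfree_numerators k d. integral {0..\<eta>} (\<lambda>\<beta>. norm (S_k k N (real a / real (d ^ k) + \<beta>)) powr p))"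
  proof (intro sum_mono kfree_numerators_arcs_ge continuous_intros)
    fix d \<beta> assume d: "d \<in> Q" and \<beta>: "\<beta> \<in> {0..\<eta>}"
    have "norm (\<Sum>a\<in>kfree_numerators k d. S_k k N (real a / real (d ^ k) + \<beta>)) = \<bar>moebius d\<bar> * norm (S_k k N \<beta>)"
      using d k by (subst sum_kfree_numerators_S_k) (auto simp: Q_def norm_mult)
    also have "\<bar>moebius d\<bar> = 1" using d by (intro abs_moebius_squarefree squarefree_if_mu_2) (auto simp: Q_def)
    finally show "real N / 8 \<le> norm (\<Sum>a\<in>kfree_numerators k d. S_k k N (real a / real (d ^ k) + \<beta>))"
      using norm_S_k_near_0[OF k, of N \<beta>] N \<beta> by (auto simp: \<eta>_def)
  qed (use \<eta> p1 in \<open>auto simp: Q_def\<close>)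
  also have "\<dots> = (\<Sum>x\<in>X. integral {0..\<eta>} (\<lambda>\<beta>. h (c x + \<beta>)))"
    unfolding X_def c_def h_def by (subst sum.Sigma) (auto simp: Q_def case_prod_unfold)
  also note up
  finally have "\<eta> * (real N / 8) powr p * (ln (real N) / (8 * real k)) \<le> I_k k N p" .
  moreover have "\<eta> * (real N / 8) powr p = real N powr (1 / real k) / (6 * 8 powr p)"
  proof -
    have "real N powr p = real N * real N powr (1 / real k)" using N by (simp add: p powr_add)
    then show ?thesis using N by (simp add: \<eta>_def powr_divide)
  qed
  ultimately have "real N powr (1 / real k) * ln (real N) / (48 * real k * 8 powr p) \<le> I_k k N p"
    by (simp add: mult_ac)
  moreover have "48 * real k * 8 powr p > 0" using k by simp
  ultimately show ?thesis by (simp add: pos_divide_le_eq mult_ac)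
qed

section \<open>The low part on the shifted arcs\<close>

lemma norm_abel_le:
  fixes \<gamma> :: "nat \<Rightarrow> complex"
  assumes \<Gamma>: "\<And>t. t \<le> M \<Longrightarrow> norm (\<Sum>m=1..t. \<gamma> m) \<le> \<Gamma>"
  shows "norm (\<Sum>m=1..M. \<gamma> m * e_exp (\<theta> * real m)) \<le> \<Gamma> * (1 + 2 * pi * \<bar>\<theta>\<bar> * real M)"
proof -
  define s where "s = (\<lambda>t. \<Sum>m=1..t. \<gamma> m)"
  define u where "u = (\<lambda>m::nat. e_exp (\<theta> * real m))"
  \<comment> \<open>Summation by parts: each step of \<open>u\<close> has norm at most 2 pi
    |\<theta>|, so the twist costs only the factor 1 + 2 pi |\<theta>| M.\<close>
  have "(\<Sum>m=1..t. \<gamma> m * u m) = s t * u t - (\<Sum>m<t. s m * (u (Suc m) - u m))" for t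
    by (induction t) (auto simp: s_def algebra_simps)
  then have "norm (\<Sum>m=1..M. \<gamma> m * u m) \<le> norm (s M * u M) + norm (\<Sum>m<M. s m * (u (Suc m) - u m))"
    by (simp add: norm_triangle_ineq4)
  also have "norm (s M * u M) \<le> \<Gamma>" using \<Gamma>[of M] by (simp add: s_def u_def norm_mult)
  also have "norm (\<Sum>m<M. s m * (u (Suc m) - u m)) \<le> (\<Sum>m<M. \<Gamma> * (2 * pi * \<bar>\<theta>\<bar>))"
  proof (intro sum_norm_le)
    fix m assume m: "m \<in> {..<M}"
    have s: "norm (s m) \<le> \<Gamma>" using \<Gamma>[of m] m by (simp add: s_def)
    have "norm (u (Suc m) - u m) \<le> 2 * pi * \<bar>\<theta>\<bar>"
      using norm_e_exp_diff_le[of "\<theta> * real (Suc m)" "\<theta> * real m"] by (simp add: u_def algebra_simps)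
    then show "norm (s m * (u (Suc m) - u m)) \<le> \<Gamma> * (2 * pi * \<bar>\<theta>\<bar>)"
      unfolding norm_mult using s by (intro mult_mono) (auto intro: order_trans[OF norm_ge_zero])
  qed
  finally show ?thesis by (simp add: u_def algebra_simps)
qed

text \<open>With w = e / gcd e d', the divisibility becomes a congruence condition on m alone, of
  density w^(-k).\<close>

lemma power_dvd_mult_iff:
  fixes e d' m :: nat
  assumes "e > 0"
  obtains w where "e = w * gcd e d'" "w > 0" "\<And>m. e ^ k dvd m * d' ^ k \<longleftrightarrow> w ^ k dvd m"
proof -
  define g where "g = gcd e d'"
  have g0: "g > 0" using assms by (simp add: g_def)
  obtain w v where wv: "e = w * g" "d' = v * g" "coprime w v"
    using gcd_coprime_exists[of e d'] g0 unfolding g_def by (auto simp: mult.commute)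
  have "e ^ k dvd m * d' ^ k \<longleftrightarrow> w ^ k dvd m" for m
  proof -
    have "e ^ k dvd m * d' ^ k \<longleftrightarrow> w ^ k * g ^ k dvd (m * v ^ k) * g ^ k"
      by (simp add: wv power_mult_distrib mult_ac)
    also have "\<dots> \<longleftrightarrow> w ^ k dvd m * v ^ k" using g0 by simp
    also have "\<dots> \<longleftrightarrow> w ^ k dvd m" using wv by (simp add: coprime_dvd_mult_left_iff)
    finally show ?thesis .
  qed
  moreover have "w > 0" using assms wv by (auto intro: Nat.gr0I)
  ultimately show ?thesis using that[of w] wv(1) unfolding g_def by blast
qed

text \<open>Apply \<open>sum_kfree_numerators\<close> to the indicator of d^k dividing a d'^k. Since
  d does not divide d', w = d / gcd d d' exceeds 1, and the divisibility would force w^k to divide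
  a, which the numerators exclude. So the left side is 0, while counting b on the right gives the
  powers of gcds.\<close>

lemma sum_moebius_gcd_power_eq_0:
  assumes d: "d > 0" and k: "k > 0" and nd: "\<not> d dvd d'"
  shows "(\<Sum>f | f dvd d. moebius f * real (gcd (d div f) d') ^ k) = 0"
proof -
  define g where "g = (\<lambda>a. if d ^ k dvd a * d' ^ k then 1 else (0::complex))"
  have "g a = 0" if a: "a \<in> kfree_numerators k d" for a
  proof -
    obtain w where w: "d = w * gcd d d'" "w > 0" "\<And>m. d ^ k dvd m * d' ^ k \<longleftrightarrow> w ^ k dvd m"
      using power_dvd_mult_iff[OF d] by blast
    have "w \<noteq> 1" using w(1) nd by (metis gcd_dvd2 mult_1)
    then have "w > 1" using w(2) by simp
    moreover have "w dvd d" using w(1) by (metis dvd_triv_left)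
    ultimately have "\<not> w ^ k dvd a" using a by (auto simp: kfree_numerators_def)
    then show ?thesis by (simp add: g_def w(3))
  qed
  then have "0 = (\<Sum>a\<in>kfree_numerators k d. g a)" by simp
  also have "\<dots> = (\<Sum>f | f dvd d. of_real (moebius f) * (\<Sum>b<(d div f) ^ k. g (f ^ k * b)))" by (rule sum_kfree_numerators[OF d])
  also have "\<dots> = (\<Sum>f | f dvd d. of_real (moebius f) * of_real (real (gcd (d div f) d') ^ k))"
  proof (intro sum.cong refl)
    fix f assume "f \<in> {f. f dvd d}"
    then have f: "f dvd d" "f > 0" using d by (auto intro: Nat.gr0I)
    define e where "e = d div f"
    have e: "d = f * e" "e > 0" using f d by (auto simp: e_def div_greater_zero_iff dvd_imp_le)
    obtain w where w: "e = w * gcd e d'" "w > 0" "\<And>m. e ^ k dvd m * d' ^ k \<longleftrightarrow> w ^ k dvd m"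
      using power_dvd_mult_iff[OF e(2)] by blast
    have "d ^ k dvd f ^ k * b * d' ^ k \<longleftrightarrow> w ^ k dvd b" for b
      using f w(3)[of b] by (simp add: e(1) power_mult_distrib mult.assoc)
    then have "(\<Sum>b<e ^ k. g (f ^ k * b)) = of_nat (card {b\<in>{..<e ^ k}. w ^ k dvd b})"
      unfolding g_def by (simp flip: sum.inter_filter)
    also have "{b\<in>{..<e ^ k}. w ^ k dvd b} = (\<lambda>b. w ^ k * b) ` {..<gcd e d' ^ k}"
    proof -
      have "e ^ k = w ^ k * gcd e d' ^ k" using w(1) by (metis power_mult_distrib)
      then show ?thesis using w(2) by (auto elim!: dvdE)
    qed
    also have "card \<dots> = gcd e d' ^ k" using w(2) by (simp add: card_image inj_on_def)
    finally show "of_real (moebius f) * (\<Sum>b<(d div f) ^ k. g (f ^ k * b)) = of_real (moebius f) * of_real (real (gcd (d div f) d') ^ k)"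
      by (simp add: e_def)
  qed
  also have "\<dots> = of_real (\<Sum>f | f dvd d. moebius f * real (gcd (d div f) d') ^ k)" by simp
  finally show ?thesis by (metis of_real_eq_0_iff)
qed

lemma sum_divisor_powers_le:
  assumes d: "d > 0" and k: "k \<ge> 2"
  shows "(\<Sum>f | f dvd d. real ((d div f) ^ k)) \<le> 2 * real d ^ k"
proof -
  have "(\<Sum>f | f dvd d. real ((d div f) ^ k)) \<le> (\<Sum>f | f dvd d. real d ^ k * (1 / (real f)\<^sup>2))"
  proof (intro sum_mono)
    fix f assume "f \<in> {f. f dvd d}"
    then have f: "f dvd d" "f > 0" using d by (auto intro: Nat.gr0I)
    have "real ((d div f) ^ k) = real d ^ k / real f ^ k" using f by (simp add: real_of_nat_div power_divide)
    also have "\<dots> \<le> real d ^ k / (real f)\<^sup>2"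
      using f k by (intro divide_left_mono power_increasing mult_pos_pos) auto
    finally show "real ((d div f) ^ k) \<le> real d ^ k * (1 / (real f)\<^sup>2)" by simp
  qed
  also have "\<dots> \<le> (\<Sum>f=1..d. real d ^ k * (1 / (real f)\<^sup>2))"
    using d by (intro sum_mono2) (auto intro: dvd_imp_le Nat.gr0I simp: Suc_le_eq)
  also have "\<dots> = real d ^ k * (1 + (\<Sum>f=2..d. 1 / (real f)\<^sup>2))"
    unfolding sum_distrib_left[symmetric]
    using sum.atLeast_Suc_atMost[of 1 d "\<lambda>f. 1 / (real f)\<^sup>2"] d unfolding Suc_1 by simp
  also have "\<dots> \<le> real d ^ k * 2"
    using sum_inverse_squares_le[of d] by (intro mult_left_mono) auto
  finally show ?thesis by simp
qed

text \<open>The bound does not involve the length M: the density terms cancel in the Moebius sum,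
  each divisor f leaves a rounding error of at most (d / f)^k, and the phase of \<beta> turns by at
  most 1/6 along the progression.\<close>

lemma sum_kfree_numerators_progression_le:
  assumes d: "d > 0" and k: "k \<ge> 2" and nd: "\<not> d dvd d'"
    and \<beta>: "0 \<le> \<beta>" "\<beta> * real (d' ^ k) * real M \<le> 1 / 6"
  shows "norm (\<Sum>a\<in>kfree_numerators k d. \<Sum>m=1..M. e_exp ((real a / real (d ^ k) + \<beta>) * real (d' ^ k) * real m)) \<le> 6 * real d ^ k"
proof -
  define \<gamma> where "\<gamma> = (\<lambda>m. \<Sum>f | f dvd d. of_real (moebius f) * (if (d div f) ^ k dvd d' ^ k * m then of_nat ((d div f) ^ k) else (0::complex)))"
  have "(\<Sum>a\<in>kfree_numerators k d. \<Sum>m=1..M. e_exp ((real a / real (d ^ k) + \<beta>) * real (d' ^ k) * real m))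
      = (\<Sum>m=1..M. \<Sum>a\<in>kfree_numerators k d. e_exp ((real a / real (d ^ k) + \<beta>) * real (d' ^ k) * real m))"
    by (rule sum.swap)
  also have "\<dots> = (\<Sum>m=1..M. \<gamma> m * e_exp ((\<beta> * real (d' ^ k)) * real m))"
  proof (intro sum.cong refl)
    fix m
    have "\<gamma> m = (\<Sum>a\<in>kfree_numerators k d. e_exp (real a / real (d ^ k) * real (d' ^ k * m)))"
      unfolding \<gamma>_def by (rule sum_kfree_numerators_e_exp[OF d, symmetric])
    then show "(\<Sum>a\<in>kfree_numerators k d. e_exp ((real a / real (d ^ k) + \<beta>) * real (d' ^ k) * real m)) = \<gamma> m * e_exp ((\<beta> * real (d' ^ k)) * real m)"
      unfolding sum_distrib_right by (simp add: distrib_right e_exp_add mult.assoc flip: sum_distrib_right)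
  qed
  finally have eq: "(\<Sum>a\<in>kfree_numerators k d. \<Sum>m=1..M. e_exp ((real a / real (d ^ k) + \<beta>) * real (d' ^ k) * real m))
      = (\<Sum>m=1..M. \<gamma> m * e_exp ((\<beta> * real (d' ^ k)) * real m))" .
  have partial: "norm (\<Sum>m=1..t. \<gamma> m) \<le> 2 * real d ^ k" for t
  proof -
    define c where "c = (\<lambda>f. real ((d div f) ^ k) * real (card {m\<in>{1..t}. (d div f) ^ k dvd d' ^ k * m}))"
    have "(\<Sum>m=1..t. \<gamma> m) = (\<Sum>f | f dvd d. of_real (moebius f) * (\<Sum>m=1..t. if (d div f) ^ k dvd d' ^ k * m then of_nat ((d div f) ^ k) else (0::complex)))"
      unfolding \<gamma>_def by (subst sum.swap) (simp add: sum_distrib_left)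
    also have "\<dots> = of_real (\<Sum>f | f dvd d. moebius f * c f)"
      unfolding c_def by (simp add: mult_ac flip: sum.inter_filter)
    \<comment> \<open>Subtracting the expected value t gcd^k of \<open>c f\<close> changes nothing,
      because its Moebius sum is 0.\<close>
    also have "(\<Sum>f | f dvd d. moebius f * c f) = (\<Sum>f | f dvd d. moebius f * (c f - real t * real (gcd (d div f) d') ^ k))"
    proof -
      have "(\<Sum>f | f dvd d. moebius f * (real t * real (gcd (d div f) d') ^ k)) = real t * (\<Sum>f | f dvd d. moebius f * real (gcd (d div f) d') ^ k)"
        by (simp add: sum_distrib_left mult_ac)
      also have "\<dots> = 0" using sum_moebius_gcd_power_eq_0[OF d _ nd] k by simp
      finally show ?thesis by (simp add: right_diff_distrib sum_subtractf)
    qed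
    finally have "norm (\<Sum>m=1..t. \<gamma> m) = \<bar>\<Sum>f | f dvd d. moebius f * (c f - real t * real (gcd (d div f) d') ^ k)\<bar>"
      by (simp only: norm_of_real)
    also have "\<dots> \<le> (\<Sum>f | f dvd d. 1 * real ((d div f) ^ k))"
    proof (intro order_trans[OF sum_abs] sum_mono)
      fix f assume "f \<in> {f. f dvd d}"
      then have f: "f dvd d" "f > 0" using d by (auto intro: Nat.gr0I)
      define e where "e = d div f"
      have e: "e > 0" using f d by (auto simp: e_def div_greater_zero_iff dvd_imp_le)
      obtain w where w: "e = w * gcd e d'" "w > 0" "\<And>m. e ^ k dvd m * d' ^ k \<longleftrightarrow> w ^ k dvd m"
        using power_dvd_mult_iff[OF e] by blast
      have ek: "real (e ^ k) = real (w ^ k) * real (gcd e d') ^ k"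
        using w(1) by (metis of_nat_mult of_nat_power power_mult_distrib)
      have "{m\<in>{1..t}. e ^ k dvd d' ^ k * m} = {m\<in>{1..t}. w ^ k dvd m}"
        using w(3) by (simp add: mult.commute)
      also have "card \<dots> = t div w ^ k"
        using w(2) by (subst multiples_eq_image) (auto simp: card_image inj_on_def)
      finally have cf: "c f = real (e ^ k) * real (t div w ^ k)" by (simp add: c_def e_def)
      have wk: "real (w ^ k) > 0" using w(2) by simp
      have "real t / real (w ^ k) - 1 \<le> real (t div w ^ k)" "real (t div w ^ k) \<le> real t / real (w ^ k)"
      proof -
        have "t < w ^ k + t div w ^ k * w ^ k" using w(2) by (intro dividend_less_div_times) simp
        then have "real t < real (w ^ k + t div w ^ k * w ^ k)" by (simp only: of_nat_less_iff)
        also have "\<dots> = (1 + real (t div w ^ k)) * real (w ^ k)" by (simp only: of_nat_add of_nat_mult distrib_right mult_1)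
        finally have "real t / real (w ^ k) < 1 + real (t div w ^ k)" using wk by (simp only: pos_divide_less_eq)
        then show "real t / real (w ^ k) - 1 \<le> real (t div w ^ k)" by linarith
      qed (rule of_nat_div_le_of_nat)
      then have "\<bar>real (t div w ^ k) - real t / real (w ^ k)\<bar> \<le> 1" by linarith
      then have "real (e ^ k) * \<bar>real (t div w ^ k) - real t / real (w ^ k)\<bar> \<le> real (e ^ k) * 1"
        by (intro mult_left_mono) auto
      moreover have "real (e ^ k) * (real (t div w ^ k) - real t / real (w ^ k)) = c f - real t * real (gcd e d') ^ k"
        unfolding cf right_diff_distrib using w(2) by (subst (2) ek) simp
      ultimately have "\<bar>c f - real t * real (gcd e d') ^ k\<bar> \<le> real (e ^ k)"
        by (metis abs_mult abs_of_nat mult_1_right)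
      then show "\<bar>moebius f * (c f - real t * real (gcd (d div f) d') ^ k)\<bar> \<le> 1 * real ((d div f) ^ k)"
        unfolding abs_mult e_def by (intro mult_mono abs_moebius_le_1) auto
    qed
    also have "\<dots> \<le> 2 * real d ^ k" using sum_divisor_powers_le[OF d k] by simp
    finally show ?thesis .
  qed
  have "norm (\<Sum>m=1..M. \<gamma> m * e_exp ((\<beta> * real (d' ^ k)) * real m)) \<le> 2 * real d ^ k * (1 + 2 * pi * \<bar>\<beta> * real (d' ^ k)\<bar> * real M)"
    by (rule norm_abel_le) (rule partial)
  also have "\<dots> \<le> 2 * real d ^ k * 3"
  proof (intro mult_left_mono)
    have "2 * pi * \<bar>\<beta> * real (d' ^ k)\<bar> * real M = 2 * pi * (\<beta> * real (d' ^ k) * real M)" using \<beta> by (simp add: abs_mult)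
    also have "\<dots> \<le> 2 * pi * (1 / 6)" using \<beta> by (intro mult_left_mono) auto
    also have "\<dots> \<le> 2" using pi_less_4 by simp
    finally show "1 + 2 * pi * \<bar>\<beta> * real (d' ^ k)\<bar> * real M \<le> 3" by simp
  qed auto
  finally show ?thesis unfolding eq by simp
qed

text \<open>Every d' in the low part satisfies 0 < d' < Y <= d, so d cannot divide it and the
  previous bound applies to each.\<close>

lemma sum_kfree_numerators_low_part_le:
  assumes k: "k \<ge> 2" and d: "d \<ge> Y" "d \<ge> 1" and N: "N \<ge> 1" and \<beta>: "0 \<le> \<beta>" "\<beta> \<le> 1 / (6 * real N)"
  shows "norm (\<Sum>a\<in>kfree_numerators k d. low_part k N Y (real a / real (d ^ k) + \<beta>)) \<le> 6 * real Y * real d ^ k"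
proof -
  have "(\<Sum>a\<in>kfree_numerators k d. low_part k N Y (real a / real (d ^ k) + \<beta>))
      = (\<Sum>d'\<in>{1..<Y}. of_real (moebius d') * (\<Sum>a\<in>kfree_numerators k d. \<Sum>m=1..N div d' ^ k. e_exp ((real a / real (d ^ k) + \<beta>) * real (d' ^ k) * real m)))"
    unfolding low_part_def by (subst sum.swap) (simp add: sum_distrib_left)
  also have "norm \<dots> \<le> (\<Sum>d'\<in>{1..<Y}. 1 * (6 * real d ^ k))"
  proof (intro sum_norm_le)
    fix d' assume d': "d' \<in> {1..<Y}"
    have nd: "\<not> d dvd d'" using d' d by (auto dest: dvd_imp_le)
    have "real (d' ^ k) * real (N div d' ^ k) \<le> real N"
      by (metis mult.commute of_nat_le_iff of_nat_mult div_times_less_eq_dividend)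
    then have "\<beta> * (real (d' ^ k) * real (N div d' ^ k)) \<le> 1 / (6 * real N) * real N"
      using \<beta> by (intro mult_mono) auto
    then have "\<beta> * real (d' ^ k) * real (N div d' ^ k) \<le> 1 / 6" using N by (simp add: mult.assoc)
    then have "norm (\<Sum>a\<in>kfree_numerators k d. \<Sum>m=1..N div d' ^ k. e_exp ((real a / real (d ^ k) + \<beta>) * real (d' ^ k) * real m)) \<le> 6 * real d ^ k"
      using d k nd \<beta> by (intro sum_kfree_numerators_progression_le) auto
    then show "norm (of_real (moebius d') * (\<Sum>a\<in>kfree_numerators k d. \<Sum>m=1..N div d' ^ k. e_exp ((real a / real (d ^ k) + \<beta>) * real (d' ^ k) * real m))) \<le> 1 * (6 * real d ^ k)"
      unfolding norm_mult using abs_moebius_le_1[of d'] by (intro mult_mono) auto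
  qed
  also have "\<dots> = real (Y - 1) * (6 * real d ^ k)" by simp
  also have "\<dots> \<le> real Y * (6 * real d ^ k)" by (intro mult_right_mono) auto
  finally show ?thesis by (simp add: mult_ac)
qed

text \<open>With d1 = u g and d2 = v g, the integer h = a1 v^k - a2 u^k is nonzero and at most
  \<eta> P^(2k) / g^k in absolute value. It determines a1 modulo u^k, so h and the quotient
  \<open>a1 div u ^ k\<close>, which is below g^k, determine the pair; the factors g^k cancel in the
  count.\<close>

lemma card_close_fractions_le:
  assumes d: "1 \<le> d1" "d1 \<le> P" "1 \<le> d2" "d2 \<le> P" and \<eta>: "\<eta> \<ge> 0"
  shows "real (card {(a1, a2) \<in> {..<d1 ^ k} \<times> {..<d2 ^ k}. a1 * d2 ^ k \<noteq> a2 * d1 ^ k \<and>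
      \<bar>real a1 / real (d1 ^ k) - real a2 / real (d2 ^ k)\<bar> \<le> \<eta>}) \<le> 2 * \<eta> * real P ^ (2 * k)"
    (is "real (card ?A) \<le> _")
proof -
  define g where "g = gcd d1 d2"
  have g0: "g > 0" using d by (auto simp: g_def)
  obtain u v where uv: "d1 = u * g" "d2 = v * g" "coprime u v"
    using gcd_coprime_exists[of d1 d2] g0 unfolding g_def by (auto simp: mult.commute)
  have u0: "u > 0" using uv d by (auto intro: Nat.gr0I)
  define T where "T = \<eta> * real P ^ (2 * k)"
  have T: "T \<ge> 0" using \<eta> by (simp add: T_def)
  define n where "n = nat \<lfloor>T / real (g ^ k)\<rfloor>"
  define H where "H = ({- int n..int n} - {0}) \<times> {..<g ^ k}"
  define \<phi> where "\<phi> = (\<lambda>(a1, a2). (int (a1 * v ^ k) - int (a2 * u ^ k), a1 div u ^ k))"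
  have "card ?A \<le> card H"
  proof (rule card_inj_on_le)
    show "finite H" by (simp add: H_def)
    show "inj_on \<phi> ?A"
    proof (rule inj_onI)
      fix x x' assume x: "x \<in> ?A" "x' \<in> ?A" and eq: "\<phi> x = \<phi> x'"
      obtain a1 a2 b1 b2 where xx: "x = (a1, a2)" "x' = (b1, b2)" by (metis surj_pair)
      have h: "int (a1 * v ^ k) - int (a2 * u ^ k) = int (b1 * v ^ k) - int (b2 * u ^ k)" and q: "a1 div u ^ k = b1 div u ^ k"
        using eq by (auto simp: \<phi>_def xx)
      have "(int a1 - int b1) * int (v ^ k) = int (u ^ k) * (int a2 - int b2)"
        using h by (simp add: algebra_simps)
      then have "int (u ^ k) dvd (int a1 - int b1) * int (v ^ k)" by simp
      moreover have "coprime (int (u ^ k)) (int (v ^ k))" using uv by simp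
      ultimately have "int (u ^ k) dvd int a1 - int b1" by (simp add: coprime_dvd_mult_left_iff)
      then have "int a1 mod int (u ^ k) = int b1 mod int (u ^ k)" by (simp add: mod_eq_dvd_iff)
      then have "a1 mod u ^ k = b1 mod u ^ k" by (metis of_nat_eq_iff of_nat_mod)
      with q have ab: "a1 = b1" by (metis div_mult_mod_eq)
      then have "int (a2 * u ^ k) = int (b2 * u ^ k)" using h by simp
      then have "a2 * u ^ k = b2 * u ^ k" by (simp only: of_nat_eq_iff)
      then show "x = x'" using ab u0 xx by simp
    qed
    show "\<phi> ` ?A \<subseteq> H"
    proof
      fix z assume "z \<in> \<phi> ` ?A"
      then obtain a1 a2 where z: "z = \<phi> (a1, a2)" and a: "a1 < d1 ^ k" "a2 < d2 ^ k" "a1 * d2 ^ k \<noteq> a2 * d1 ^ k"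
        "\<bar>real a1 / real (d1 ^ k) - real a2 / real (d2 ^ k)\<bar> \<le> \<eta>" by auto
      define h where "h = int (a1 * v ^ k) - int (a2 * u ^ k)"
      have "h \<noteq> 0"
      proof
        assume "h = 0"
        then have "a1 * v ^ k = a2 * u ^ k" unfolding h_def by linarith
        then have "a1 * d2 ^ k = a2 * d1 ^ k" unfolding uv power_mult_distrib by (metis mult.assoc)
        then show False using a by simp
      qed
      have "real_of_int h * real (g ^ k) = (real a1 / real (d1 ^ k) - real a2 / real (d2 ^ k)) * (real (d1 ^ k) * real (d2 ^ k))"
      proof -
        have "(real a1 / real (d1 ^ k) - real a2 / real (d2 ^ k)) * (real (d1 ^ k) * real (d2 ^ k)) = real a1 * real (d2 ^ k) - real a2 * real (d1 ^ k)"
          using d by (simp add: field_simps)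
        then show ?thesis by (simp add: h_def uv power_mult_distrib algebra_simps)
      qed
      then have "\<bar>real_of_int h\<bar> * real (g ^ k) = \<bar>real a1 / real (d1 ^ k) - real a2 / real (d2 ^ k)\<bar> * (real (d1 ^ k) * real (d2 ^ k))"
        by (metis abs_mult abs_of_nat)
      also have "\<dots> \<le> \<eta> * (real P ^ k * real P ^ k)"
        using a d \<eta> by (intro mult_mono) (auto intro!: power_mono)
      also have "\<dots> = T" by (simp add: T_def mult_2 power_add)
      finally have "\<bar>real_of_int h\<bar> \<le> T / real (g ^ k)" using g0 by (simp add: field_simps)
      then have "\<bar>h\<bar> \<le> \<lfloor>T / real (g ^ k)\<rfloor>" by (simp add: le_floor_iff)
      then have "\<bar>h\<bar> \<le> int n" unfolding n_def by linarith
      moreover have "a1 div u ^ k < g ^ k"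
        using a(1) u0 by (simp add: uv power_mult_distrib less_mult_imp_div_less mult.commute)
      ultimately show "z \<in> H" using \<open>h \<noteq> 0\<close> by (auto simp: z \<phi>_def H_def h_def)
    qed
  qed
  also have "card H = 2 * n * g ^ k"
  proof -
    have "card ({- int n..int n} - {0}) = nat (2 * int n + 1) - 1" by (subst card_Diff_singleton) auto
    also have "\<dots> = 2 * n" by linarith
    finally show ?thesis unfolding H_def card_cartesian_product by simp
  qed
  finally have "real (card ?A) \<le> real (2 * n * g ^ k)" by (rule of_nat_mono)
  also have "\<dots> = 2 * (real n * real (g ^ k))" by simp
  also have "\<dots> \<le> 2 * (T / real (g ^ k) * real (g ^ k))"
    using T by (intro mult_left_mono mult_right_mono) (auto simp: n_def)
  also have "\<dots> = 2 * \<eta> * real P ^ (2 * k)" using g0 by (simp add: T_def)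
  finally show ?thesis .
qed

subsection \<open>The lower bound for the first moment\<close>

text \<open>The logarithm is traded for a fourth root. An exponent below 1/3 is what the later
  comparison needs: with y / D of order K^3, the bound must be small against K D.\<close>

lemma moment_1_low_part_le:
  assumes k: "k \<ge> 2"
  obtains C where "C > 0"
    "\<And>N i y. y ^ (k + 1) = real N \<Longrightarrow> 2 ^ i \<le> y \<Longrightarrow>
      moment 1 (low_part k N (2 ^ i)) \<le> C * (2 ^ i * (y / 2 ^ i) powr (1/4))"
proof -
  define s where "s = 1 / (4 * real (k + 1))"
  have s: "s > 0" by (simp add: s_def)
  define e where "e = (2 ^ (k + 2) + 2 :: real) powr (1/2)"
  have e0: "(0::real) < 2 ^ (k + 2) + 2" by (intro add_pos_pos) auto
  then have "(2::real) ^ (k + 2) + 2 \<noteq> 0" by (rule less_imp_neq[THEN not_sym])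
  then have e: "e > 0" unfolding e_def powr_gt_zero .
  define K where "K = 2 * (8 * (8 powr s / s) + e)"
  have K: "K > 0" using s e by (simp add: K_def add_pos_pos)
  have blkb: "moment 1 (dyadic_block k N D) \<le> K * (real D * (y / real D) powr (1/4))"
    if y: "y ^ (k + 1) = real N" and D: "D \<ge> 1" "real D \<le> y" for N D y
  proof -
    define z where "z = y / real D"
    have z: "z \<ge> 1" using D by (simp add: z_def)
    have z1: "1 \<le> z ^ (k + 1)" using z by (rule one_le_power)
    have "ln (8 * z ^ (k + 1)) \<le> (8 * z ^ (k + 1)) powr s / s"
      using z1 s by (intro ln_powr_bound) auto
    also have "(8 * z ^ (k + 1)) powr s = 8 powr s * z powr (1/4)"
    proof -
      have "(z ^ (k + 1)) powr s = z powr (real (k + 1) * s)"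
        using z by (intro power_powr) auto
      also have "real (k + 1) * s = 1/4" by (simp add: s_def field_simps)
      finally show ?thesis by (simp add: powr_mult)
    qed
    finally have ln: "ln (8 * z ^ (k + 1)) \<le> 8 powr s / s * z powr (1/4)" by simp
    have "moment 1 (smooth_block k N D) \<le> 8 * real D * ln (8 * z ^ (k + 1))"
      using moment_1_smooth_block_le[OF k y D] by (simp add: z_def)
    also have "\<dots> \<le> 8 * real D * (8 powr s / s * z powr (1/4))"
      by (intro mult_left_mono ln) auto
    finally have 1: "moment 1 (smooth_block k N D) \<le> 8 * (8 powr s / s) * (real D * z powr (1/4))" by (simp add: mult_ac)
    have "moment 1 (\<lambda>\<alpha>. smooth_block k N D \<alpha> - dyadic_block k N D \<alpha>) \<le> ((2 ^ (k + 2) + 2) * (real D)\<^sup>2) powr (1/2)"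
      using D moment_2_edge_le[OF k D(1), of N]
      by (intro moment_lyapunov continuous_intros) (auto intro!: mult_pos_pos add_pos_pos)
    also have "\<dots> = e * real D"
      using D by (simp add: e_def powr_mult powr_half_sqrt)
    also have "\<dots> \<le> e * (real D * z powr (1/4))"
      using e z by (intro mult_left_mono mult_le_cancel_left1[THEN iffD2]) (auto intro: ge_one_powr_ge_zero)
    finally have 2: "moment 1 (\<lambda>\<alpha>. smooth_block k N D \<alpha> - dyadic_block k N D \<alpha>) \<le> e * (real D * z powr (1/4))" .
    have "moment 1 (dyadic_block k N D) = moment 1 (\<lambda>\<alpha>. smooth_block k N D \<alpha> + - (smooth_block k N D \<alpha> - dyadic_block k N D \<alpha>))" by simp
    also have "\<dots> \<le> 2 powr 1 * (moment 1 (smooth_block k N D) + moment 1 (\<lambda>\<alpha>. - (smooth_block k N D \<alpha> - dyadic_block k N D \<alpha>)))"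
      using D by (intro moment_add_le continuous_intros) auto
    also have "\<dots> \<le> 2 * (8 * (8 powr s / s) * (real D * z powr (1/4)) + e * (real D * z powr (1/4)))"
      unfolding moment_minus using 1 2 by simp
    also have "\<dots> = K * (real D * z powr (1/4))" by (simp add: K_def algebra_simps)
    finally show ?thesis by (simp add: z_def)
  qed
  define \<rho> where "\<rho> = 2 powr (- (3/4) :: real)"
  have \<rho>: "0 < \<rho>" "\<rho> < 1" using powr_less_mono[of "- (3/4)" 0 "2::real"] by (auto simp: \<rho>_def)
  define G where "G = (1 / (1 - \<rho> powr (1 / 1))) powr 1"
  have "G > 0" using \<rho> by (simp add: G_def)
  then have "K * G > 0" using K by simp
  moreover have "moment 1 (low_part k N (2 ^ i)) \<le> K * G * (2 ^ i * (y / 2 ^ i) powr (1/4))"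
    if y: "y ^ (k + 1) = real N" and i: "2 ^ i \<le> y" for N i y
  proof -
    have y0: "y > 0" using i by (rule less_le_trans[rotated]) simp
    have "moment 1 (\<lambda>\<alpha>. \<Sum>j<i. dyadic_block k N (2 ^ j) \<alpha>) \<le> K * (2 ^ i * (y / 2 ^ i) powr (1/4)) * (1 / (1 - \<rho> powr (1 / 1))) powr 1"
    proof (rule moment_sum_geometric_le[where \<pi> = "\<lambda>j. i - j"])
      fix j assume j: "j \<in> {..<i}"
      have "moment 1 (dyadic_block k N (2 ^ j)) \<le> K * (real (2 ^ j) * (y / real (2 ^ j)) powr (1/4))"
        using y dyadic_le[OF _ i] j by (intro blkb) auto
      also have "real (2 ^ j) * (y / real (2 ^ j)) powr (1/4) = 2 ^ i * (y / 2 ^ i) powr (1/4) * \<rho> ^ (i - j)"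
      proof -
        have p: "(2::real) ^ n = 2 powr real n" for n by (simp add: powr_realpow)
        have r: "\<rho> ^ (i - j) = 2 powr (- (3/4) * (real i - real j))"
          using j by (simp add: \<rho>_def powr_powr of_nat_diff mult.commute flip: powr_realpow)
        have q: "(y / 2 powr real n) powr (1/4) = y powr (1/4) * 2 powr (- (real n / 4))" for n
          by (simp add: powr_divide powr_powr powr_minus_divide)
        have "real (2 ^ j) * (y / real (2 ^ j)) powr (1/4) = y powr (1/4) * (2 powr real j * 2 powr (- (real j / 4)))"
          by (simp add: p q)
        also have "2 powr real j * 2 powr (- (real j / 4)) = (2::real) powr (3/4 * real j)"
          by (simp flip: powr_add)
        finally have L: "real (2 ^ j) * (y / real (2 ^ j)) powr (1/4) = y powr (1/4) * 2 powr (3/4 * real j)" .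
        have "2 ^ i * (y / 2 ^ i) powr (1/4) * \<rho> ^ (i - j)
            = y powr (1/4) * (2 powr real i * 2 powr (- (real i / 4)) * 2 powr (- (3/4) * (real i - real j)))"
          unfolding p q r by (simp only: mult_ac)
        also have "2 powr real i * 2 powr (- (real i / 4)) * 2 powr (- (3/4) * (real i - real j)) = (2::real) powr (3/4 * real j)"
          unfolding powr_add[symmetric] by (intro arg_cong[where f = "\<lambda>x. 2 powr x"]) (simp add: field_simps)
        finally show ?thesis using L by simp
      qed
      finally show "moment 1 (dyadic_block k N (2 ^ j)) \<le> K * (2 ^ i * (y / 2 ^ i) powr (1/4)) * \<rho> ^ (i - j)" by (simp add: mult.assoc)
    next
      show "inj_on (\<lambda>j. i - j) {..<i}" by (auto simp: inj_on_def)
    qed (use K \<rho> y0 in \<open>auto intro!: continuous_intros\<close>)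
    moreover have "low_part k N (2 ^ i) = (\<lambda>\<alpha>. \<Sum>j<i. dyadic_block k N (2 ^ j) \<alpha>)" by (rule ext) (rule low_part_eq_sum_dyadic_block)
    ultimately show ?thesis by (simp add: G_def mult_ac)
  qed
  ultimately show ?thesis by (rule that)
qed

text \<open>If every point lay in at most one arc, the first term on the right would suffice; the other two
  pay, by the inequality \<open>u (r - 1) \<le> \<lambda> u\<^sup>2 + r (r - 1) / (4 \<lambda>)\<close>, for points that lie in \<open>r \<ge> 2\<close> arcs.\<close>

lemma sum_arcs_le:
  fixes G :: "real \<Rightarrow> complex" and c :: "'x \<Rightarrow> real"
  assumes X: "finite X" and c: "\<And>x. x \<in> X \<Longrightarrow> 0 \<le> c x \<and> c x + \<eta> \<le> 1"
    and G: "continuous_on UNIV G" and \<eta>: "\<eta> \<ge> 0" and l: "l > 0"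
    and Z: "Z = {(x, x') \<in> X \<times> X. x \<noteq> x' \<and> \<bar>c x - c x'\<bar> \<le> \<eta>}"
  shows "(\<Sum>x\<in>X. integral {0..\<eta>} (\<lambda>\<beta>. norm (G (c x + \<beta>)))) \<le> moment 1 G + l * moment 2 G + real (card Z) * \<eta> / (4 * l)"
proof -
  have G1: "continuous_on {0..1} G" using G continuous_on_subset by blast
  have nG: "continuous_on UNIV (\<lambda>\<alpha>. norm (G \<alpha>))" using G by (intro continuous_intros)
  have finZ: "finite Z" unfolding Z by (rule finite_subset[of _ "X \<times> X"]) (use X in auto)
  have cZ: "0 \<le> c (fst z) \<and> c (fst z) + \<eta> \<le> 1" if "z \<in> Z" for z using that c by (auto simp: Z)
  have i1: "((\<lambda>\<alpha>. norm (G \<alpha>)) has_integral moment 1 G) {0..1}"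
    unfolding moment_1 by (intro integrable_integral integrable_continuous_interval continuous_intros G1)
  have i2: "((\<lambda>\<alpha>. l * (norm (G \<alpha>))\<^sup>2) has_integral l * moment 2 G) {0..1}"
    unfolding moment_2 by (intro has_integral_mult_right integrable_integral integrable_continuous_interval continuous_intros G1)
  have "((\<lambda>\<alpha>. \<Sum>z\<in>Z. if \<alpha> \<in> {c (fst z)..c (fst z) + \<eta>} then 1 else 0) has_integral
      (\<Sum>z\<in>Z. integral {0..\<eta>} (\<lambda>\<beta>. 1::real))) {0..1}"
    by (rule has_integral_arcs[OF finZ cZ _ \<eta>]) auto
  then have "((\<lambda>\<alpha>. \<Sum>z\<in>Z. if \<alpha> \<in> {c (fst z)..c (fst z) + \<eta>} then 1 else 0) has_integral real (card Z) * \<eta>) {0..1}"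
    using \<eta> by simp
  from has_integral_divide[OF this, of "4 * l"]
  have i3: "((\<lambda>\<alpha>. (\<Sum>z\<in>Z. if \<alpha> \<in> {c (fst z)..c (fst z) + \<eta>} then 1 else 0) / (4 * l)) has_integral real (card Z) * \<eta> / (4 * l)) {0..1}" .
  show ?thesis
  proof (rule has_integral_le[OF has_integral_arcs[OF X c nG \<eta>] has_integral_add[OF has_integral_add[OF i1 i2] i3]])
    fix \<alpha> :: real
    define u where "u = norm (G \<alpha>)"
    define A where "A = {x\<in>X. \<alpha> \<in> {c x..c x + \<eta>}}"
    have finA: "finite A" using X by (simp add: A_def)
    define r where "r = real (card A)"
    define R where "R = (\<Sum>z\<in>Z. if \<alpha> \<in> {c (fst z)..c (fst z) + \<eta>} then 1 else (0::real))"
    \<comment> \<open>Two distinct arcs through \<alpha> start within \<eta> of each other, so every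
      ordered pair of them lies in \<open>Z\<close> and is counted by \<open>R\<close>.\<close>
    have rR: "r * (r - 1) \<le> R"
    proof -
      have "r * r = real (card (A \<times> A))" by (simp add: r_def card_cartesian_product)
      also have "A \<times> A = (\<lambda>x. (x, x)) ` A \<union> {(x, x') \<in> A \<times> A. x \<noteq> x'}" by auto
      also have "card \<dots> \<le> card ((\<lambda>x. (x, x)) ` A) + card {(x, x') \<in> A \<times> A. x \<noteq> x'}" by (rule card_Un_le)
      also have "card ((\<lambda>x. (x, x)) ` A) = card A" by (simp add: card_image inj_on_def)
      also have "card {(x, x') \<in> A \<times> A. x \<noteq> x'} \<le> card {z\<in>Z. \<alpha> \<in> {c (fst z)..c (fst z) + \<eta>}}"
        using finZ by (intro card_mono) (auto simp: A_def Z)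
      also have "real (card A + card {z\<in>Z. \<alpha> \<in> {c (fst z)..c (fst z) + \<eta>}}) = r + R"
        unfolding R_def r_def using finZ by (simp flip: sum.inter_filter)
      finally show ?thesis by (simp add: algebra_simps)
    qed
    have "(\<Sum>x\<in>X. if \<alpha> \<in> {c x..c x + \<eta>} then u else 0) = r * u"
      unfolding r_def A_def using X by (simp flip: sum.inter_filter)
    also have "\<dots> \<le> u + l * u\<^sup>2 + R / (4 * l)"
    proof (cases "card A = 0")
      case True
      then have "r = 0" by (simp add: r_def)
      moreover have "R \<ge> 0" unfolding R_def by (intro sum_nonneg) auto
      ultimately show ?thesis using l by (simp add: u_def add_nonneg_nonneg)
    next
      case False
      then have r1: "r \<ge> 1" by (simp add: r_def)
      have "(2 * l * u - (r - 1))\<^sup>2 \<ge> 0" by simp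
      then have "4 * l * (u * (r - 1)) \<le> 4 * l * (l * u\<^sup>2) + (r - 1) * (r - 1)"
        by (simp add: power2_eq_square algebra_simps)
      also have "(r - 1) * (r - 1) \<le> r * (r - 1)" using r1 by (intro mult_right_mono) auto
      also have "r * (r - 1) \<le> R" by (rule rR)
      finally have "4 * l * (u * (r - 1)) \<le> 4 * l * (l * u\<^sup>2 + R / (4 * l))" using l by (simp add: algebra_simps)
      then have "u * (r - 1) \<le> l * u\<^sup>2 + R / (4 * l)" using l by (simp add: mult_le_cancel_left)
      then show ?thesis by (simp add: algebra_simps)
    qed
    finally show "(\<Sum>x\<in>X. if \<alpha> \<in> {c x..c x + \<eta>} then norm (G \<alpha>) else 0)
        \<le> norm (G \<alpha>) + l * (norm (G \<alpha>))\<^sup>2 + (\<Sum>z\<in>Z. if \<alpha> \<in> {c (fst z)..c (fst z) + \<eta>} then 1 else 0) / (4 * l)"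
      by (simp only: u_def R_def)
  qed
qed

text \<open>Only d >= D is used, so that d divides no d' of the low part. Each of at least P/8
  squarefree d contributes (N/8 - N/16) / (6 N) = 1/96, which gives P/768.\<close>

lemma moment_1_low_part_diff_ge:
  assumes k: "k \<ge> 2" and N: "N \<ge> 1" and D: "D \<ge> 1" and K: "P = K * D" "K \<ge> 96" and P: "real P ^ (k + 1) \<le> real N"
    and l: "l > 0"
  shows "real P / 768 \<le> moment 1 (\<lambda>\<alpha>. S_k k N \<alpha> - low_part k N D \<alpha>) + l * moment 2 (\<lambda>\<alpha>. S_k k N \<alpha> - low_part k N D \<alpha>)
      + real P ^ (2 * k + 2) / (72 * (real N)\<^sup>2 * l)"
proof -
  define G where "G = (\<lambda>\<alpha>. S_k k N \<alpha> - low_part k N D \<alpha>)"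
  have Gc: "continuous_on UNIV G" unfolding G_def by (intro continuous_intros)
  define \<eta> where "\<eta> = 1 / (6 * real N)"
  have \<eta>: "\<eta> > 0" using N by (simp add: \<eta>_def)
  have P1: "P \<ge> 1" using K D by (simp add: Suc_le_eq)
  have Pk: "real P ^ k \<le> real N"
  proof -
    have "real P ^ k \<le> real P ^ (k + 1)" using P1 by (intro power_increasing) auto
    then show ?thesis using P by linarith
  qed
  define Q where "Q = {d \<in> {D..P}. mu_k 2 d = 1}"
  define X where "X = Sigma Q (kfree_numerators k)"
  define c where "c = (\<lambda>(d, a). real a / real (d ^ k))"
  have finQ: "finite Q" by (simp add: Q_def)
  have finX: "finite X" by (auto simp: X_def Q_def)
  have cX: "0 \<le> c x \<and> c x + \<eta> \<le> 1" if "x \<in> X" for x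
  proof -
    have "real P ^ k \<le> 6 * real N" using Pk by linarith
    then have "\<eta> \<le> 1 / real P ^ k" unfolding \<eta>_def using P1 N by (intro frac_le) auto
    then show ?thesis using that kfree_numerators_arc_subset D by (auto simp: X_def Q_def c_def)
  qed
  \<comment> \<open>At least P/4 integers up to P are squarefree, and fewer than D <= P/8 of them
    are lost below D.\<close>
  have cardQ: "real P / 8 \<le> real (card Q)"
  proof -
    have "real P / 4 \<le> (\<Sum>n=1..P. mu_k 2 n)" by (rule sum_mu_k_ge) simp
    also have "\<dots> = real (card {n\<in>{1..P}. mu_k 2 n = 1})"
    proof -
      have "(\<Sum>n=1..P. mu_k 2 n) = (\<Sum>n=1..P. if mu_k 2 n = 1 then 1 else 0)"
        by (intro sum.cong refl) (use mu_k_range[of 2] in auto)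
      then show ?thesis by (simp flip: sum.inter_filter)
    qed
    also have "card {n\<in>{1..P}. mu_k 2 n = 1} \<le> card ({1..<D} \<union> Q)"
      using finQ by (intro card_mono) (auto simp: Q_def)
    also have "\<dots> \<le> card {1..<D} + card Q" by (rule card_Un_le)
    finally have "real P / 4 \<le> real (card {1..<D}) + real (card Q)" by simp
    moreover have "real (card {1..<D}) \<le> real D" by simp
    moreover have "real D \<le> real P / 8"
    proof -
      have "8 * D \<le> K * D" using K by (intro mult_right_mono) auto
      then have "real (8 * D) \<le> real (K * D)" by (simp only: of_nat_le_iff)
      then show ?thesis by (simp add: K)
    qed
    ultimately show ?thesis by linarith
  qed
  define Z where "Z = {(x, x') \<in> X \<times> X. x \<noteq> x' \<and> \<bar>c x - c x'\<bar> \<le> \<eta>}"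
  have cardZ: "real (card Z) \<le> 2 * \<eta> * real P ^ (2 * k + 2)"
  proof -
    define B where "B = (\<lambda>d1 d2. {(a1, a2) \<in> {..<d1 ^ k} \<times> {..<d2 ^ k}. a1 * d2 ^ k \<noteq> a2 * d1 ^ k \<and>
      \<bar>real a1 / real (d1 ^ k) - real a2 / real (d2 ^ k)\<bar> \<le> \<eta>})"
    have finB: "finite (B d1 d2)" for d1 d2
      by (rule finite_subset[of _ "{..<d1 ^ k} \<times> {..<d2 ^ k}"]) (auto simp: B_def)
    have "Z \<subseteq> (\<Union>d1\<in>Q. \<Union>d2\<in>Q. (\<lambda>(a1, a2). ((d1, a1), (d2, a2))) ` B d1 d2)"
    proof
      fix z assume z: "z \<in> Z"
      obtain d1 a1 d2 a2 where zz: "z = ((d1, a1), (d2, a2))" by (metis surj_pair)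
      have d: "d1 \<in> Q" "d2 \<in> Q" "a1 \<in> kfree_numerators k d1" "a2 \<in> kfree_numerators k d2" "(d1, a1) \<noteq> (d2, a2)"
        "\<bar>real a1 / real (d1 ^ k) - real a2 / real (d2 ^ k)\<bar> \<le> \<eta>"
        using z by (auto simp: zz Z_def X_def c_def)
      have "d1 > 0" "d2 > 0" using d D by (auto simp: Q_def)
      then have "a1 * d2 ^ k \<noteq> a2 * d1 ^ k" using kfree_numerators_fractions_distinct[of d1 d2 a1 k a2] d by auto
      then have "(a1, a2) \<in> B d1 d2" using d by (auto simp: B_def kfree_numerators_def)
      then show "z \<in> (\<Union>d1\<in>Q. \<Union>d2\<in>Q. (\<lambda>(a1, a2). ((d1, a1), (d2, a2))) ` B d1 d2)"
        using d zz by force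
    qed
    then have "card Z \<le> card (\<Union>d1\<in>Q. \<Union>d2\<in>Q. (\<lambda>(a1, a2). ((d1, a1), (d2, a2))) ` B d1 d2)"
      using finQ finB by (intro card_mono) auto
    also have "\<dots> \<le> (\<Sum>d1\<in>Q. \<Sum>d2\<in>Q. card ((\<lambda>(a1, a2). ((d1, a1), (d2, a2))) ` B d1 d2))"
      using finQ by (intro order_trans[OF card_UN_le] sum_mono card_UN_le) auto
    also have "\<dots> \<le> (\<Sum>d1\<in>Q. \<Sum>d2\<in>Q. card (B d1 d2))"
      using finB by (intro sum_mono card_image_le) auto
    finally have "real (card Z) \<le> (\<Sum>d1\<in>Q. \<Sum>d2\<in>Q. real (card (B d1 d2)))"
      by (metis (mono_tags, lifting) of_nat_mono of_nat_sum sum.cong)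
    also have "\<dots> \<le> (\<Sum>d1\<in>Q. \<Sum>d2\<in>Q. 2 * \<eta> * real P ^ (2 * k))"
      unfolding B_def using D \<eta> by (intro sum_mono card_close_fractions_le) (auto simp: Q_def)
    also have "\<dots> = (real (card Q) * real (card Q)) * (2 * \<eta> * real P ^ (2 * k))" by simp
    also have "\<dots> \<le> (real P * real P) * (2 * \<eta> * real P ^ (2 * k))"
    proof -
      have "card Q \<le> card {1..P}" using D by (intro card_mono) (auto simp: Q_def)
      then have "card Q \<le> P" by simp
      then show ?thesis using \<eta> by (intro mult_right_mono mult_mono) auto
    qed
    finally show ?thesis by (simp add: mult_ac)
  qed
  have "real P / 768 = (real P / 8) * (1 / 96)" by simp
  also have "\<dots> \<le> real (card Q) * (1 / 96)" using cardQ by (intro mult_right_mono) auto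
  also have "\<dots> = (\<Sum>d\<in>Q. \<eta> * ((real N / 16) powr 1 * real (d ^ k) powr (1 - 1)))"
  proof -
    have "\<eta> * ((real N / 16) powr 1 * real (d ^ k) powr (1 - 1)) = 1 / 96" if "d \<in> Q" for d
      using that D N by (auto simp: Q_def \<eta>_def)
    then have "(\<Sum>d\<in>Q. \<eta> * ((real N / 16) powr 1 * real (d ^ k) powr (1 - 1))) = (\<Sum>d\<in>Q. 1 / 96)"
      by (rule sum.cong[OF refl])
    also have "\<dots> = real (card Q) * (1 / 96)" by simp
    finally show ?thesis by (rule sym)
  qed
  also have "\<dots> \<le> (\<Sum>d\<in>Q. \<Sum>a\<in>kfree_numerators k d. integral {0..\<eta>} (\<lambda>\<beta>. norm (G (real a / real (d ^ k) + \<beta>)) powr 1))"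
  proof (intro sum_mono kfree_numerators_arcs_ge Gc)
    fix d \<beta> assume d: "d \<in> Q" and \<beta>: "\<beta> \<in> {0..\<eta>}"
    have d': "D \<le> d" "1 \<le> d" "d \<le> P" using d D by (auto simp: Q_def)
    have "norm (\<Sum>a\<in>kfree_numerators k d. S_k k N (real a / real (d ^ k) + \<beta>)) = \<bar>moebius d\<bar> * norm (S_k k N \<beta>)"
      using d' k by (subst sum_kfree_numerators_S_k) (auto simp: norm_mult)
    also have "\<bar>moebius d\<bar> = 1" using d by (intro abs_moebius_squarefree squarefree_if_mu_2) (auto simp: Q_def)
    finally have 1: "real N / 8 \<le> norm (\<Sum>a\<in>kfree_numerators k d. S_k k N (real a / real (d ^ k) + \<beta>))"
      using norm_S_k_near_0[OF k N, of \<beta>] \<beta> by (auto simp: \<eta>_def)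
    have "norm (\<Sum>a\<in>kfree_numerators k d. low_part k N D (real a / real (d ^ k) + \<beta>)) \<le> 6 * real D * real d ^ k"
      using d' k N \<beta> by (intro sum_kfree_numerators_low_part_le) (auto simp: \<eta>_def)
    also have "\<dots> \<le> 6 * real D * real P ^ k" using d' by (intro mult_left_mono power_mono) auto
    \<comment> \<open>The origin of K >= 96: 96 D P^k <= K D P^k = P^(k+1) <= N.\<close>
    also have "\<dots> \<le> real N / 16"
    proof -
      have "96 * (real D * real P ^ k) \<le> real K * (real D * real P ^ k)"
        using K by (intro mult_right_mono) auto
      also have "\<dots> = real P ^ (k + 1)" by (simp add: K mult.assoc)
      also have "\<dots> \<le> real N" by (rule P)
      finally show ?thesis by simp
    qed
    finally have 2: "norm (\<Sum>a\<in>kfree_numerators k d. low_part k N D (real a / real (d ^ k) + \<beta>)) \<le> real N / 16" .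
    have "(\<Sum>a\<in>kfree_numerators k d. G (real a / real (d ^ k) + \<beta>))
        = (\<Sum>a\<in>kfree_numerators k d. S_k k N (real a / real (d ^ k) + \<beta>)) - (\<Sum>a\<in>kfree_numerators k d. low_part k N D (real a / real (d ^ k) + \<beta>))"
      by (simp add: G_def sum_subtractf)
    then show "real N / 16 \<le> norm (\<Sum>a\<in>kfree_numerators k d. G (real a / real (d ^ k) + \<beta>))"
      using 1 2 norm_triangle_ineq2[of "\<Sum>a\<in>kfree_numerators k d. S_k k N (real a / real (d ^ k) + \<beta>)" "\<Sum>a\<in>kfree_numerators k d. low_part k N D (real a / real (d ^ k) + \<beta>)"]
      by simp
  qed (use \<eta> D in \<open>auto simp: Q_def\<close>)
  also have "\<dots> = (\<Sum>x\<in>X. integral {0..\<eta>} (\<lambda>\<beta>. norm (G (c x + \<beta>))))"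
    unfolding X_def c_def by (subst sum.Sigma) (auto simp: finQ case_prod_unfold)
  also have "\<dots> \<le> moment 1 G + l * moment 2 G + real (card Z) * \<eta> / (4 * l)"
    using \<eta> l by (intro sum_arcs_le finX cX Gc Z_def) auto
  \<comment> \<open>At most P^2 pairs of denominators give 2 \<eta> P^(2k) close pairs each; with
    \<eta> = 1 / (6 N) the constant becomes 72.\<close>
  also have "real (card Z) * \<eta> / (4 * l) \<le> (2 * \<eta> * real P ^ (2 * k + 2)) * \<eta> / (4 * l)"
    using cardZ \<eta> l by (intro divide_right_mono mult_right_mono) auto
  also have "\<dots> = real P ^ (2 * k + 2) / (72 * (real N)\<^sup>2 * l)"
    using N l by (simp add: \<eta>_def power2_eq_square)
  finally show ?thesis by (simp add: G_def)
qed

text \<open>At p = 1 the triangle inequality costs no constant, unlike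
  \<open>moment_add_le\<close>.\<close>

lemma moment_1_diff_le:
  assumes "continuous_on {0..1} f" "continuous_on {0..1} g"
  shows "moment 1 (\<lambda>x. f x - g x) \<le> moment 1 f + moment 1 g"
proof -
  have "moment 1 (\<lambda>x. f x - g x) \<le> integral {0..1} (\<lambda>x. norm (f x) + norm (g x))"
    unfolding moment_1 using assms
    by (intro integral_le integrable_continuous_interval continuous_intros norm_triangle_ineq4)
  also have "\<dots> = moment 1 f + moment 1 g"
    unfolding moment_1 using assms
    by (intro integral_add integrable_continuous_interval continuous_intros)
  finally show ?thesis .
qed

lemma I_k_1_lower:
  assumes k: "k \<ge> 2"
  obtains c where "c > 0" "\<And>N. N \<ge> 1 \<Longrightarrow> real N powr (1 / real (k + 1)) \<le> c * I_k k N 1"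
proof -
  obtain C1 where C1: "C1 > 0" "\<And>N i y. y ^ (k + 1) = real N \<Longrightarrow> 2 ^ i \<le> y \<Longrightarrow>
      moment 1 (low_part k N (2 ^ i)) \<le> C1 * (2 ^ i * (y / 2 ^ i) powr (1/4))"
    using moment_1_low_part_le[OF k] by blast
  define C2 :: real where "C2 = 2 ^ (k + 1) * (1 / (1 - (1/2) powr (1/2))) powr 2"
  have "(1/2) powr (1/2) < (1::real)" using powr_less_mono2[of "1/2" "1/2::real" 1] by simp
  then have C2: "C2 > 0" by (simp add: C2_def)
  have "(1::real) < 2" by simp
  \<comment> \<open>The thresholds serve, in turn, the shifted low part (96), the overlap term
    (3072^2 / 72 = 131072 < 132096) and the L^1 norm of the low part.\<close>
  from real_arch_pow[OF this] obtain s where s: "max 96 (max (132096 * C2) (2 * (3072 * C1) ^ 4)) < (2::real) ^ s"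
    by blast
  define K :: nat where "K = 2 ^ s"
  have rK: "real K = 2 ^ s" by (simp add: K_def)
  have K: "real K \<ge> 96" "132096 * C2 \<le> real K" "2 * (3072 * C1) ^ 4 \<le> real K"
    using s unfolding rK by linarith+
  have K96: "K \<ge> 96" using K(1) by simp
  have K0: "real K > 0" using K by linarith
  \<comment> \<open>The first summand comes from y <= 2 K^2 P and P <= 3072 times the moment, the
    second from the case of bounded y.\<close>
  define c where "c = 6144 * real K ^ 2 + 48 * real K ^ 3"
  have c0: "c > 0" using K0 by (simp add: c_def add_pos_pos)
  have "real N powr (1 / real (k + 1)) \<le> c * I_k k N 1" if N: "N \<ge> 1" for N
  proof -
    define y where "y = real N powr (1 / real (k + 1))"
    have y: "y ^ (k + 1) = real N" unfolding y_def using root_power_eq[OF N] .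
    have y1: "y \<ge> 1" unfolding y_def using N by (intro ge_one_powr_ge_zero) auto
    have I48: "1 \<le> 48 * I_k k N 1"
      using I_k_lower_supercritical[OF k, of 1 N] N by simp
    show ?thesis
    proof (cases "y < real K ^ 3")
      \<comment> \<open>Here y is bounded and the arc at 0 is enough.\<close>
      case True
      have "y \<le> real K ^ 3 * 1" using True by simp
      also have "\<dots> \<le> real K ^ 3 * (48 * I_k k N 1)" using I48 by (intro mult_left_mono) auto
      also have "\<dots> \<le> c * I_k k N 1"
        unfolding c_def using I_k_nonneg[of k N 1] by (simp add: distrib_right)
      finally show ?thesis by (simp add: y_def)
    next
      case False
      have K3: "real K ^ 3 > 0" using K0 by simp
      have "1 \<le> y / real K ^ 3" using False K3 by simp
      \<comment> \<open>D is within a factor 2 of y / K^3. The factor K^2 between P and y makes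
        overlaps rare; the factor K between D and P makes the low part small.\<close>
      then obtain i where i: "2 ^ i \<le> y / real K ^ 3" "y / real K ^ 3 < 2 ^ (i + 1)"
        using ex_dyadic by blast
      define D :: nat where "D = 2 ^ i"
      have rD: "real D = 2 ^ i" by (simp add: D_def)
      have D: "D \<ge> 1" "real D * real K ^ 3 \<le> y" "y < 2 * real D * real K ^ 3"
        using i K3 by (simp_all add: D_def field_simps)
      have D0: "real D > 0" using D by simp
      define P where "P = K * D"
      have rP: "real P = real K * real D" by (simp add: P_def)
      have P0: "real P > 0" using K0 D0 by (simp add: rP)
      have Py: "real P * real K ^ 2 \<le> y" using D(2) by (simp add: rP power2_eq_square power3_eq_cube mult_ac)
      have PN: "real P ^ (k + 1) * real K ^ (2 * k + 2) \<le> real N"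
      proof -
        have "real P ^ (k + 1) * real K ^ (2 * k + 2) = (real P * real K ^ 2) ^ (k + 1)"
          by (simp only: power_mult_distrib flip: power_mult) simp
        also have "\<dots> \<le> y ^ (k + 1)" using Py by (intro power_mono) auto
        finally show ?thesis using y by simp
      qed
      have PN1: "real P ^ (k + 1) \<le> real N"
      proof -
        have "real P ^ (k + 1) * 1 \<le> real P ^ (k + 1) * real K ^ (2 * k + 2)"
          using K by (intro mult_left_mono one_le_power) auto
        then show ?thesis using PN by simp
      qed
      have Dy: "2 ^ i \<le> y"
      proof -
        have "real D * 1 \<le> real D * real K ^ 3" using K by (intro mult_left_mono one_le_power) auto
        then have "real D \<le> y" using D(2) by linarith
        then show ?thesis by (simp add: rD)
      qed
      note NJ = dyadic_index_le[OF y Dy]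
      define G where "G = (\<lambda>\<alpha>. S_k k N \<alpha> - low_part k N D \<alpha>)"
      have Geq: "G = (\<lambda>\<alpha>. \<Sum>j\<in>{i..<N}. dyadic_block k N (2 ^ j) \<alpha>)"
      proof
        fix \<alpha>
        have "S_k k N \<alpha> = low_part k N (2 ^ i) \<alpha> + (\<Sum>j\<in>{i..<N}. dyadic_block k N (2 ^ j) \<alpha>)"
          using k NJ by (intro S_k_eq_sum_dyadic_block) auto
        then show "G \<alpha> = (\<Sum>j\<in>{i..<N}. dyadic_block k N (2 ^ j) \<alpha>)" by (simp add: G_def D_def)
      qed
      have G2: "moment 2 G \<le> C2 * (real N / real D ^ (k - 1))"
        unfolding Geq using moment_2_tail_le[OF k N, of i] by (simp add: C2_def rD mult_ac)
      \<comment> \<open>Chosen so that the mean-square term is at most P/3072. The main term P/768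
        is four such shares: mean square, overlaps and low part take one each, and one is left for
        the moment.\<close>
      define l where "l = real P * real D ^ (k - 1) / (3072 * C2 * real N)"
      have l: "l > 0" using P0 D0 C2 N by (simp add: l_def)
      have "real P / 768 \<le> moment 1 G + l * moment 2 G + real P ^ (2 * k + 2) / (72 * (real N)\<^sup>2 * l)"
        unfolding G_def by (rule moment_1_low_part_diff_ge[OF k N D(1) P_def K96 PN1 l])
      moreover have "l * moment 2 G \<le> real P / 3072"
      proof -
        have "l * moment 2 G \<le> l * (C2 * (real N / real D ^ (k - 1)))" using G2 l by (intro mult_left_mono) auto
        also have "\<dots> = real P / 3072" using C2 N D0 by (simp add: l_def)
        finally show ?thesis .
      qed
      moreover have "real P ^ (2 * k + 2) / (72 * (real N)\<^sup>2 * l) \<le> real P / 3072"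
      proof -
        have N0: "real N > 0" using N by simp
        have "2 * k + 2 = (k + 1) + ((k - 1) + 2)" using k by simp
        then have "real P ^ (2 * k + 2) = real P ^ (k + 1) * (real P ^ (k - 1) * real P ^ 2)"
          by (simp only: power_add)
        also have "real P ^ (k - 1) = real K ^ (k - 1) * real D ^ (k - 1)" by (simp add: rP power_mult_distrib)
        finally have Pe: "real P ^ (2 * k + 2) = real P ^ (k + 1) * (real K ^ (k - 1) * real D ^ (k - 1) * real P ^ 2)" .
        have "real P ^ (2 * k + 2) / (72 * (real N)\<^sup>2 * l) = real P ^ (k + 1) * real K ^ (k - 1) * real P * (3072 * C2) / (72 * real N)"
          unfolding Pe l_def using N0 C2 D0 P0 by (simp add: field_simps power2_eq_square)
        also have "\<dots> \<le> real N / real K * real P * (3072 * C2) / (72 * real N)"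
        proof (intro divide_right_mono mult_right_mono)
          have "real P ^ (k + 1) * (real K ^ (k - 1) * real K) \<le> real P ^ (k + 1) * real K ^ (2 * k + 2)"
          proof (intro mult_left_mono)
            have "real K ^ (k - 1) * real K = real K ^ ((k - 1) + 1)" by (simp only: power_add power_one_right)
            also have "\<dots> \<le> real K ^ (2 * k + 2)" using K by (intro power_increasing) auto
            finally show "real K ^ (k - 1) * real K \<le> real K ^ (2 * k + 2)" .
          qed auto
          also note PN
          finally show "real P ^ (k + 1) * real K ^ (k - 1) \<le> real N / real K"
            using K0 by (simp add: pos_le_divide_eq mult.assoc)
        qed (use P0 C2 in auto)
        also have "\<dots> = real P * (3072 * C2) / (72 * real K)" using N0 by simp
        also have "\<dots> \<le> real P / 3072"
        proof -
          have "3072 * (3072 * C2) \<le> 72 * real K" using K(2) C2 by linarith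
          then have "real P * (3072 * (3072 * C2)) \<le> real P * (72 * real K)" using P0 by (intro mult_left_mono) auto
          then show ?thesis using K0 by (simp add: field_simps)
        qed
        finally show ?thesis .
      qed
      moreover have "moment 1 (low_part k N D) \<le> real P / 3072"
      proof -
        have "moment 1 (low_part k N D) \<le> C1 * (real D * (y / real D) powr (1/4))"
          using C1(2)[OF y Dy] by (simp add: D_def)
        also have "\<dots> \<le> C1 * (real D * (2 * real K ^ 3) powr (1/4))"
          using D D0 C1(1) y1 by (intro mult_left_mono powr_mono2) (auto simp: field_simps)
        also have "\<dots> = real D / 3072 * (3072 * C1 * (2 * real K ^ 3) powr (1/4))" by simp
        also have "\<dots> \<le> real D / 3072 * real K"
        proof (intro mult_left_mono)
          \<comment> \<open>The claim reduces to 2 b^4 <= K, since the fourth root of K^3 falls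
            short of K by a factor K^(1/4).\<close>
          define b where "b = 3072 * C1"
          have b: "b > 0" "2 * b ^ 4 \<le> real K" using C1(1) K(3) by (simp_all only: b_def)
          have "b = (b ^ 4) powr (1/4)" using b(1) by (simp add: power_powr)
          then have "b * (2 * real K ^ 3) powr (1/4) = (b ^ 4) powr (1/4) * (2 * real K ^ 3) powr (1/4)"
            by (rule arg_cong)
          also have "\<dots> = (2 * b ^ 4 * real K ^ 3) powr (1/4)"
            unfolding powr_mult[symmetric] by (simp only: mult_ac)
          also have "\<dots> \<le> (real K * real K ^ 3) powr (1/4)"
            using b by (intro powr_mono2 mult_right_mono) auto
          also have "real K * real K ^ 3 = real K ^ 4" by (simp flip: power_Suc)
          also have "(real K ^ 4) powr (1/4) = real K" using K0 by (simp add: power_powr)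
          finally show "3072 * C1 * (2 * real K ^ 3) powr (1/4) \<le> real K" by (simp only: b_def)
        qed auto
        also have "\<dots> = real P / 3072" by (simp add: rP)
        finally show ?thesis .
      qed
      moreover have "moment 1 G \<le> I_k k N 1 + moment 1 (low_part k N D)"
        unfolding G_def I_k_eq_mom by (intro moment_1_diff_le continuous_intros)
      ultimately have "real P \<le> 3072 * I_k k N 1" by linarith
      then have "2 * real K ^ 2 * real P \<le> 2 * real K ^ 2 * (3072 * I_k k N 1)" by (intro mult_left_mono) auto
      moreover have "y \<le> 2 * real K ^ 2 * real P"
        using D(3) by (simp add: rP power2_eq_square power3_eq_cube mult_ac)
      moreover have "2 * real K ^ 2 * (3072 * I_k k N 1) \<le> c * I_k k N 1"
        unfolding c_def using I_k_nonneg[of k N 1] by (simp add: distrib_right)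
      ultimately show ?thesis unfolding y_def by linarith
    qed
  qed
  then show ?thesis using that c0 by blast
qed

section \<open>From the first moment to all subcritical exponents\<close>

lemma I_k_pos:
  assumes "k \<ge> 2" "p \<ge> 0" "N \<ge> 1"
  shows "I_k k N p > 0"
proof (rule ccontr)
  assume "\<not> I_k k N p > 0"
  then have "6 * 8 powr p * I_k k N p \<le> 0" by (intro mult_nonneg_nonpos) auto
  moreover have "real N powr (p - 1) > 0" using assms by simp
  ultimately show False using I_k_lower_supercritical[OF assms] by linarith
qed

text \<open>For p >= 1 Lyapunov's inequality suffices. For p < 1 the exponent 1 lies between p and
  some subcritical q > 1, so the lower bound at 1 and the upper bound at q force a lower bound at
  p.\<close>

lemma I_k_lower_subcritical:
  assumes k: "k \<ge> 2" and p: "0 \<le> p" "p < 1 + 1 / real k"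
  obtains C where "C > 0" "\<And>N. N \<ge> 1 \<Longrightarrow> real N powr (p / real (k + 1)) \<le> C * I_k k N p"
proof -
  obtain c where c: "c > 0" "\<And>N. N \<ge> 1 \<Longrightarrow> real N powr (1 / real (k + 1)) \<le> c * I_k k N 1"
    using I_k_1_lower[OF k] by blast
  show ?thesis
  proof (cases "p \<ge> 1")
    case True
    have "real N powr (p / real (k + 1)) \<le> c powr p * I_k k N p" if N: "N \<ge> 1" for N
    proof -
      have "moment 1 (S_k k N) \<le> (I_k k N p) powr (1 / p)"
        using True I_k_pos[OF k p(1) N] by (intro moment_lyapunov continuous_intros) (auto simp: I_k_eq_mom)
      then have "c * I_k k N 1 \<le> c * (I_k k N p) powr (1 / p)"
        using c(1) by (intro mult_left_mono) (auto simp: I_k_eq_mom)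
      then have "(real N powr (1 / real (k + 1))) powr p \<le> (c * (I_k k N p) powr (1 / p)) powr p"
        using c(2)[OF N] p by (intro powr_mono2) auto
      also have "\<dots> = c powr p * I_k k N p"
        using True I_k_nonneg[of k N p] by (simp add: powr_mult powr_powr)
      finally show ?thesis by (simp add: powr_powr)
    qed
    then show ?thesis using c(1) by (intro that[of "c powr p"]) auto
  next
    case False
    \<comment> \<open>Any exponent strictly between 1 and the critical one would serve.\<close>
    define q where "q = 1 + 1 / (2 * real k)"
    have q: "1 < q" "0 \<le> q" "q < 1 + 1 / real k" using k by (auto simp: q_def field_simps add_nonneg_nonneg)
    obtain B where B: "B > 0" "\<And>N. N \<ge> 1 \<Longrightarrow> I_k k N q \<le> B * real N powr (q / real (k + 1))"
      using I_k_upper_subcritical[OF k q(2,3)] by blast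
    define t where "t = (q - 1) / (q - p)"
    have qp: "q - p > 0" using q False by linarith
    have t: "0 < t" "t \<le> 1" using q False qp by (auto simp: t_def)
    have tq: "1 = t * p + (1 - t) * q"
    proof -
      have "t * (q - p) = q - 1" using qp by (simp add: t_def)
      then show ?thesis by (simp add: algebra_simps)
    qed
    define E where "E = (c * B powr (1 - t)) powr (1 / t)"
    have "real N powr (p / real (k + 1)) \<le> E * I_k k N p" if N: "N \<ge> 1" for N
    proof -
      define y where "y = real N powr (1 / real (k + 1))"
      have y: "y > 0" using N by (simp add: y_def)
      have yr: "real N powr (r / real (k + 1)) = y powr r" for r by (simp add: y_def powr_powr)
      have "moment 1 (S_k k N) \<le> (I_k k N p) powr t * (B * y powr q) powr (1 - t)"
        using t q p I_k_pos[OF k p(1) N] B(1) B(2)[OF N, unfolded yr] y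
        by (intro moment_interpolate[where q = p and s = q] tq continuous_intros) (auto simp: I_k_eq_mom)
      also have "\<dots> = (I_k k N p) powr t * (B powr (1 - t) * y powr (q * (1 - t)))"
        by (simp only: powr_mult powr_powr)
      finally have "c * I_k k N 1 \<le> c * ((I_k k N p) powr t * (B powr (1 - t) * y powr (q * (1 - t))))"
        using c(1) by (intro mult_left_mono) (auto simp: I_k_eq_mom)
      then have "y powr 1 \<le> (c * B powr (1 - t)) * (I_k k N p) powr t * y powr (q * (1 - t))"
        using c(2)[OF N] y by (simp add: y_def mult_ac)
      \<comment> \<open>The subcritical order of magnitude y^p has an exponent linear in p, so the
        powers of y cancel without loss.\<close>
      also have "y powr 1 = y powr (t * p) * y powr (q * (1 - t))"
        using tq by (subst powr_add[symmetric]) (simp add: mult.commute)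
      finally have "y powr (t * p) \<le> (c * B powr (1 - t)) * (I_k k N p) powr t"
        using y by (simp add: mult_le_cancel_right)
      then have "(y powr (t * p)) powr (1 / t) \<le> ((c * B powr (1 - t)) * (I_k k N p) powr t) powr (1 / t)"
        using t by (intro powr_mono2) auto
      also have "\<dots> = E * I_k k N p"
        using t I_k_nonneg[of k N p] by (simp only: powr_mult powr_powr E_def) simp
      finally show ?thesis unfolding yr using t by (simp add: powr_powr)
    qed
    moreover have "E > 0" using c(1) B(1) by (simp add: E_def)
    ultimately show ?thesis using that by blast
  qed
qed

lemma ll_onI:
  assumes "C > 0" "\<And>N. N \<ge> 2 \<Longrightarrow> f N \<le> C * g N" "\<And>N. N \<ge> 2 \<Longrightarrow> f N \<ge> 0"
  shows "ll_on {2..} f g"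
  unfolding ll_on_def using assms by (intro exI[of _ C]) auto

theorem theorem1p2:
  fixes k :: nat and p :: real
  assumes "k \<ge> 2"
  shows "(p > 1 + 1 / real k \<longrightarrow>
           ll_on {2..} (\<lambda>N. real N powr (p - 1)) (\<lambda>N. I_k k N p) \<and>
           ll_on {2..} (\<lambda>N. I_k k N p) (\<lambda>N. real N powr (p - 1))) \<and>
         (p = 1 + 1 / real k \<longrightarrow>
           ll_on {2..} (\<lambda>N. real N powr (1 / real k) * ln (real N)) (\<lambda>N. I_k k N p) \<and>
           ll_on {2..} (\<lambda>N. I_k k N p) (\<lambda>N. real N powr (1 / real k) * (ln (real N))\<^sup>2)) \<and>
         (0 \<le> p \<and> p < 1 + 1 / real k \<longrightarrow>
           ll_on {2..} (\<lambda>N. real N powr (p / real (k + 1))) (\<lambda>N. I_k k N p) \<and>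
           ll_on {2..} (\<lambda>N. I_k k N p) (\<lambda>N. real N powr (p / real (k + 1))))"
proof (intro conjI impI)
  assume p: "p > 1 + 1 / real k"
  have "1 / real k \<ge> 0" by simp
  then have "p \<ge> 0" using p by linarith
  then show "ll_on {2..} (\<lambda>N. real N powr (p - 1)) (\<lambda>N. I_k k N p)"
    using I_k_lower_supercritical[OF assms] by (intro ll_onI[of "6 * 8 powr p"]) auto
  obtain C where "C > 0" "\<And>N. N \<ge> 1 \<Longrightarrow> I_k k N p \<le> C * real N powr (p - 1)"
    using I_k_upper_supercritical[OF assms p] by blast
  then show "ll_on {2..} (\<lambda>N. I_k k N p) (\<lambda>N. real N powr (p - 1))"
    by (intro ll_onI[of C]) (auto simp: I_k_nonneg)
next
  assume p: "p = 1 + 1 / real k"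
  show "ll_on {2..} (\<lambda>N. real N powr (1 / real k) * ln (real N)) (\<lambda>N. I_k k N p)"
    using I_k_lower_critical[OF assms p] assms by (intro ll_onI[of "48 * real k * 8 powr p"]) auto
  obtain C where "C > 0" "\<And>N. N \<ge> 2 \<Longrightarrow> I_k k N p \<le> C * (real N powr (1 / real k) * (ln (real N))\<^sup>2)"
    using I_k_upper_critical[OF assms p] by blast
  then show "ll_on {2..} (\<lambda>N. I_k k N p) (\<lambda>N. real N powr (1 / real k) * (ln (real N))\<^sup>2)"
    by (intro ll_onI[of C]) (auto simp: I_k_nonneg)
next
  assume "0 \<le> p \<and> p < 1 + 1 / real k"
  then have p: "0 \<le> p" "p < 1 + 1 / real k" by auto
  obtain C where "C > 0" "\<And>N. N \<ge> 1 \<Longrightarrow> real N powr (p / real (k + 1)) \<le> C * I_k k N p"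
    using I_k_lower_subcritical[OF assms p] by blast
  then show "ll_on {2..} (\<lambda>N. real N powr (p / real (k + 1))) (\<lambda>N. I_k k N p)"
    by (intro ll_onI[of C]) auto
  obtain C' where "C' > 0" "\<And>N. N \<ge> 1 \<Longrightarrow> I_k k N p \<le> C' * real N powr (p / real (k + 1))"
    using I_k_upper_subcritical[OF assms p] by blast
  then show "ll_on {2..} (\<lambda>N. I_k k N p) (\<lambda>N. real N powr (p / real (k + 1)))"
    by (intro ll_onI[of C']) (auto simp: I_k_nonneg)
qed

end
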